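(* Let $(\mathcal C_0[0,T],\mu_0)$ be classical Wiener space, let $\mathcal P_0$ be the set of Borel probability measures $\mu$ on $\mathcal C_0[0,T]$ with $\mu\sim\mu_0$, and define $D:\mathcal P_0\to[0,\infty)$ by $$D(\mu):=D_{KL}(\mu\|\mu_0)-\frac12\int_0^T\left(\partial_sE_\mu[B(s)]\right)^2ds.$$ Then for all $\mu\in\mathcal P_0$, $D(\mu)\ge0$. Additionally, $D(\mu)=0$ if and only if $\mu$ corresponds to a state independent drift.
   Context: Classical Wiener space: $\mathcal C_0[0,T]$ is the space of continuous functions on $[0,T]$ vanishing at $0$, with the supremum norm, and $\mu_0$ is the law of standard Brownian motion $B$ ($B$ also denotes the coordinate process). $\mu\sim\mu_0$ means mutual absolute continuity. $D_{KL}(\mu\|\mu_0)=E_\mu[\log(d\mu/d\mu_0)]$. For every $\mu\sim\mu_0$ there is a progressively measurable process $F$ with sample paths almost surely in $W_0^{1,2}=\{F:F(t)=\int_0^tg(s)\,ds,\ g\in L^2[0,T]\}$ such that $B(t)-F(t)$ is a Brownian motion under $\mu$; one says that $F$ (the drift) corresponds to $\mu$. The drift is state independent if $F$ is a deterministic path, i.e. does not depend on the underlying process $B$.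
   Formalization: D takes values in [0,∞] instead of [0,∞): since D_KL(μ‖μ_0) can be infinite for μ∼μ_0, D(μ) is set to ∞ in that case (also where the difference would be ∞−∞); when D_KL is finite, D(μ) is the stated expression. *)

theory Defs
  imports "HOL-Probability.Probability"
begin

section \<open>The path space\<close>

text \<open>Paths are functions on the closed interval, extended by \<^const>\<open>undefined\<close> outside of it (this is
  how \<^const>\<open>cfunspace\<close> represents functions on a subspace); the metric is the supremum metric.\<close>

definition C0_metric :: "real \<Rightarrow> (real \<Rightarrow> real) metric" where
  "C0_metric T = submetric (cfunspace (top_of_set {0..T}) euclidean_metric) {w. w 0 = 0}"

abbreviation C0 :: "real \<Rightarrow> (real \<Rightarrow> real) set" where
  "C0 T \<equiv> mspace (C0_metric T)"

definition C0_borel :: "real \<Rightarrow> (real \<Rightarrow> real) measure" where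
  "C0_borel T = sigma (C0 T) {U. openin (mtopology_of (C0_metric T)) U}"

lemma C0_eq: "C0 T = {w \<in> extensional {0..T}. continuous_on {0..T} w \<and> w 0 = 0}"
proof -
  have "mtopology_of (euclidean_metric :: real metric) = euclidean"
    by (simp add: mtopology_of_def)
  moreover have "Met_TC.mbounded (w ` {0..T})" if "continuous_on {0..T} w" for w :: "real \<Rightarrow> real"
    using compact_continuous_image[OF that] compact_imp_bounded by auto
  ultimately show ?thesis
    unfolding C0_metric_def by auto
qed

lemma mdist_C0:
  assumes "0 \<le> T" "v \<in> C0 T" "w \<in> C0 T"
  shows "mdist (C0_metric T) v w = (SUP t\<in>{0..T}. \<bar>v t - w t\<bar>)"
proof -
  have "v \<in> Met_TC.fspace {0..T}" "w \<in> Met_TC.fspace {0..T}"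
    using assms unfolding C0_metric_def by (auto simp: Met_TC.fspace_def)
  then show ?thesis
    using assms(1) unfolding C0_metric_def
    by (simp add: mdist_cfunspace_eq_mdist_funspace Met_TC.fdist_def dist_real_def)
qed

lemma space_C0_borel [simp]: "space (C0_borel T) = C0 T"
  by (simp add: C0_borel_def space_measure_of_conv)

section \<open>Brownian motion and Wiener measure\<close>

text \<open>The \<open>\<sigma>\<close>-algebra of the path up to time \<open>t\<close>.\<close>

definition path_filtration :: "real \<Rightarrow> real \<Rightarrow> (real \<Rightarrow> real) measure" where
  "path_filtration T t =
     sigma (C0 T) {(\<lambda>w. w s) -` A \<inter> C0 T | s A. s \<in> {0..t} \<and> A \<in> sets (borel :: real measure)}"

text \<open>Standard Brownian motion on \<open>[0,T]\<close> relative to the filtration of the coordinate process. For the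
  coordinate process itself, and for its translates by a deterministic path, independence of the past
  of the filtration is the same as independence of the increments.\<close>

definition brownian_motion ::
  "real \<Rightarrow> (real \<Rightarrow> real) measure \<Rightarrow> (real \<Rightarrow> (real \<Rightarrow> real) \<Rightarrow> real) \<Rightarrow> bool" where
  "brownian_motion T M X \<longleftrightarrow>
     (\<forall>t\<in>{0..T}. X t \<in> borel_measurable (path_filtration T t)) \<and>
     (AE w in M. X 0 w = 0) \<and>
     (AE w in M. continuous_on {0..T} (\<lambda>t. X t w)) \<and>
     (\<forall>s t. 0 \<le> s \<and> s < t \<and> t \<le> T \<longrightarrow>
        distributed M lborel (\<lambda>w. X t w - X s w) (normal_density 0 (sqrt (t - s))) \<and>
        prob_space.indep_set M (sets (path_filtration T s))
          (sets (vimage_algebra (space M) (\<lambda>w. X t w - X s w) borel)))"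

definition wiener_measure :: "real \<Rightarrow> (real \<Rightarrow> real) measure \<Rightarrow> bool" where
  "wiener_measure T \<mu>0 \<longleftrightarrow>
     prob_space \<mu>0 \<and> sets \<mu>0 = sets (C0_borel T) \<and> brownian_motion T \<mu>0 (\<lambda>t w. w t)"

text \<open>The set \<open>\<P>\<^sub>0\<close>.\<close>

definition equivalent_measures :: "real \<Rightarrow> (real \<Rightarrow> real) measure \<Rightarrow> (real \<Rightarrow> real) measure set" where
  "equivalent_measures T \<mu>0 =
     {\<mu>. prob_space \<mu> \<and> sets \<mu> = sets (C0_borel T) \<and>
         absolutely_continuous \<mu>0 \<mu> \<and> absolutely_continuous \<mu> \<mu>0}"

section \<open>Drifts\<close>

definition W012 :: "real \<Rightarrow> (real \<Rightarrow> real) set" where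
  "W012 T = {f. \<exists>g. set_borel_measurable lborel {0..T} g \<and>
                    set_integrable lborel {0..T} (\<lambda>s. (g s)\<^sup>2) \<and>
                    (\<forall>t\<in>{0..T}. f t = (LBINT s:{0..t}. g s))}"

definition progressively_measurable :: "real \<Rightarrow> (real \<Rightarrow> (real \<Rightarrow> real) \<Rightarrow> real) \<Rightarrow> bool" where
  "progressively_measurable T F \<longleftrightarrow>
     (\<forall>t\<in>{0..T}. (\<lambda>(s, w). F s w)
        \<in> borel_measurable (restrict_space borel {0..t} \<Otimes>\<^sub>M path_filtration T t))"

definition drift_of ::
  "real \<Rightarrow> (real \<Rightarrow> real) measure \<Rightarrow> (real \<Rightarrow> (real \<Rightarrow> real) \<Rightarrow> real) \<Rightarrow> bool" where
  "drift_of T \<mu> F \<longleftrightarrow>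
     progressively_measurable T F \<and>
     (AE w in \<mu>. (\<lambda>t. F t w) \<in> W012 T) \<and>
     brownian_motion T \<mu> (\<lambda>t w. w t - F t w)"

definition state_independent :: "real \<Rightarrow> (real \<Rightarrow> (real \<Rightarrow> real) \<Rightarrow> real) \<Rightarrow> bool" where
  "state_independent T F \<longleftrightarrow> (\<exists>f. \<forall>w\<in>C0 T. \<forall>t\<in>{0..T}. F t w = f t)"

section \<open>The functional\<close>

text \<open>\<^const>\<open>KL_divergence\<close> is a Bochner integral, hence \<open>0\<close> when the integrand is not integrable. The
  negative part of \<open>log (d\<mu>/d\<mu>0)\<close> is always \<open>\<mu>\<close>-integrable, so non-integrability means \<open>\<infinity>\<close>.
  Note the order of the arguments: \<open>KL_divergence b \<mu>0 \<mu>\<close> integrates against \<open>\<mu>\<close>.\<close>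

definition D_KL :: "'a measure \<Rightarrow> 'a measure \<Rightarrow> ereal" where
  "D_KL \<mu> \<mu>0 =
     (if integrable \<mu> (entropy_density (exp 1) \<mu>0 \<mu>) then ereal (KL_divergence (exp 1) \<mu>0 \<mu>) else \<infinity>)"

definition mean_path :: "(real \<Rightarrow> real) measure \<Rightarrow> real \<Rightarrow> real" where
  "mean_path \<mu> s = (\<integral>w. w s \<partial>\<mu>)"

text \<open>If \<open>D_KL \<mu> \<mu>0\<close> is finite then the mean path exists and is absolutely continuous, so \<^const>\<open>deriv\<close>
  is its derivative almost everywhere and the value is a real number. If \<open>D_KL \<mu> \<mu>0 = \<infinity>\<close>, where
  the mean path may fail to be differentiable or even to exist, the value is \<open>\<infinity>\<close>, since
  \<open>\<infinity> - x = \<infinity>\<close> for every extended real \<open>x\<close>.\<close>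

definition D_functional :: "real \<Rightarrow> (real \<Rightarrow> real) measure \<Rightarrow> (real \<Rightarrow> real) measure \<Rightarrow> ereal" where
  "D_functional T \<mu>0 \<mu> =
     D_KL \<mu> \<mu>0 -
     ereal (1/2) * enn2ereal (\<integral>\<^sup>+s\<in>{0..T}. ennreal ((deriv (mean_path \<mu>) s)\<^sup>2) \<partial>lborel)"

end

theory Submission
  imports Defs
begin

text \<open>
Let \<open>m\<close> be the mean path of \<open>\<mu>\<close> and let \<open>D\<close> be the density of \<open>\<mu>\<close> with respect to Wiener measure. On
the dyadic grid of level \<open>n\<close> let \<open>h\<close> be the step function of the slopes of \<open>m\<close>, and call its squared
norm the energy of \<open>m\<close> at level \<open>n\<close>. The exponential \<open>z\<close> of the Wiener integral of \<open>h\<close> minus one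
half of the energy is a probability density (\<open>cm_density\<close>), because the increments of Brownian motion
are independent Gaussians. Under \<open>\<mu>\<close> the mean of the Wiener integral of \<open>h\<close> is the energy. So, if the
relative entropy of \<open>\<mu>\<close> is finite, the nonnegative function \<open>D * ln D - D - D * ln z + z\<close> has the mean
\<open>D_KL \<mu> \<mu>0 - energy / 2\<close> under Wiener measure (\<open>entropy_gap_cm_density\<close>); this is the relative entropy of \<open>\<mu>\<close> with respect to the measure with
density \<open>z\<close>.

Consequently the energies of \<open>m\<close> are at most twice the entropy. A continuous path with bounded energies
is the integral of a function \<open>g\<close> whose squared norm is at most the limit of the energies
(\<open>finite_energy_imp_primitive\<close>), because the step functions of the slopes are a martingale bounded in
\<open>L\<^sup>2\<close>. By Lebesgue's differentiation theorem \<open>g\<close> is almost everywhere the derivative of \<open>m\<close>, and the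
functional is nonnegative.

If the functional vanishes, then the limit of the energies is twice the entropy, and the functions
above tend to \<open>0\<close> in mean. They measure a strictly convex gap between \<open>D\<close> and \<open>z\<close>, so \<open>z\<close> tends to
\<open>D\<close> almost surely along a subsequence (\<open>tilted_eq_shifted\<close>). The functions \<open>z\<close> are themselves a
martingale bounded in \<open>L\<^sup>2\<close>, and their limit is the density of the law of Brownian motion shifted by
\<open>m\<close> (\<open>cameron_martin\<close>). So \<open>\<mu>\<close> is this law, and the drift \<open>m\<close> corresponds to it.

Conversely let \<open>f\<close> be a deterministic drift that corresponds to \<open>\<mu>\<close>. Then \<open>\<mu>\<close> is the law of Brownian
motion shifted by \<open>f\<close>, since the law of the increments determines the measure, and its mean path is
\<open>f\<close>. Fatou's lemma shows that the entropy is at most one half of the squared norm of the derivative of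
\<open>f\<close> (\<open>entropy_drifted_le\<close>), so it is finite and the functional is at most \<open>0\<close>.

Only step functions are integrated against Brownian motion; both passages to the limit rest on
\<open>L2_bounded_martingale_converges\<close>. That a measure on the path space is determined by its values on
cylinders at dyadic times is shown first.
\<close>

section \<open>Dyadic cylinders generate the Borel sets of the path space\<close>

definition grid :: "real \<Rightarrow> nat \<Rightarrow> nat \<Rightarrow> real" where
  "grid T N i = T * real i / real N"

lemma grid_mem: "0 \<le> T \<Longrightarrow> i \<le> N \<Longrightarrow> grid T N i \<in> {0..T}"
  by (cases "N = 0") (auto simp: grid_def divide_simps mult_left_mono)

lemma grid_0 [simp]: "grid T N 0 = 0"
  by (simp add: grid_def)

lemma grid_refine: "0 < K \<Longrightarrow> grid T (N * K) (i * K) = grid T N i"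
  by (simp add: grid_def)

lemma C0_continuous_on: "w \<in> C0 T \<Longrightarrow> continuous_on {0..T} w"
  and C0_at_0: "w \<in> C0 T \<Longrightarrow> w 0 = 0"
  unfolding C0_eq by auto

lemma space_path_filtration [simp]: "space (path_filtration T t) = C0 T"
  by (simp add: path_filtration_def space_measure_of_conv)

lemma sets_path_filtration:
  "sets (path_filtration T t) =
     sigma_sets (C0 T) {(\<lambda>w. w s) -` A \<inter> C0 T | s A. s \<in> {0..t} \<and> A \<in> sets (borel :: real measure)}"
  unfolding path_filtration_def by (rule sets_measure_of) auto

lemma measurable_coordinate:
  "s \<in> {0..t} \<Longrightarrow> (\<lambda>w. w s) \<in> borel_measurable (path_filtration T t)"
  by (rule measurableI) (auto simp: sets_path_filtration intro!: sigma_sets.Basic)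

lemma measurable_into_path_filtration:
  assumes "f \<in> space M \<rightarrow> C0 T" "\<And>s. s \<in> {0..t} \<Longrightarrow> (\<lambda>x. f x s) \<in> borel_measurable M"
  shows "f \<in> measurable M (path_filtration T t)"
  unfolding path_filtration_def
proof (rule measurable_measure_of)
  show "f -` y \<inter> space M \<in> sets M"
    if "y \<in> {(\<lambda>w. w s) -` A \<inter> C0 T |s A. s \<in> {0..t} \<and> A \<in> sets borel}" for y
  proof -
    from that obtain s A where y: "y = (\<lambda>w. w s) -` A \<inter> C0 T" "s \<in> {0..t}" "A \<in> sets borel"
      by auto
    have "f -` y \<inter> space M = (\<lambda>x. f x s) -` A \<inter> space M"
      using assms(1) y(1) by auto
    then show ?thesis
      using measurable_sets[OF assms(2)[OF y(2)] y(3)] by simp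
  qed
qed (use assms(1) in auto)

lemma sets_path_filtration_mono:
  "s \<le> t \<Longrightarrow> sets (path_filtration T s) \<subseteq> sets (path_filtration T t)"
  unfolding sets_path_filtration by (rule sigma_sets_mono') force

lemma sets_C0_borel: "sets (C0_borel T) = sigma_sets (C0 T) {U. openin (mtopology_of (C0_metric T)) U}"
  proof -
  have "{U. openin (mtopology_of (C0_metric T)) U} \<subseteq> Pow (C0 T)"
    using openin_subset[of "mtopology_of (C0_metric T)"] by auto
  then show ?thesis
    unfolding C0_borel_def by (rule sets_measure_of)
qed

lemma openin_C0_iff:
  assumes "0 \<le> T"
  shows "openin (mtopology_of (C0_metric T)) U \<longleftrightarrow>
    U \<subseteq> C0 T \<and> (\<forall>w\<in>U. \<exists>r>0. \<forall>v\<in>C0 T. (SUP t\<in>{0..T}. \<bar>w t - v t\<bar>) < r \<longrightarrow> v \<in> U)"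
proof -
  have "Metric_space.mball (C0 T) (mdist (C0_metric T)) w r
    = {v\<in>C0 T. (SUP t\<in>{0..T}. \<bar>w t - v t\<bar>) < r}" if "w \<in> C0 T" for w r
    using that by (auto simp: Metric_space.mball_def[OF Metric_space_mspace_mdist] mdist_C0[OF assms])
  then have "Metric_space.mball (C0 T) (mdist (C0_metric T)) w r \<subseteq> U \<longleftrightarrow>
    (\<forall>v\<in>C0 T. (SUP t\<in>{0..T}. \<bar>w t - v t\<bar>) < r \<longrightarrow> v \<in> U)" if "w \<in> C0 T" for w r
    using that by blast
  then show ?thesis
    unfolding mtopology_of_def Metric_space.openin_mtopology[OF Metric_space_mspace_mdist] Ball_def
    by (meson subsetD)
qed

lemma bdd_above_C0_diff:
  assumes "v \<in> C0 T" "w \<in> C0 T"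
  shows "bdd_above ((\<lambda>t. \<bar>v t - w t\<bar>) ` {0..T})"
proof -
  have "continuous_on {0..T} (\<lambda>t. \<bar>v t - w t\<bar>)"
    using assms by (intro continuous_intros C0_continuous_on)
  then show ?thesis
    by (intro bounded_imp_bdd_above compact_imp_bounded compact_continuous_image) auto
qed

lemma measurable_coordinate_C0_borel:
  assumes "0 \<le> T" "s \<in> {0..T}"
  shows "(\<lambda>w. w s) \<in> borel_measurable (C0_borel T)"
proof (rule borel_measurableI)
  fix A :: "real set" assume "open A"
  have "openin (mtopology_of (C0_metric T)) {w\<in>C0 T. w s \<in> A}"
    unfolding openin_C0_iff[OF assms(1)]
  proof safe
    fix w assume w: "w \<in> C0 T" "w s \<in> A"
    then obtain e where e: "e > 0" "\<And>y. dist y (w s) < e \<Longrightarrow> y \<in> A"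
      using \<open>open A\<close> by (metis open_dist)
    have "v s \<in> A" if v: "v \<in> C0 T" "(SUP t\<in>{0..T}. \<bar>w t - v t\<bar>) < e" for v
    proof -
      have "\<bar>w s - v s\<bar> \<le> (SUP t\<in>{0..T}. \<bar>w t - v t\<bar>)"
        by (rule cSUP_upper[OF assms(2) bdd_above_C0_diff[OF w(1) v(1)]])
      then show ?thesis
        using v(2) by (intro e(2)) (simp add: dist_real_def)
    qed
    then show "\<exists>r>0. \<forall>v\<in>C0 T. (SUP t\<in>{0..T}. \<bar>w t - v t\<bar>) < r \<longrightarrow> v \<in> {w\<in>C0 T. w s \<in> A}"
      using e(1) by blast
  qed
  then have "{w\<in>C0 T. w s \<in> A} \<in> sets (C0_borel T)"
    unfolding sets_C0_borel by (intro sigma_sets.Basic) simp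
  moreover have "(\<lambda>w. w s) -` A \<inter> space (C0_borel T) = {w\<in>C0 T. w s \<in> A}"
    by auto
  ultimately show "(\<lambda>w. w s) -` A \<inter> space (C0_borel T) \<in> sets (C0_borel T)"
    by (simp only:)
qed

lemma sets_path_filtration_subset:
  assumes "0 \<le> T" "t \<le> T"
  shows "sets (path_filtration T t) \<subseteq> sets (C0_borel T)"
proof -
  have "(\<lambda>w. w) \<in> measurable (C0_borel T) (path_filtration T t)"
  proof (rule measurable_into_path_filtration)
    show "(\<lambda>w. w s) \<in> borel_measurable (C0_borel T)" if "s \<in> {0..t}" for s
      using assms that by (intro measurable_coordinate_C0_borel) auto
  qed simp
  show ?thesis
  proof
    fix A assume A: "A \<in> sets (path_filtration T t)"
    then have "(\<lambda>w. w) -` A \<inter> space (C0_borel T) = A"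
      using sets.sets_into_space[OF A] by auto
    with measurable_sets[OF \<open>(\<lambda>w. w) \<in> measurable (C0_borel T) (path_filtration T t)\<close> A]
    show "A \<in> sets (C0_borel T)"
      by (simp only:)
  qed
qed

definition cylinder :: "real \<Rightarrow> nat \<Rightarrow> (nat \<Rightarrow> real set) \<Rightarrow> (real \<Rightarrow> real) set" where
  "cylinder T n A = {w\<in>C0 T. \<forall>i\<le>2 ^ n. w (grid T (2 ^ n) i) \<in> A i}"

definition cylinders :: "real \<Rightarrow> (real \<Rightarrow> real) set set" where
  "cylinders T = {cylinder T n A | n A. \<forall>i. A i \<in> sets borel}"

lemma sets_cylinder:
  assumes "0 \<le> T" "space M = C0 T" "\<And>s. s \<in> {0..T} \<Longrightarrow> (\<lambda>w. w s) \<in> borel_measurable M"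
    and "\<And>i. A i \<in> sets borel"
  shows "cylinder T n A \<in> sets M"
proof -
  have "(\<Inter>i\<in>{..2 ^ n}. (\<lambda>w. w (grid T (2 ^ n) i)) -` A i \<inter> space M) \<in> sets M"
    using assms(1) by (intro sets.finite_INT measurable_sets[OF assms(3,4)] grid_mem) auto
  also have "(\<Inter>i\<in>{..2 ^ n}. (\<lambda>w. w (grid T (2 ^ n) i)) -` A i \<inter> space M) = cylinder T n A"
    using assms(2) by (auto simp: cylinder_def)
  finally show ?thesis .
qed

lemma cylinder_refine:
  assumes "n \<le> m"
  shows "cylinder T n A =
    cylinder T m (\<lambda>i. if 2 ^ (m - n) dvd i then A (i div 2 ^ (m - n)) else UNIV)"
proof -
  define K :: nat where "K = 2 ^ (m - n)"
  have K: "0 < K" "(2::nat) ^ m = 2 ^ n * K"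
    using assms by (auto simp: K_def power_add[symmetric])
  have "(\<forall>i\<le>2 ^ n. w (grid T (2 ^ n) i) \<in> A i) \<longleftrightarrow>
    (\<forall>i\<le>2 ^ m. w (grid T (2 ^ m) i) \<in> (if K dvd i then A (i div K) else UNIV))" for w
  proof safe
    fix i :: nat assume *: "\<forall>i\<le>2 ^ n. w (grid T (2 ^ n) i) \<in> A i" "i \<le> 2 ^ m"
    show "w (grid T (2 ^ m) i) \<in> (if K dvd i then A (i div K) else UNIV)"
    proof (cases "K dvd i")
      case True
      then obtain j where "i = j * K" by (metis dvd_div_mult_self)
      then show ?thesis
        using * K grid_refine[OF K(1), of T "2 ^ n" j] by auto
    qed simp
  next
    fix i :: nat assume *: "\<forall>i\<le>2 ^ m. w (grid T (2 ^ m) i) \<in> (if K dvd i then A (i div K) else UNIV)"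
      "i \<le> 2 ^ n"
    have "i * K \<le> 2 ^ m" using * K by auto
    with * have "w (grid T (2 ^ m) (i * K)) \<in> A i"
      using K(1) by force
    then show "w (grid T (2 ^ n) i) \<in> A i"
      unfolding K(2) using grid_refine[OF K(1), of T "2 ^ n" i] by simp
  qed
  then show ?thesis
    by (simp add: cylinder_def K_def)
qed

lemma cylinder_Int: "cylinder T n A \<inter> cylinder T n B = cylinder T n (\<lambda>i. A i \<inter> B i)"
  by (auto simp: cylinder_def)

lemma Int_stable_cylinders: "Int_stable (cylinders T)"
proof (rule Int_stableI)
  fix a b assume "a \<in> cylinders T" "b \<in> cylinders T"
  then obtain n A m B where *: "a = cylinder T n A" "b = cylinder T m B"
    "\<And>i. A i \<in> sets borel" "\<And>i. B i \<in> sets borel"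
    by (auto simp: cylinders_def)
  define k where "k = max n m"
  define A' where "A' = (\<lambda>i. if 2 ^ (k - n) dvd i then A (i div 2 ^ (k - n)) else UNIV)"
  define B' where "B' = (\<lambda>i. if 2 ^ (k - m) dvd i then B (i div 2 ^ (k - m)) else UNIV)"
  have "a = cylinder T k A'" "b = cylinder T k B'"
    using * cylinder_refine[of n k T A] cylinder_refine[of m k T B]
    by (auto simp: k_def A'_def B'_def)
  then have "a \<inter> b = cylinder T k (\<lambda>i. A' i \<inter> B' i)"
    by (simp add: cylinder_Int)
  moreover have "\<forall>i. A' i \<inter> B' i \<in> sets borel"
    using * by (auto simp: A'_def B'_def)
  ultimately show "a \<inter> b \<in> cylinders T"
    by (auto simp: cylinders_def)
qed

lemma dyadic_approx:
  assumes "0 < T" "t \<in> {0..T}"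
  obtains j where "j \<le> 2 ^ n" "grid T (2 ^ n) j \<le> t" "t \<le> grid T (2 ^ n) j + T / 2 ^ n"
proof
  define j where "j = nat \<lfloor>t * 2 ^ n / T\<rfloor>"
  have nn: "0 \<le> t * 2 ^ n / T"
    using assms by auto
  have j: "real j \<le> t * 2 ^ n / T" "t * 2 ^ n / T < real j + 1"
    unfolding j_def using nn by linarith+
  have "t * 2 ^ n / T \<le> 2 ^ n"
    using assms by (simp add: divide_simps)
  with j(1) have "real j \<le> real (2 ^ n)"
    by (simp only: of_nat_power of_nat_numeral)
  then show "j \<le> 2 ^ n"
    by (rule of_nat_le_iff[THEN iffD1])
  show "grid T (2 ^ n) j \<le> t" "t \<le> grid T (2 ^ n) j + T / 2 ^ n"
    using j assms by (auto simp: grid_def field_simps)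
qed

lemma dyadic_sequence:
  assumes "0 < T" "t \<in> {0..T}"
  obtains j where "\<And>n. j n \<le> 2 ^ n" "(\<lambda>n. grid T (2 ^ n) (j n)) \<longlonglongrightarrow> t"
proof -
  have "\<exists>j. j \<le> 2 ^ n \<and> grid T (2 ^ n) j \<le> t \<and> t \<le> grid T (2 ^ n) j + T / 2 ^ n" for n
    using dyadic_approx[OF assms, of n] by metis
  then obtain j where j: "\<And>n. j n \<le> 2 ^ n" "\<And>n. grid T (2 ^ n) (j n) \<le> t"
    "\<And>n. t \<le> grid T (2 ^ n) (j n) + T / 2 ^ n"
    by metis
  have "(\<lambda>n. T / 2 ^ n) \<longlonglongrightarrow> 0"
    using tendsto_mult_right_zero[OF LIMSEQ_inverse_realpow_zero[of 2], of T] by (simp add: divide_inverse)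
  from tendsto_diff[OF tendsto_const this, of t]
  have lim: "(\<lambda>n. t - T / 2 ^ n) \<longlonglongrightarrow> t"
    by simp
  have "(\<lambda>n. grid T (2 ^ n) (j n)) \<longlonglongrightarrow> t"
  proof (rule tendsto_sandwich[OF _ _ lim tendsto_const])
    show "\<forall>\<^sub>F n in sequentially. t - T / 2 ^ n \<le> grid T (2 ^ n) (j n)"
      using j(3) by (intro always_eventually allI) (simp add: le_diff_eq diff_le_eq)
    show "\<forall>\<^sub>F n in sequentially. grid T (2 ^ n) (j n) \<le> t"
      using j(2) by (intro always_eventually allI)
  qed
  with j(1) show thesis
    by (rule that)
qed

lemma dyadic_dense:
  fixes f :: "real \<Rightarrow> real"
  assumes "0 < T" "continuous_on {0..T} f" "\<And>n i. i \<le> 2 ^ n \<Longrightarrow> f (grid T (2 ^ n) i) \<le> c" "t \<in> {0..T}"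
  shows "f t \<le> c"
proof -
  obtain j where j: "\<And>n. j n \<le> 2 ^ n" "(\<lambda>n. grid T (2 ^ n) (j n)) \<longlonglongrightarrow> t"
    by (rule dyadic_sequence[OF assms(1,4)]) blast
  have "(\<lambda>n. f (grid T (2 ^ n) (j n))) \<longlonglongrightarrow> f t"
    by (rule continuous_on_tendsto_compose[OF assms(2) j(2) assms(4)])
      (use assms(1) j(1) in \<open>auto intro!: always_eventually grid_mem simp del: atLeastAtMost_iff\<close>)
  then show ?thesis
    by (rule LIMSEQ_le_const2) (use assms(3) j(1) in auto)
qed

text \<open>A path lies in tubes of arbitrarily small diameter, so an open set is the union of the tubes inside
it, and there are only countably many tubes. As a tube is a countable intersection of cylinders, the Borel sets are generated by the
coordinates. The list \<open>q\<close> holds the values of a step function on the grid of level \<open>n\<close>; a path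
has to stay close to it at the dyadic times of all levels, so by continuity at all times.\<close>

definition tube :: "real \<Rightarrow> nat \<Rightarrow> nat \<Rightarrow> rat list \<Rightarrow> (real \<Rightarrow> real) set" where
  "tube T n k q =
     (\<Inter>m. cylinder T m (\<lambda>i. cball (of_rat (q ! (i * 2 ^ n div 2 ^ m))) (1 / real (Suc k))))"

lemma tube_close:
  assumes "0 < T" "v \<in> tube T n k q" "w \<in> tube T n k q"
  shows "(SUP t\<in>{0..T}. \<bar>w t - v t\<bar>) \<le> 2 / real (Suc k)"
proof (rule cSUP_least)
  fix t assume t: "t \<in> {0..T}"
  have C: "v \<in> C0 T" "w \<in> C0 T"
    using assms by (auto simp: tube_def cylinder_def)
  have cont: "continuous_on {0..T} (\<lambda>t. \<bar>w t - v t\<bar>)"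
    using C by (intro continuous_intros C0_continuous_on)
  have "\<bar>w (grid T (2 ^ m) i) - v (grid T (2 ^ m) i)\<bar> \<le> 2 / real (Suc k)" if "i \<le> 2 ^ m" for i m
  proof -
    define c :: real where "c = of_rat (q ! (i * 2 ^ n div 2 ^ m))"
    have "dist c (w (grid T (2 ^ m) i)) \<le> 1 / real (Suc k)" "dist c (v (grid T (2 ^ m) i)) \<le> 1 / real (Suc k)"
      using assms that by (auto simp: tube_def cylinder_def c_def)
    then have "\<bar>w (grid T (2 ^ m) i) - v (grid T (2 ^ m) i)\<bar> \<le> 1 / real (Suc k) + 1 / real (Suc k)"
      unfolding dist_real_def by linarith
    also have "\<dots> = 2 / real (Suc k)" by simp
    finally show ?thesis .
  qed
  then show "\<bar>w t - v t\<bar> \<le> 2 / real (Suc k)"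
    by (rule dyadic_dense[OF assms(1) cont _ t])
qed (use assms(1) in auto)

lemma tube_exists:
  assumes "0 < T" "w \<in> C0 T"
  obtains n q where "w \<in> tube T n k q"
proof -
  \<comment> \<open>Half of the radius is for the oscillation of \<open>w\<close> within a cell, half for the rounding of its
    values to rational numbers.\<close>
  define e where "e = 1 / real (Suc k) / 2"
  have e: "e > 0" "e + e = 1 / real (Suc k)"
    by (simp_all add: e_def field_simps)
  have "uniformly_continuous_on {0..T} w"
    using C0_continuous_on[OF assms(2)] by (intro compact_uniformly_continuous) auto
  then obtain d where d: "d > 0" "\<And>x y. x \<in> {0..T} \<Longrightarrow> y \<in> {0..T} \<Longrightarrow> dist y x < d \<Longrightarrow> dist (w y) (w x) < e"
    using e(1) unfolding uniformly_continuous_on_def by metis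
  obtain n where n: "T / 2 ^ n < d"
  proof -
    obtain n where "inverse d * T < 2 ^ n"
      using real_arch_pow[of 2 "inverse d * T"] by auto
    then show ?thesis
      using d(1) by (intro that[of n]) (simp add: field_simps)
  qed
  have "\<exists>q::rat. \<bar>w (grid T (2 ^ n) j) - of_rat q\<bar> < e" for j
    using e(1) of_rat_dense[of "w (grid T (2 ^ n) j)" "w (grid T (2 ^ n) j) + e"]
    by (auto simp: abs_if) (metis add.commute less_diff_eq minus_diff_eq neg_less_iff_less diff_less_eq)
  then obtain Q :: "nat \<Rightarrow> rat" where Q: "\<And>j. \<bar>w (grid T (2 ^ n) j) - of_rat (Q j)\<bar> < e"
    by metis
  have "w \<in> tube T n k (map Q [0..<Suc (2 ^ n)])"
    unfolding tube_def
  proof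
    fix m :: nat
    have "dist (of_rat (map Q [0..<Suc (2 ^ n)] ! (i * 2 ^ n div 2 ^ m))) (w (grid T (2 ^ m) i)) \<le> 1 / real (Suc k)"
      if i: "i \<le> 2 ^ m" for i
    proof -
      define j where "j = i * 2 ^ n div 2 ^ m"
      have "j \<le> 2 ^ m * 2 ^ n div 2 ^ m"
        unfolding j_def using i by (intro div_le_mono mult_right_mono) auto
      then have j: "j \<le> 2 ^ n" by simp
      have lo: "j * 2 ^ m \<le> i * 2 ^ n"
        unfolding j_def by (rule div_times_less_eq_dividend)
      have hi: "i * 2 ^ n < Suc j * 2 ^ m"
        unfolding j_def by (metis dividend_less_times_div mult.commute mult_Suc zero_less_numeral zero_less_power)
      have "grid T (2 ^ n) j \<le> grid T (2 ^ m) i"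
        using of_nat_mono[OF lo, where 'a=real] assms(1) by (simp add: grid_def field_simps)
      moreover have "grid T (2 ^ m) i < grid T (2 ^ n) j + T / 2 ^ n"
      proof -
        have "real (i * 2 ^ n) < real (Suc j * 2 ^ m)"
          using hi by (simp only: of_nat_less_iff)
        then have "T * (real i * 2 ^ n) < T * ((real j + 1) * 2 ^ m)"
          using assms(1) by (intro mult_strict_left_mono) (simp_all add: algebra_simps)
        then show ?thesis
          by (simp add: grid_def field_simps)
      qed
      ultimately have "dist (grid T (2 ^ m) i) (grid T (2 ^ n) j) < d"
        using n by (simp add: dist_real_def)
      then have "dist (w (grid T (2 ^ m) i)) (w (grid T (2 ^ n) j)) < e"
        using i j assms(1) by (intro d(2) grid_mem) auto
      moreover have "map Q [0..<Suc (2 ^ n)] ! j = Q j"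
        using j by (metis add_0 diff_zero le_imp_less_Suc length_upt nth_map nth_upt)
      ultimately show ?thesis
        using Q[of j] e(2) unfolding j_def[symmetric] dist_real_def by simp
    qed
    then show "w \<in> cylinder T m (\<lambda>i. cball (of_rat (map Q [0..<Suc (2 ^ n)] ! (i * 2 ^ n div 2 ^ m))) (1 / real (Suc k)))"
      using assms(2) by (simp add: cylinder_def)
  qed
  then show thesis
    by (rule that)
qed

lemma sets_C0_borel_cylinders:
  assumes "0 < T"
  shows "sets (C0_borel T) = sigma_sets (C0 T) (cylinders T)"
proof
  have "cylinders T \<subseteq> sets (C0_borel T)"
    unfolding cylinders_def
    using assms by (auto intro!: sets_cylinder measurable_coordinate_C0_borel)
  then show "sigma_sets (C0 T) (cylinders T) \<subseteq> sets (C0_borel T)"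
    using sets.sigma_sets_subset[of "cylinders T" "C0_borel T"] by simp
next
  have tube: "tube T n k q \<in> sigma_sets (C0 T) (cylinders T)" for n k q
    unfolding tube_def
  proof (rule sigma_sets_INTER)
    show "cylinders T \<subseteq> Pow (C0 T)"
      by (auto simp: cylinders_def cylinder_def)
    show "cylinder T m (\<lambda>i. cball (of_rat (q ! (i * 2 ^ n div 2 ^ m))) (1 / real (Suc k)))
      \<in> sigma_sets (C0 T) (cylinders T)" for m
      unfolding cylinders_def by (intro sigma_sets.Basic CollectI exI conjI refl) auto
  qed simp
  have "U \<in> sigma_sets (C0 T) (cylinders T)" if "openin (mtopology_of (C0_metric T)) U" for U
  proof -
    have U: "U \<subseteq> C0 T" "\<And>w. w \<in> U \<Longrightarrow> \<exists>r>0. \<forall>v\<in>C0 T. (SUP t\<in>{0..T}. \<bar>w t - v t\<bar>) < r \<longrightarrow> v \<in> U"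
      using that openin_C0_iff[of T U] assms by auto
    define I where "I = {(n, k, q). tube T n k q \<subseteq> U}"
    have "U = (\<Union>(n, k, q)\<in>I. tube T n k q)"
    proof (intro equalityI subsetI)
      fix w assume w: "w \<in> U"
      then obtain r where r: "r > 0" "\<And>v. v \<in> C0 T \<Longrightarrow> (SUP t\<in>{0..T}. \<bar>w t - v t\<bar>) < r \<Longrightarrow> v \<in> U"
        using U(2) by blast
      obtain k where k: "2 / real (Suc k) < r"
      proof -
        obtain k where "inverse (real (Suc k)) < r / 2"
          using reals_Archimedean[of "r / 2"] r(1) by auto
        then show ?thesis by (intro that[of k]) (simp add: field_simps)
      qed
      obtain n q where nq: "w \<in> tube T n k q"
        using tube_exists[OF assms] U(1) w by blast
      have "tube T n k q \<subseteq> U"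
      proof
        fix v assume v: "v \<in> tube T n k q"
        then have "v \<in> C0 T" by (auto simp: tube_def cylinder_def)
        then show "v \<in> U"
          using r(2)[of v] tube_close[OF assms v nq] k by force
      qed
      with nq show "w \<in> (\<Union>(n, k, q)\<in>I. tube T n k q)"
        by (auto simp: I_def)
    qed (auto simp: I_def)
    moreover have "(\<Union>x\<in>I. case x of (n, k, q) \<Rightarrow> tube T n k q) \<in> sigma_sets (C0 T) (cylinders T)"
      by (rule sigma_sets_UNION) (auto simp: tube intro: countable_subset[OF subset_UNIV])
    ultimately show ?thesis
      by simp
  qed
  then show "sets (C0_borel T) \<subseteq> sigma_sets (C0 T) (cylinders T)"
    unfolding sets_C0_borel by (intro sigma_sets_mono) auto
qed

lemma sets_path_filtration_T:
  assumes "0 < T"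
  shows "sets (path_filtration T T) = sets (C0_borel T)"
proof
  have "cylinder T n A \<in> sets (path_filtration T T)" if "\<And>i. A i \<in> sets borel" for n A
    using assms that by (auto intro!: sets_cylinder measurable_coordinate)
  then have "cylinders T \<subseteq> sets (path_filtration T T)"
    by (auto simp: cylinders_def)
  from sets.sigma_sets_subset[OF this] show "sets (C0_borel T) \<subseteq> sets (path_filtration T T)"
    by (simp add: sets_C0_borel_cylinders[OF assms])
  show "sets (path_filtration T T) \<subseteq> sets (C0_borel T)"
    using assms by (intro sets_path_filtration_subset) auto
qed

lemma measure_eqI_cylinders:
  assumes "0 < T" "sets M = sets (C0_borel T)" "sets N = sets (C0_borel T)" "finite_measure M"
    and eq: "\<And>n A. (\<And>i. A i \<in> sets borel) \<Longrightarrow> emeasure M (cylinder T n A) = emeasure N (cylinder T n A)"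
  shows "M = N"
proof (rule measure_eqI_generator_eq[OF Int_stable_cylinders])
  interpret finite_measure M by fact
  show "range (\<lambda>i::nat. cylinder T 0 (\<lambda>_. UNIV)) \<subseteq> cylinders T"
    unfolding cylinders_def by (intro image_subsetI CollectI exI conjI refl) auto
  show "(\<Union>i::nat. cylinder T 0 (\<lambda>_. UNIV)) = C0 T"
    by (auto simp: cylinder_def)
  show "cylinders T \<subseteq> Pow (C0 T)"
    by (auto simp: cylinders_def cylinder_def)
  show "emeasure M X = emeasure N X" if "X \<in> cylinders T" for X
    using that eq by (auto simp: cylinders_def)
  show "sets M = sigma_sets (C0 T) (cylinders T)" "sets N = sigma_sets (C0 T) (cylinders T)"
    using assms by (simp_all add: sets_C0_borel_cylinders)
  show "emeasure M (cylinder T 0 (\<lambda>_. UNIV)) \<noteq> \<infinity>" for i :: nat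
    by (simp add: emeasure_eq_measure)
qed

section \<open>Increments of Brownian motion\<close>

lemma (in prob_space) nn_integral_indep_set:
  fixes X Y :: "'a \<Rightarrow> ennreal"
  assumes indep: "indep_set (sets F) (sets G)" and sp: "space F = space M" "space G = space M"
    and X: "X \<in> borel_measurable F" and Y: "Y \<in> borel_measurable G"
  shows "(\<integral>\<^sup>+w. X w * Y w \<partial>M) = (\<integral>\<^sup>+w. X w \<partial>M) * (\<integral>\<^sup>+w. Y w \<partial>M)"
proof -
  have sub: "sets F \<subseteq> sets M" "sets G \<subseteq> sets M"
    using indep by (simp_all add: indep_sets2_eq)
  have XY: "X \<in> borel_measurable M" "Y \<in> borel_measurable M"
    using measurable_sets[OF X] measurable_sets[OF Y] sub sp by (auto intro!: measurableI)
  have "indep_set (sigma_sets (space M) {X -` A \<inter> space M |A. A \<in> sets borel})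
    (sigma_sets (space M) {Y -` A \<inter> space M |A. A \<in> sets borel})"
    unfolding indep_set_def
  proof (rule indep_sets_mono_sets[OF indep[unfolded indep_set_def]])
    have 1: "sigma_sets (space M) {X -` A \<inter> space M |A. A \<in> sets borel} \<subseteq> sets F"
      unfolding sp(1)[symmetric] using measurable_sets[OF X] by (intro sets.sigma_sets_subset) auto
    have 2: "sigma_sets (space M) {Y -` A \<inter> space M |A. A \<in> sets borel} \<subseteq> sets G"
      unfolding sp(2)[symmetric] using measurable_sets[OF Y] by (intro sets.sigma_sets_subset) auto
    show "case_bool (sigma_sets (space M) {X -` A \<inter> space M |A. A \<in> sets borel})
        (sigma_sets (space M) {Y -` A \<inter> space M |A. A \<in> sets borel}) i
      \<subseteq> case_bool (sets F) (sets G) i" for i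
      using 1 2 by (cases i) auto
  qed
  then have "indep_var borel X borel Y"
    using XY by (simp add: indep_var_eq)
  then have "indep_vars (case_bool borel borel) (case_bool X Y) UNIV"
    unfolding indep_var_def .
  moreover have "case_bool borel borel = (\<lambda>_::bool. borel :: ennreal measure)"
    by (auto split: bool.split)
  ultimately have "indep_vars (\<lambda>_. borel) (case_bool X Y) UNIV"
    by simp
  from indep_vars_nn_integral[OF _ this] show ?thesis
    by (simp add: UNIV_bool mult.commute)
qed

text \<open>By induction on \<open>n\<close>: the product over the first increments depends on the past of the next one only.\<close>

lemma nn_integral_brownian_increments:
  fixes X :: "real \<Rightarrow> (real \<Rightarrow> real) \<Rightarrow> real" and \<phi> :: "nat \<Rightarrow> real \<Rightarrow> ennreal"
  assumes "0 < T" and M: "prob_space M" "sets M = sets (C0_borel T)" and X: "brownian_motion T M X"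
    and \<phi>: "\<And>i. \<phi> i \<in> borel_measurable borel" and "n \<le> N"
  shows "(\<integral>\<^sup>+w. (\<Prod>i<n. \<phi> i (X (grid T N (Suc i)) w - X (grid T N i) w)) \<partial>M) =
    (\<Prod>i<n. \<integral>\<^sup>+x. ennreal (normal_density 0 (sqrt (T / N)) x) * \<phi> i x \<partial>lborel)"
  using \<open>n \<le> N\<close>
proof (induction n)
  case 0
  interpret prob_space M by fact
  show ?case by (simp add: emeasure_space_1)
next
  case (Suc n)
  interpret prob_space M by fact
  have spM: "space M = C0 T"
    using sets_eq_imp_space_eq[OF M(2)] by simp
  define s where "s = grid T N n"
  define t where "t = grid T N (Suc n)"
  have st: "0 \<le> s" "s < t" "t \<le> T" "t - s = T / N"
    using Suc.prems \<open>0 < T\<close> grid_mem[of T "Suc n" N] grid_mem[of T n N]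
    by (auto simp: s_def t_def grid_def divide_simps algebra_simps)
  define Y where "Y = (\<lambda>w. X t w - X s w)"
  have Y: "distributed M lborel Y (normal_density 0 (sqrt (T / N)))"
    "indep_set (sets (path_filtration T s)) (sets (vimage_algebra (space M) Y borel))"
    using X st unfolding brownian_motion_def Y_def by metis+
  have meas: "X (grid T N i) \<in> borel_measurable (path_filtration T s)" if "i \<le> n" for i
  proof -
    have g: "grid T N i \<in> {0..T}"
      using that Suc.prems \<open>0 < T\<close> by (intro grid_mem) auto
    have le: "grid T N i \<le> s"
      using that \<open>0 < T\<close> by (auto simp: s_def grid_def intro!: divide_right_mono)
    have "X (grid T N i) \<in> borel_measurable (path_filtration T (grid T N i))"
      using X g by (auto simp: brownian_motion_def)
    then show ?thesis
      using sets_path_filtration_mono[OF le, of T] by (auto simp: measurable_def)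
  qed
  have "(\<integral>\<^sup>+w. (\<Prod>i<Suc n. \<phi> i (X (grid T N (Suc i)) w - X (grid T N i) w)) \<partial>M) =
    (\<integral>\<^sup>+w. (\<Prod>i<n. \<phi> i (X (grid T N (Suc i)) w - X (grid T N i) w)) * \<phi> n (Y w) \<partial>M)"
    by (simp add: Y_def s_def t_def)
  also have "\<dots> = (\<integral>\<^sup>+w. (\<Prod>i<n. \<phi> i (X (grid T N (Suc i)) w - X (grid T N i) w)) \<partial>M) *
    (\<integral>\<^sup>+w. \<phi> n (Y w) \<partial>M)"
  proof (rule nn_integral_indep_set[OF Y(2)])
    show "(\<lambda>w. \<Prod>i<n. \<phi> i (X (grid T N (Suc i)) w - X (grid T N i) w)) \<in> borel_measurable (path_filtration T s)"
      by (intro borel_measurable_prod_ennreal measurable_compose[OF _ \<phi>] borel_measurable_diff meas) auto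
    show "(\<lambda>w. \<phi> n (Y w)) \<in> borel_measurable (vimage_algebra (space M) Y borel)"
      by (intro measurable_compose[OF _ \<phi>] measurable_vimage_algebra1) auto
  qed (simp_all add: spM)
  also have "(\<integral>\<^sup>+w. \<phi> n (Y w) \<partial>M) =
    (\<integral>\<^sup>+x. ennreal (normal_density 0 (sqrt (T / N)) x) * \<phi> n x \<partial>lborel)"
    using distributed_nn_integral[OF Y(1), of "\<phi> n"] \<phi> by simp
  finally show ?case
    using Suc by simp
qed

text \<open>Completing the square shows that the exponential weight moves the mean of the Gaussian from \<open>0\<close> to
\<open>c * \<sigma>\<^sup>2\<close>; this is the Cameron-Martin theorem for a single increment.\<close>

lemma nn_integral_gaussian_tilt:
  assumes "0 < \<sigma>" and [measurable]: "\<phi> \<in> borel_measurable borel"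
  shows "(\<integral>\<^sup>+x. ennreal (normal_density 0 \<sigma> x) * (ennreal (exp (c * x - c\<^sup>2 * \<sigma>\<^sup>2 / 2)) * \<phi> x) \<partial>lborel) =
    (\<integral>\<^sup>+x. ennreal (normal_density 0 \<sigma> x) * \<phi> (x + c * \<sigma>\<^sup>2) \<partial>lborel)"
proof -
  have eq: "normal_density 0 \<sigma> x * exp (c * x - c\<^sup>2 * \<sigma>\<^sup>2 / 2) = normal_density (c * \<sigma>\<^sup>2) \<sigma> x" for x
  proof -
    have "- x\<^sup>2 / (2 * \<sigma>\<^sup>2) + (c * x - c\<^sup>2 * \<sigma>\<^sup>2 / 2) = - (x - c * \<sigma>\<^sup>2)\<^sup>2 / (2 * \<sigma>\<^sup>2)"
      using assms(1) by (simp add: field_simps power2_eq_square)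
    then show ?thesis
      by (simp add: normal_density_def exp_add[symmetric] del: minus_divide_left)
  qed
  have "(\<integral>\<^sup>+x. ennreal (normal_density 0 \<sigma> x) * (ennreal (exp (c * x - c\<^sup>2 * \<sigma>\<^sup>2 / 2)) * \<phi> x) \<partial>lborel) =
    (\<integral>\<^sup>+x. ennreal (normal_density (c * \<sigma>\<^sup>2) \<sigma> x) * \<phi> x \<partial>lborel)"
    by (simp add: eq[symmetric] ennreal_mult mult.assoc)
  also have "\<dots> = (\<integral>\<^sup>+x. ennreal (normal_density (c * \<sigma>\<^sup>2) \<sigma> (c * \<sigma>\<^sup>2 + 1 * x)) * \<phi> (c * \<sigma>\<^sup>2 + 1 * x) \<partial>lborel)"
    by (subst nn_integral_real_affine[where c=1 and t="c * \<sigma>\<^sup>2"]) auto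
  also have "\<dots> = (\<integral>\<^sup>+x. ennreal (normal_density 0 \<sigma> x) * \<phi> (x + c * \<sigma>\<^sup>2) \<partial>lborel)"
    by (simp add: normal_density_def add.commute)
  finally show ?thesis .
qed

definition incr :: "real \<Rightarrow> nat \<Rightarrow> (real \<Rightarrow> real) \<Rightarrow> nat \<Rightarrow> real" where
  "incr T N f i = f (grid T N (Suc i)) - f (grid T N i)"

lemma sum_incr: "(\<Sum>i<j. incr T N f i) = f (grid T N j) - f 0"
  by (induction j) (simp_all add: incr_def)

lemma measurable_incr:
  assumes "0 < T" "i < N"
  shows "(\<lambda>w. incr T N w i) \<in> borel_measurable (C0_borel T)"
  unfolding incr_def using assms
  by (intro borel_measurable_diff measurable_coordinate_C0_borel grid_mem) auto

text \<open>The sets in the hypothesis, taken over all levels, are not stable under intersection, since an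
increment over a coarse cell is a sum of increments over fine ones. At one level, however, they
determine the law of the vector of all increments, and the positions at the grid points are partial
sums of these. The cylinders of all levels are stable under intersection.\<close>

lemma emeasure_cylinder_eqI:
  assumes "0 < T" and M: "prob_space M" "sets M = sets (C0_borel T)"
    and M': "prob_space M'" "sets M' = sets (C0_borel T)"
    and eq: "\<And>A. (\<And>i. A i \<in> sets borel) \<Longrightarrow>
      emeasure M {w\<in>C0 T. \<forall>i<2 ^ n. incr T (2 ^ n) w i \<in> A i} =
      emeasure M' {w\<in>C0 T. \<forall>i<2 ^ n. incr T (2 ^ n) w i \<in> A i}"
    and B: "\<And>i. B i \<in> sets borel"
  shows "emeasure M (cylinder T n B) = emeasure M' (cylinder T n B)"
proof -
  interpret M: prob_space M by fact
  interpret M': prob_space M' by fact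
  let ?P = "Pi\<^sub>M {..<(2::nat) ^ n} (\<lambda>_. borel :: real measure)"
  define D where "D = (\<lambda>w. \<lambda>i\<in>{..<2 ^ n}. incr T (2 ^ n) w i)"
  have D: "D \<in> measurable (C0_borel T) ?P"
    unfolding D_def using assms(1) by (intro measurable_restrict measurable_incr) auto
  then have DM: "D \<in> measurable M ?P" "D \<in> measurable M' ?P"
    by (simp_all add: measurable_cong_sets[OF M(2) refl] measurable_cong_sets[OF M'(2) refl])
  have sp: "space M = C0 T" "space M' = C0 T"
    using sets_eq_imp_space_eq[OF M(2)] sets_eq_imp_space_eq[OF M'(2)] by simp_all
  have eqD: "distr M ?P D = distr M' ?P D"
  proof (rule measure_eqI_PiM_finite)
    fix A :: "nat \<Rightarrow> real set" assume A: "\<And>i. i \<in> {..<2 ^ n} \<Longrightarrow> A i \<in> sets borel"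
    have PA: "Pi\<^sub>E {..<2 ^ n} A \<in> sets ?P"
      using A by (intro sets_PiM_I_finite) auto
    define A' where "A' = (\<lambda>i. if i < 2 ^ n then A i else UNIV)"
    have *: "D -` Pi\<^sub>E {..<2 ^ n} A \<inter> C0 T = {w\<in>C0 T. \<forall>i<2 ^ n. incr T (2 ^ n) w i \<in> A' i}"
      unfolding D_def A'_def vimage_def restrict_PiE_iff by auto
    have "A' i \<in> sets borel" for i
      using A by (simp add: A'_def)
    then show "emeasure (distr M ?P D) (Pi\<^sub>E {..<2 ^ n} A) = emeasure (distr M' ?P D) (Pi\<^sub>E {..<2 ^ n} A)"
      using eq[of A'] by (simp add: emeasure_distr[OF DM(1) PA] emeasure_distr[OF DM(2) PA] sp *)
  next
    show "range (\<lambda>i::nat. space ?P) \<subseteq> prod_algebra {..<2 ^ n} (\<lambda>_. borel)"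
      by (auto simp: space_PiM intro!: prod_algebraI_finite)
    interpret D: prob_space "distr M ?P D"
      using DM by (intro M.prob_space_distr)
    show "emeasure (distr M ?P D) (space ?P) \<noteq> \<infinity>" for i :: nat
      by (rule D.emeasure_finite[unfolded infinity_ennreal_def[symmetric]])
  qed auto
  define E where "E = {x\<in>space ?P. \<forall>j\<in>{..2 ^ n}. (\<Sum>i<j. x i) \<in> B j}"
  have E: "E \<in> sets ?P"
    unfolding E_def
  proof (rule sets.sets_Collect_finite_All')
    fix j assume "j \<in> {..(2::nat) ^ n}"
    then have "(\<lambda>x. \<Sum>i<j. x i) \<in> borel_measurable ?P"
      by (intro borel_measurable_sum measurable_component_singleton) auto
    from measurable_sets[OF this B[of j]]
    show "{x\<in>space ?P. (\<Sum>i<j. x i) \<in> B j} \<in> sets ?P"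
      by (simp add: vimage_def Int_def conj_commute)
  qed auto
  have "D -` E \<inter> C0 T = cylinder T n B"
  proof -
    have "(\<Sum>i<j. D w i) = w (grid T (2 ^ n) j)" if "w \<in> C0 T" "j \<le> 2 ^ n" for w j
    proof -
      have "(\<Sum>i<j. D w i) = (\<Sum>i<j. incr T (2 ^ n) w i)"
        using that by (intro sum.cong) (auto simp: D_def)
      then show ?thesis
        using C0_at_0[OF that(1)] by (simp add: sum_incr)
    qed
    moreover have "D w \<in> space ?P" for w
      by (auto simp: D_def space_PiM)
    ultimately show ?thesis
      by (auto simp: E_def cylinder_def)
  qed
  with emeasure_distr[OF DM(1) E] emeasure_distr[OF DM(2) E] eqD sp show ?thesis
    by simp
qed

lemma measure_eqI_increments:
  assumes "0 < T" and M: "prob_space M" "sets M = sets (C0_borel T)"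
    and M': "prob_space M'" "sets M' = sets (C0_borel T)"
    and eq: "\<And>n A. (\<And>i. A i \<in> sets borel) \<Longrightarrow>
      emeasure M {w\<in>C0 T. \<forall>i<2 ^ n. incr T (2 ^ n) w i \<in> A i} =
      emeasure M' {w\<in>C0 T. \<forall>i<2 ^ n. incr T (2 ^ n) w i \<in> A i}"
  shows "M = M'"
proof (rule measure_eqI_cylinders[OF assms(1) M(2) M'(2)])
  show "finite_measure M"
    using M(1) by (simp add: prob_space_def)
  show "emeasure M (cylinder T n B) = emeasure M' (cylinder T n B)" if "\<And>i. B i \<in> sets borel" for n B
    by (rule emeasure_cylinder_eqI[OF assms(1) M M' eq that])
qed

section \<open>Square-integrable martingales\<close>

lemma nn_integral_AE_limit_le:
  fixes f :: "nat \<Rightarrow> 'a \<Rightarrow> real"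
  assumes [measurable]: "\<And>k. f k \<in> borel_measurable M"
    and lim: "AE x in M. (\<lambda>k. f k x) \<longlonglongrightarrow> g x"
    and le: "\<forall>\<^sub>F k in sequentially. (\<integral>\<^sup>+x. ennreal (f k x) \<partial>M) \<le> c"
  shows "(\<integral>\<^sup>+x. ennreal (g x) \<partial>M) \<le> c"
proof -
  have "(\<integral>\<^sup>+x. ennreal (g x) \<partial>M) = (\<integral>\<^sup>+x. liminf (\<lambda>k. ennreal (f k x)) \<partial>M)"
  proof (rule nn_integral_cong_AE)
    show "AE x in M. ennreal (g x) = liminf (\<lambda>k. ennreal (f k x))"
      using lim
    proof eventually_elim
      case (elim x)
      then have "(\<lambda>k. ennreal (f k x)) \<longlonglongrightarrow> ennreal (g x)"
        by (intro tendsto_ennrealI)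
      then show ?case
        by (simp add: lim_imp_Liminf)
    qed
  qed
  also have "\<dots> \<le> liminf (\<lambda>k. \<integral>\<^sup>+x. ennreal (f k x) \<partial>M)"
    by (intro nn_integral_liminf) auto
  also have "\<dots> \<le> c"
    by (rule Liminf_le) (use le in auto)
  finally show ?thesis .
qed

text \<open>For \<open>p = 2 ^ k\<close> this turns a bound of order \<open>1 / 4 ^ k\<close> on the mean of \<open>d\<^sup>2\<close> into one of order
\<open>1 / 2 ^ k\<close> on the mean of \<open>\<bar>d\<bar>\<close>, which is summable.\<close>

lemma abs_le_power_mean:
  fixes d p :: real
  assumes "p > 0"
  shows "\<bar>d\<bar> \<le> 1 / 2 * (1 / p + p * d\<^sup>2)"
proof -
  have "0 \<le> p * (\<bar>d\<bar> - 1 / p)\<^sup>2"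
    using assms by simp
  also have "\<dots> = p * d\<^sup>2 - 2 * \<bar>d\<bar> + 1 / p"
    using assms by (simp add: power2_eq_square field_simps)
  finally show ?thesis by simp
qed

lemma (in finite_measure) integral_abs_le_of_L2:
  fixes d :: "'a \<Rightarrow> real"
  assumes [measurable]: "d \<in> borel_measurable M" and "integrable M (\<lambda>x. (d x)\<^sup>2)"
    and "(\<integral>x. (d x)\<^sup>2 \<partial>M) \<le> 1 / 4 ^ k"
  shows "(\<integral>x. \<bar>d x\<bar> \<partial>M) \<le> (measure M (space M) + 1) / 2 * (1 / 2) ^ k"
proof -
  have "(\<integral>x. \<bar>d x\<bar> \<partial>M) \<le> (\<integral>x. 1 / 2 * (1 / 2 ^ k + 2 ^ k * (d x)\<^sup>2) \<partial>M)"
    using assms(2) square_integrable_imp_integrable[OF assms(1,2)]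
    by (intro integral_mono abs_le_power_mean) auto
  also have "\<dots> = 1 / 2 * (1 / 2 ^ k * measure M (space M) + 2 ^ k * (\<integral>x. (d x)\<^sup>2 \<partial>M))"
    using assms(2) by (simp add: mult.commute)
  also have "\<dots> \<le> 1 / 2 * (1 / 2 ^ k * measure M (space M) + 2 ^ k * (1 / 4 ^ k))"
    using assms(3) by (intro mult_left_mono add_left_mono) auto
  also have "(2::real) ^ k * (1 / 4 ^ k) = (1 / 2) ^ k"
  proof -
    have "(4::real) ^ k = 2 ^ k * 2 ^ k" by (simp flip: power_mult_distrib)
    then show ?thesis by (simp add: power_one_over)
  qed
  finally show ?thesis by (simp add: field_simps power_one_over)
qed

text \<open>The condition on the inner products says that the increments of the sequence are orthogonal to its
past, so the squared distance of \<open>X n\<close> and \<open>X m\<close> is \<open>a m - a n\<close> for \<open>n \<le> m\<close>, and boundedness of \<open>a\<close>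
makes the sequence Cauchy. The lemma serves twice: for the difference quotients
of a path on finer and finer grids (over Lebesgue measure) and for the approximate Cameron-Martin
densities (over Wiener measure).\<close>

lemma L2_bounded_martingale_converges:
  fixes X :: "nat \<Rightarrow> 'a \<Rightarrow> real" and a :: "nat \<Rightarrow> real"
  assumes "finite_measure M"
    and [measurable]: "\<And>n. X n \<in> borel_measurable M"
    and sq: "\<And>n. integrable M (\<lambda>x. (X n x)\<^sup>2)"
    and inner: "\<And>n m. n \<le> m \<Longrightarrow> (\<integral>x. X n x * X m x \<partial>M) = a n"
    and bound: "\<And>n. a n \<le> C"
  obtains Y r where "Y \<in> borel_measurable M" "strict_mono r"
    "AE x in M. (\<lambda>k. X (r k) x) \<longlonglongrightarrow> Y x"
    "integrable M (\<lambda>x. (Y x)\<^sup>2)" "(\<integral>x. (Y x)\<^sup>2 \<partial>M) \<le> C"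
    "(\<lambda>k. \<integral>x. \<bar>X (r k) x - Y x\<bar> \<partial>M) \<longlonglongrightarrow> 0"
proof -
  interpret finite_measure M by fact
  have prod: "integrable M (\<lambda>x. X n x * X m x)" for n m
  proof (rule Bochner_Integration.integrable_bound)
    show "integrable M (\<lambda>x. (X n x)\<^sup>2 + (X m x)\<^sup>2)"
      using sq by auto
    have "\<bar>u * v\<bar> \<le> u\<^sup>2 + v\<^sup>2" for u v :: real
    proof -
      have "2 * \<bar>u * v\<bar> \<le> u\<^sup>2 + v\<^sup>2"
        using sum_squares_bound[of "\<bar>u\<bar>" "\<bar>v\<bar>"] by (simp add: abs_mult mult.assoc)
      then show ?thesis
        using abs_ge_zero[of "u * v"] by linarith
    qed
    then show "AE x in M. norm (X n x * X m x) \<le> norm ((X n x)\<^sup>2 + (X m x)\<^sup>2)"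
      by simp
  qed auto
  have diff_sq: "integrable M (\<lambda>x. (X m x - X n x)\<^sup>2)" for m n
    using sq prod by (simp add: power2_diff mult.assoc)
  have diff: "(\<integral>x. (X m x - X n x)\<^sup>2 \<partial>M) = a m - a n" if "n \<le> m" for n m
    using inner[OF that] inner[of n n] inner[of m m] sq prod
    by (simp add: power2_diff mult.assoc power2_eq_square[symmetric] mult.commute[of "X m _"])
  have mono: "a n \<le> a m" if "n \<le> m" for n m
    proof -
    have "0 \<le> (\<integral>x. (X m x - X n x)\<^sup>2 \<partial>M)"
      by (rule Bochner_Integration.integral_nonneg) simp
    then show ?thesis
      using diff[OF that] by simp
  qed
  have "incseq a" "bdd_above (range a)"
    using mono bound by (auto simp: incseq_def bdd_above_def)
  then obtain L where L: "a \<longlonglongrightarrow> L"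
    using LIMSEQ_incseq_SUP by blast
  have aL: "a n \<le> L" for n
    using incseq_le[OF \<open>incseq a\<close> L] .
  have "\<exists>N. \<forall>n\<ge>N. L - a n \<le> 1 / 4 ^ k" for k
  proof -
    have "(0::real) < 1 / 4 ^ k" by simp
    from LIMSEQ_D[OF L this] obtain N where "\<And>n. n \<ge> N \<Longrightarrow> norm (a n - L) < 1 / 4 ^ k"
      by blast
    then show ?thesis
      using aL by (intro exI[of _ N]) (force simp: abs_if split: if_splits)
  qed
  then obtain N where N: "\<And>k n. N k \<le> n \<Longrightarrow> L - a n \<le> 1 / 4 ^ k"
    by metis
  \<comment> \<open>The summand \<open>k\<close> makes the indices strictly increasing, the sum puts \<open>r k\<close> above \<open>N k\<close>.\<close>
  define r where "r k = (\<Sum>j\<le>k. N j) + k" for k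
  have r: "strict_mono r"
    by (simp add: strict_mono_Suc_iff r_def)
  have "N k \<le> r k" for k
    using member_le_sum[of k "{..k}" N] by (simp add: r_def)
  with N have rL: "L - a (r k) \<le> 1 / 4 ^ k" for k
    by blast
  define D where "D k x = X (r (Suc k)) x - X (r k) x" for k x
  have D_meas [measurable]: "D k \<in> borel_measurable M" for k
    unfolding D_def by measurable
  have D1: "integrable M (D k)" for k
    unfolding D_def by (intro Bochner_Integration.integrable_diff square_integrable_imp_integrable[OF _ sq]) auto
  have D2: "(\<integral>x. \<bar>D k x\<bar> \<partial>M) \<le> (measure M (space M) + 1) / 2 * (1 / 2) ^ k" for k
  proof (rule integral_abs_le_of_L2)
    have "r k \<le> r (Suc k)"
      using r by (simp add: strict_mono_less_eq)
    then show "(\<integral>x. (D k x)\<^sup>2 \<partial>M) \<le> 1 / 4 ^ k"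
      using diff[of "r k" "r (Suc k)"] aL[of "r (Suc k)"] rL[of k] by (simp add: D_def)
  qed (use diff_sq in \<open>auto simp: D_def\<close>)
  have "(\<integral>\<^sup>+x. (\<Sum>k. ennreal \<bar>D k x\<bar>) \<partial>M) = (\<Sum>k. \<integral>\<^sup>+x. ennreal \<bar>D k x\<bar> \<partial>M)"
    by (intro nn_integral_suminf) auto
  also have "\<dots> \<le> (\<Sum>k. ennreal ((measure M (space M) + 1) / 2 * (1 / 2) ^ k))"
    using D1 D2 by (intro suminf_le summableI) (auto simp: nn_integral_eq_integral intro!: ennreal_leI)
  also have "\<dots> = ennreal (\<Sum>k. (measure M (space M) + 1) / 2 * (1 / 2) ^ k)"
    by (intro suminf_ennreal2 summable_mult summable_geometric) auto
  also have "\<dots> < \<infinity>" by simp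
  finally have "AE x in M. (\<Sum>k. ennreal \<bar>D k x\<bar>) \<noteq> \<infinity>"
    by (intro nn_integral_PInf_AE) auto
  then have conv: "AE x in M. convergent (\<lambda>k. X (r k) x)"
  proof eventually_elim
    case (elim x)
    then have "summable (\<lambda>k. \<bar>D k x\<bar>)"
      by (intro summable_suminf_not_top) auto
    then have "summable (\<lambda>k. D k x)"
      by (rule summable_rabs_cancel)
    moreover have "(\<Sum>j<k. D j x) = X (r k) x - X (r 0) x" for k
      unfolding D_def by (rule sum_lessThan_telescope)
    ultimately have "convergent (\<lambda>k. X (r k) x - X (r 0) x)"
      by (simp add: summable_iff_convergent)
    then show ?case
      by (simp add: convergent_diff_const_right_iff)
  qed
  define Y where "Y x = lim (\<lambda>k. X (r k) x)" for x
  have Y_meas [measurable]: "Y \<in> borel_measurable M"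
    unfolding Y_def by (intro borel_measurable_lim_metric) auto
  have lim: "AE x in M. (\<lambda>k. X (r k) x) \<longlonglongrightarrow> Y x"
    using conv by eventually_elim (simp add: Y_def convergent_LIMSEQ_iff)
  have "(\<integral>\<^sup>+x. ennreal ((Y x)\<^sup>2) \<partial>M) \<le> ennreal C"
  proof (rule nn_integral_AE_limit_le[where f = "\<lambda>k x. (X (r k) x)\<^sup>2"])
    show "AE x in M. (\<lambda>k. (X (r k) x)\<^sup>2) \<longlonglongrightarrow> (Y x)\<^sup>2"
      using lim by eventually_elim (intro tendsto_intros)
    show "\<forall>\<^sub>F k in sequentially. (\<integral>\<^sup>+x. ennreal ((X (r k) x)\<^sup>2) \<partial>M) \<le> ennreal C"
      using sq inner[of "r _" "r _"] bound
      by (intro always_eventually allI)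
        (simp add: nn_integral_eq_integral power2_eq_square ennreal_leI)
  qed auto
  moreover have C0: "0 \<le> C"
    proof -
    have "0 \<le> (\<integral>x. X 0 x * X 0 x \<partial>M)"
      by (rule Bochner_Integration.integral_nonneg) simp
    then show ?thesis
      using bound[of 0] inner[of 0 0] by simp
  qed
  ultimately have Y2: "integrable M (\<lambda>x. (Y x)\<^sup>2)" "(\<integral>x. (Y x)\<^sup>2 \<partial>M) \<le> C"
  proof -
    assume *: "(\<integral>\<^sup>+x. ennreal ((Y x)\<^sup>2) \<partial>M) \<le> ennreal C" "0 \<le> C"
    show I: "integrable M (\<lambda>x. (Y x)\<^sup>2)"
      by (rule integrableI_bounded) (use * in \<open>auto intro: le_less_trans[OF _ ennreal_less_top]\<close>)
    show "(\<integral>x. (Y x)\<^sup>2 \<partial>M) \<le> C"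
      using * nn_integral_eq_integral[OF I] by simp
  qed
  have XY: "(\<integral>\<^sup>+x. ennreal ((X (r k) x - Y x)\<^sup>2) \<partial>M) \<le> ennreal (1 / 4 ^ k)" for k
  proof (rule nn_integral_AE_limit_le[where f = "\<lambda>j x. (X (r k) x - X (r j) x)\<^sup>2"])
    show "AE x in M. (\<lambda>j. (X (r k) x - X (r j) x)\<^sup>2) \<longlonglongrightarrow> (X (r k) x - Y x)\<^sup>2"
      using lim by eventually_elim (intro tendsto_intros)
    have "(\<integral>\<^sup>+x. ennreal ((X (r k) x - X (r j) x)\<^sup>2) \<partial>M) \<le> ennreal (1 / 4 ^ k)" if "k \<le> j" for j
    proof -
      have "(\<integral>\<^sup>+x. ennreal ((X (r k) x - X (r j) x)\<^sup>2) \<partial>M) = ennreal (\<integral>x. (X (r k) x - X (r j) x)\<^sup>2 \<partial>M)"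
        using diff_sq by (intro nn_integral_eq_integral) auto
      also have "(\<integral>x. (X (r k) x - X (r j) x)\<^sup>2 \<partial>M) = a (r j) - a (r k)"
        using diff[of "r k" "r j"] r that by (simp add: power2_commute strict_mono_less_eq)
      also have "\<dots> \<le> 1 / 4 ^ k"
        using aL[of "r j"] rL[of k] by linarith
      finally show ?thesis by (simp add: ennreal_leI)
    qed
    then show "\<forall>\<^sub>F j in sequentially. (\<integral>\<^sup>+x. ennreal ((X (r k) x - X (r j) x)\<^sup>2) \<partial>M) \<le> ennreal (1 / 4 ^ k)"
      by (auto simp: eventually_sequentially)
  qed auto
  have I: "integrable M (\<lambda>x. (X (r k) x - Y x)\<^sup>2)" for k
    by (rule integrableI_bounded) (use XY[of k] in \<open>auto intro: le_less_trans[OF _ ennreal_less_top]\<close>)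
  have "(\<integral>x. \<bar>X (r k) x - Y x\<bar> \<partial>M) \<le> (measure M (space M) + 1) / 2 * (1 / 2) ^ k" for k
    using XY[of k] I nn_integral_eq_integral[OF I, of k] by (intro integral_abs_le_of_L2) auto
  then have "norm (\<integral>x. \<bar>X (r k) x - Y x\<bar> \<partial>M) \<le> (measure M (space M) + 1) / 2 * (1 / 2) ^ k" for k
    by simp
  moreover have "(\<lambda>k. (measure M (space M) + 1) / 2 * (1 / 2) ^ k) \<longlonglongrightarrow> 0"
    by (intro tendsto_mult_right_zero LIMSEQ_realpow_zero) auto
  ultimately have "(\<lambda>k. \<integral>x. \<bar>X (r k) x - Y x\<bar> \<partial>M) \<longlonglongrightarrow> 0"
    by (rule Lim_null_comparison[OF always_eventually, OF allI])
  with Y_meas r lim Y2 show thesis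
    by (rule that)
qed

section \<open>Paths of finite energy\<close>

definition slope :: "real \<Rightarrow> nat \<Rightarrow> (real \<Rightarrow> real) \<Rightarrow> nat \<Rightarrow> real" where
  "slope T N f i = incr T N f i / (T / N)"

definition energy :: "real \<Rightarrow> nat \<Rightarrow> (real \<Rightarrow> real) \<Rightarrow> real" where
  "energy T N f = (\<Sum>i<N. (slope T N f i)\<^sup>2 * (T / N))"

lemma slope_mult: "0 < T \<Longrightarrow> 0 < N \<Longrightarrow> slope T N f i * (T / N) = incr T N f i"
  by (simp add: slope_def)

lemma energy_nonneg: "0 < T \<Longrightarrow> 0 \<le> energy T N f"
  unfolding energy_def by (intro sum_nonneg) auto

lemma sum_blocks:
  assumes "0 < K"
  shows "(\<Sum>i<N * K. c (i div K) * incr T (N * K) f i) = (\<Sum>j<N. c j * incr T N f j)"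
proof -
  have "(\<Sum>i<N * K. c (i div K) * incr T (N * K) f i) =
    (\<Sum>j<N. \<Sum>i=j * K..<j * K + K. c (i div K) * incr T (N * K) f i)"
    by (rule sum.nat_group[symmetric])
  also have "\<dots> = (\<Sum>j<N. c j * incr T N f j)"
  proof (rule sum.cong)
    fix j
    have "(\<Sum>i=j * K..<j * K + K. c (i div K) * incr T (N * K) f i) =
      (\<Sum>i=j * K..<j * K + K. c j * incr T (N * K) f i)"
    proof (rule sum.cong)
      fix i assume "i \<in> {j * K..<j * K + K}"
      then have "i div K = j"
        by (intro div_nat_eqI) (auto simp: mult.commute)
      then show "c (i div K) * incr T (N * K) f i = c j * incr T (N * K) f i"
        by simp
    qed simp
    also have "\<dots> = c j * (\<Sum>i=j * K..<j * K + K. f (grid T (N * K) (Suc i)) - f (grid T (N * K) i))"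
      by (simp add: sum_distrib_left incr_def)
    also have "(\<Sum>i=j * K..<j * K + K. f (grid T (N * K) (Suc i)) - f (grid T (N * K) i)) =
      f (grid T (N * K) (j * K + K)) - f (grid T (N * K) (j * K))"
      by (rule sum_Suc_diff') simp
    also have "\<dots> = incr T N f j"
      using grid_refine[OF assms, of T N "Suc j"] grid_refine[OF assms, of T N j]
      by (simp add: incr_def add.commute)
    finally show "(\<Sum>i=j * K..<j * K + K. c (i div K) * incr T (N * K) f i) = c j * incr T N f j" .
  qed simp
  finally show ?thesis .
qed

text \<open>The slope over a cell is the average of the slopes over the cells of any finer grid within it, so
projecting the finer step function onto the coarser one gives the coarser one back.\<close>

lemma slope_inner:
  assumes "0 < T" "0 < N" "0 < K"
  shows "(\<Sum>i<N * K. slope T N f (i div K) * slope T (N * K) f i * (T / real (N * K))) = energy T N f"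
    and "(\<Sum>i<N * K. (slope T N f (i div K))\<^sup>2 * (T / real (N * K))) = energy T N f"
proof -
  have sm: "slope T (N * K) f i * (T / real (N * K)) = incr T (N * K) f i" for i
    using assms by (intro slope_mult) auto
  have "(\<Sum>i<N * K. slope T N f (i div K) * slope T (N * K) f i * (T / real (N * K))) =
    (\<Sum>i<N * K. slope T N f (i div K) * incr T (N * K) f i)"
    by (simp only: mult.assoc sm)
  also have "\<dots> = (\<Sum>j<N. slope T N f j * incr T N f j)"
    by (rule sum_blocks[OF assms(3)])
  also have "\<dots> = energy T N f"
    unfolding energy_def using assms
    by (intro sum.cong) (auto simp: power2_eq_square slope_mult[symmetric] mult.assoc)
  finally show "(\<Sum>i<N * K. slope T N f (i div K) * slope T (N * K) f i * (T / real (N * K))) = energy T N f" .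
  have id: "incr T M (\<lambda>x. x) i = T / real M" for M i
    by (simp add: incr_def grid_def field_simps add_divide_distrib)
  show "(\<Sum>i<N * K. (slope T N f (i div K))\<^sup>2 * (T / real (N * K))) = energy T N f"
    using sum_blocks[OF assms(3), of "\<lambda>j. (slope T N f j)\<^sup>2" T N "\<lambda>x. x"]
    unfolding id energy_def .
qed

definition cell :: "real \<Rightarrow> nat \<Rightarrow> real \<Rightarrow> nat" where
  "cell T N s = nat \<lfloor>s * real N / T\<rfloor>"

lemma cell_eq_iff:
  assumes "0 < T" "0 < N" "0 \<le> s"
  shows "cell T N s = i \<longleftrightarrow> grid T N i \<le> s \<and> s < grid T N (Suc i)"
proof -
  have "cell T N s = i \<longleftrightarrow> \<lfloor>s * real N / T\<rfloor> = int i"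
    using assms by (auto simp: cell_def)
  also have "\<dots> \<longleftrightarrow> real i \<le> s * real N / T \<and> s * real N / T < real i + 1"
    by (simp add: floor_eq_iff)
  also have "\<dots> \<longleftrightarrow> grid T N i \<le> s \<and> s < grid T N (Suc i)"
    using assms by (simp add: grid_def field_simps)
  finally show ?thesis .
qed

lemma cell_less:
  assumes "0 < T" "0 < N" "s \<in> {0..<T}"
  shows "cell T N s < N"
proof -
  have "s * real N / T < real N"
    using assms by (simp add: field_simps)
  moreover have "0 \<le> s * real N / T"
    using assms by simp
  ultimately show ?thesis
    unfolding cell_def by linarith
qed

lemma cell_refine:
  assumes "0 < T" "0 < K" "0 \<le> s"
  shows "cell T N s = cell T (N * K) s div K"
proof -
  have "\<lfloor>s * real N / T\<rfloor> = \<lfloor>(s * real (N * K) / T) / real_of_int (int K)\<rfloor>"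
    using assms by (simp add: field_simps)
  also have "\<dots> = \<lfloor>s * real (N * K) / T\<rfloor> div int K"
    by (rule floor_divide_real_eq_div) simp
  finally show ?thesis
    using assms by (simp add: cell_def nat_div_distrib)
qed

lemma has_bochner_integral_cell:
  fixes \<phi> :: "nat \<Rightarrow> real"
  assumes "0 < T" "0 < N"
  shows "has_bochner_integral (restrict_space lborel {0..<T}) (\<lambda>s. \<phi> (cell T N s)) (\<Sum>i<N. \<phi> i * (T / N))"
proof -
  have le: "grid T N i \<le> grid T N (Suc i)" for i
    using assms by (simp add: grid_def divide_right_mono)
  have eq: "indicator {0..<T} s *\<^sub>R \<phi> (cell T N s) =
      (\<Sum>i<N. \<phi> i * indicator {grid T N i..<grid T N (Suc i)} s)" for s
  proof (cases "s \<in> {0..<T}")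
    case True
    then have "(\<Sum>i<N. \<phi> i * indicator {grid T N i..<grid T N (Suc i)} s) =
        (\<Sum>i<N. if cell T N s = i then \<phi> i else 0)"
      using cell_eq_iff[OF assms] by (intro sum.cong) (auto simp: indicator_def)
    then show ?thesis
      using True cell_less[OF assms True] by (simp add: sum.delta')
  next
    case False
    have "s \<notin> {grid T N i..<grid T N (Suc i)}" if "i < N" for i
      using False grid_mem[of T i N] grid_mem[of T "Suc i" N] that assms by auto
    then have "(\<Sum>i<N. \<phi> i * indicator {grid T N i..<grid T N (Suc i)} s) = 0"
      by (intro sum.neutral) (auto simp: indicator_def)
    with False show ?thesis by simp
  qed
  have "has_bochner_integral lborel (indicator {grid T N i..<grid T N (Suc i)} :: real \<Rightarrow> real) (T / N)" for i
  proof -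
    have "has_bochner_integral lborel (indicator {grid T N i..<grid T N (Suc i)} :: real \<Rightarrow> real)
        (measure lborel {grid T N i..<grid T N (Suc i)})"
      using le by (intro has_bochner_integral_real_indicator) auto
    also have "measure lborel {grid T N i..<grid T N (Suc i)} = T / N"
      using le by (simp add: measure_def grid_def field_simps add_divide_distrib)
    finally show ?thesis .
  qed
  then have "has_bochner_integral lborel
      (\<lambda>s. \<Sum>i<N. \<phi> i * indicator {grid T N i..<grid T N (Suc i)} s) (\<Sum>i<N. \<phi> i * (T / N))"
    by (intro has_bochner_integral_sum has_bochner_integral_mult_right)
  then show ?thesis
    unfolding eq[symmetric] by (subst has_bochner_integral_restrict_space) auto
qed

text \<open>The step functions formed by the slopes of \<open>f\<close> are a square-integrable martingale on the interval,
bounded in \<open>L\<^sup>2\<close> because its squared norms are the energies. Its limit \<open>g\<close> is the derivative of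
\<open>f\<close>: at a dyadic time \<open>t\<close> the integral of the step function over \<open>{0..t}\<close> is \<open>f t\<close> from some level
on, and both sides of the claimed identity are continuous in \<open>t\<close>.\<close>

lemma finite_energy_imp_primitive:
  assumes "0 < T" "continuous_on {0..T} f" "f 0 = 0" and bound: "\<And>n. energy T (2 ^ n) f \<le> C"
  obtains g where "g \<in> borel_measurable lborel" "integrable lborel g"
    "integrable lborel (\<lambda>s. (g s)\<^sup>2)" "(\<integral>s. (g s)\<^sup>2 \<partial>lborel) \<le> C"
    "\<And>t. t \<in> {0..T} \<Longrightarrow> f t = (LBINT s:{0..t}. g s)" "\<And>s. s \<notin> {0..T} \<Longrightarrow> g s = 0"
proof -
  define M where "M = restrict_space lborel {0..<T}"
  have M: "finite_measure M"
    unfolding M_def using assms(1) by (intro finite_measureI) (simp add: emeasure_restrict_space)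
  interpret M: finite_measure M by fact
  define h where "h n s = slope T (2 ^ n) f (cell T (2 ^ n) s)" for n s
  have step: "has_bochner_integral M (\<lambda>s. \<phi> (cell T (2 ^ n) s)) (\<Sum>i<2 ^ n. \<phi> i * (T / real (2 ^ n)))"
    for \<phi> :: "nat \<Rightarrow> real" and n
    using has_bochner_integral_cell[OF assms(1), of "2 ^ n" \<phi>] by (simp add: M_def)
  have hm: "h n \<in> borel_measurable M" for n
    using step[of "slope T (2 ^ n) f" n] unfolding h_def has_bochner_integral_iff by auto
  have hint: "integrable M (h n)" for n
    using step[of "slope T (2 ^ n) f" n] unfolding h_def has_bochner_integral_iff by auto
  have spM: "space M = {0..<T}"
    by (simp add: M_def)
  have inner: "(\<integral>s. h n s * h m s \<partial>M) = energy T (2 ^ n) f" if "n \<le> m" for n m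
  proof -
    define K :: nat where "K = 2 ^ (m - n)"
    have K: "0 < K" "(2::nat) ^ m = 2 ^ n * K"
      using that by (auto simp: K_def power_add[symmetric])
    have "(\<integral>s. h n s * h m s \<partial>M) =
      (\<integral>s. slope T (2 ^ n) f (cell T (2 ^ m) s div K) * slope T (2 ^ m) f (cell T (2 ^ m) s) \<partial>M)"
      unfolding h_def
      by (intro Bochner_Integration.integral_cong refl) (use cell_refine[OF assms(1) K(1), of _ "2 ^ n"] spM in \<open>simp add: K(2)\<close>)
    also have "\<dots> = (\<Sum>i<2 ^ m. slope T (2 ^ n) f (i div K) * slope T (2 ^ m) f i * (T / real (2 ^ m)))"
      by (rule has_bochner_integral_integral_eq[OF step[of "\<lambda>i. slope T (2 ^ n) f (i div K) * slope T (2 ^ m) f i" m]])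
    also have "\<dots> = energy T (2 ^ n) f"
      unfolding K(2) using assms(1) K(1) by (intro slope_inner) auto
    finally show ?thesis .
  qed
  have sq: "integrable M (\<lambda>s. (h n s)\<^sup>2)" for n
    using step[of "\<lambda>i. (slope T (2 ^ n) f i)\<^sup>2" n] unfolding h_def has_bochner_integral_iff by auto
  obtain Y r where Y: "Y \<in> borel_measurable M" "strict_mono r"
    "AE s in M. (\<lambda>k. h (r k) s) \<longlonglongrightarrow> Y s" "integrable M (\<lambda>s. (Y s)\<^sup>2)" "(\<integral>s. (Y s)\<^sup>2 \<partial>M) \<le> C"
    "(\<lambda>k. \<integral>s. \<bar>h (r k) s - Y s\<bar> \<partial>M) \<longlonglongrightarrow> 0"
    by (rule L2_bounded_martingale_converges[OF M hm sq inner bound]) (assumption | rule that)+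
  define g where "g s = indicator {0..<T} s *\<^sub>R Y s" for s
  have Y1: "integrable M Y"
    by (rule M.square_integrable_imp_integrable[OF Y(1,4)])
  have g1: "integrable lborel g"
    using Y1 unfolding M_def g_def by (subst (asm) integrable_restrict_space) auto
  have g2eq: "(g s)\<^sup>2 = indicator {0..<T} s *\<^sub>R (Y s)\<^sup>2" for s
    by (simp add: g_def indicator_def)
  have g2: "integrable lborel (\<lambda>s. (g s)\<^sup>2)"
    using Y(4) unfolding M_def g2eq by (subst (asm) integrable_restrict_space) auto
  have g2C: "(\<integral>s. (g s)\<^sup>2 \<partial>lborel) \<le> C"
    using Y(5) unfolding M_def g2eq by (subst (asm) integral_restrict_space) auto
  define G where "G t = (LBINT s:{0..t}. g s)" for t
  have gset: "set_integrable lborel A g" if "A \<in> sets lborel" for A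
    unfolding set_integrable_def using integrable_mult_indicator[OF that g1] .
  have Gcont: "continuous_on {0..T} G"
  proof -
    have "G = (\<lambda>t. integral {0..t} g)"
      unfolding G_def using gset by (intro ext set_borel_integral_eq_integral(2)) auto
    moreover have "g integrable_on {0..T}"
      using gset by (intro set_borel_integral_eq_integral(1)) auto
    ultimately show ?thesis
      using indefinite_integral_continuous_1 by metis
  qed
  have eq: "f (grid T (2 ^ n) j) = G (grid T (2 ^ n) j)" if j: "j \<le> 2 ^ n" for n j
  proof -
    define t where "t = grid T (2 ^ n) j"
    have t: "t \<in> {0..T}"
      unfolding t_def using assms(1) j by (intro grid_mem) auto
    have Gt: "G t = (\<integral>s. indicator {0..<t} s * Y s \<partial>M)"
    proof -
      have "G t = (\<integral>s. indicator {0..<t} s * g s \<partial>lborel)"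
        unfolding G_def set_lebesgue_integral_def
      proof (rule integral_cong_AE)
        show "(\<lambda>s. indicator {0..<t} s * g s) \<in> borel_measurable lborel"
          using g1 by (intro borel_measurable_times) auto
        show "(\<lambda>s. indicator {0..t} s *\<^sub>R g s) \<in> borel_measurable lborel"
          using g1 by (intro borel_measurable_scaleR) auto
        show "AE s in lborel. indicator {0..t} s *\<^sub>R g s = indicator {0..<t} s * g s"
          using AE_lborel_singleton[of t] by eventually_elim (auto simp: indicator_def)
      qed
      also have "\<dots> = (\<integral>s. indicator {0..<T} s *\<^sub>R (indicator {0..<t} s * Y s) \<partial>lborel)"
        by (intro Bochner_Integration.integral_cong) (auto simp: g_def)
      also have "\<dots> = (\<integral>s. indicator {0..<t} s * Y s \<partial>M)"
        unfolding M_def by (subst integral_restrict_space) auto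
      finally show ?thesis .
    qed
    have hk: "(\<integral>s. indicator {0..<t} s * h m s \<partial>M) = f t" if "n \<le> m" for m
    proof -
      define K :: nat where "K = 2 ^ (m - n)"
      have K: "0 < K" "(2::nat) ^ m = 2 ^ n * K"
        using that by (auto simp: K_def power_add[symmetric])
      have tK: "t = grid T (2 ^ m) (j * K)"
        unfolding t_def K(2) by (rule grid_refine[OF K(1), symmetric])
      have ind: "indicator {0..<t} s = (if cell T (2 ^ m) s < j * K then 1 else 0 :: real)" if "s \<in> {0..<T}" for s
      proof -
        have "cell T (2 ^ m) s < j * K \<longleftrightarrow> s < t"
        proof -
          have "cell T (2 ^ m) s < j * K \<longleftrightarrow> \<lfloor>s * real (2 ^ m) / T\<rfloor> < int (j * K)"
            using that assms(1) unfolding cell_def by (subst nat_less_iff) auto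
          also have "\<dots> \<longleftrightarrow> s * real (2 ^ m) / T < real (j * K)"
            by (simp add: floor_less_iff)
          also have "\<dots> \<longleftrightarrow> s < t"
            using assms(1) unfolding tK grid_def by (simp add: field_simps)
          finally show ?thesis .
        qed
        then show ?thesis using that by (auto simp: indicator_def)
      qed
      have "(\<integral>s. indicator {0..<t} s * h m s \<partial>M) =
          (\<integral>s. (if cell T (2 ^ m) s < j * K then 1 else 0) * slope T (2 ^ m) f (cell T (2 ^ m) s) \<partial>M)"
        unfolding h_def by (intro Bochner_Integration.integral_cong refl) (simp add: ind spM)
      also have "\<dots> = (\<Sum>i<2 ^ m. (if i < j * K then 1 else 0) * slope T (2 ^ m) f i * (T / real (2 ^ m)))"
        by (rule has_bochner_integral_integral_eq[OF step[of "\<lambda>i. (if i < j * K then 1 else 0) * slope T (2 ^ m) f i" m]])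
      also have "\<dots> = (\<Sum>i<2 ^ m. if i < j * K then incr T (2 ^ m) f i else 0)"
        using slope_mult[OF assms(1), of "2 ^ m" f] by (intro sum.cong) auto
      also have "\<dots> = (\<Sum>i\<in>{..<2 ^ m} \<inter> {i. i < j * K}. incr T (2 ^ m) f i)"
        by (simp add: sum.inter_restrict)
      also have "{..<2 ^ m} \<inter> {i. i < j * K} = {..<j * K}"
      proof -
        have "j * K \<le> 2 ^ m" unfolding K(2) using j by simp
        then show ?thesis by auto
      qed
      also have "(\<Sum>i<j * K. incr T (2 ^ m) f i) = f t"
        using assms(3) by (simp add: sum_incr tK)
      finally show ?thesis .
    qed
    have "\<bar>f t - G t\<bar> \<le> (\<integral>s. \<bar>h (r k) s - Y s\<bar> \<partial>M)" if "n \<le> k" for k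
    proof -
      have ind: "integrable M (\<lambda>s. indicator {0..<t} s * u s)" if "integrable M u" for u :: "real \<Rightarrow> real"
        using t that integrable_real_mult_indicator[of "{0..<t}" M u]
        by (auto simp: M_def sets_restrict_space_iff mult.commute)
      have "n \<le> r k"
        using that seq_suble[OF Y(2), of k] by simp
      then have "f t - G t = (\<integral>s. indicator {0..<t} s * h (r k) s \<partial>M) - (\<integral>s. indicator {0..<t} s * Y s \<partial>M)"
        by (simp add: hk Gt)
      also have "\<dots> = (\<integral>s. indicator {0..<t} s * h (r k) s - indicator {0..<t} s * Y s \<partial>M)"
        by (rule Bochner_Integration.integral_diff[symmetric]) (intro ind hint Y1)+
      also have "\<bar>\<dots>\<bar> \<le> (\<integral>s. \<bar>indicator {0..<t} s * h (r k) s - indicator {0..<t} s * Y s\<bar> \<partial>M)"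
        by (rule integral_abs_bound)
      also have "\<dots> \<le> (\<integral>s. \<bar>h (r k) s - Y s\<bar> \<partial>M)"
        by (intro integral_mono Bochner_Integration.integrable_abs Bochner_Integration.integrable_diff ind hint Y1)
          (auto simp: indicator_def)
      finally show ?thesis .
    qed
    then have "\<forall>\<^sub>F k in sequentially. norm (f t - G t) \<le> (\<integral>s. \<bar>h (r k) s - Y s\<bar> \<partial>M)"
      by (auto simp: eventually_sequentially)
    from Lim_null_comparison[OF this Y(6)] have "f t - G t = 0"
      by (simp add: LIMSEQ_const_iff)
    then show ?thesis by (simp add: t_def)
  qed
  have "f t = G t" if t: "t \<in> {0..T}" for t
  proof -
    have "f t - G t \<le> 0"
      by (rule dyadic_dense[OF assms(1) continuous_on_diff[OF assms(2) Gcont] _ t]) (simp add: eq)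
    moreover have "G t - f t \<le> 0"
      by (rule dyadic_dense[OF assms(1) continuous_on_diff[OF Gcont assms(2)] _ t]) (simp add: eq)
    ultimately show ?thesis by simp
  qed
  then show thesis
    using g1 g2 g2C by (intro that[of g]) (auto simp: G_def g_def)
qed

text \<open>Over each cell the slope of \<open>f\<close> is the average of \<open>g\<close>, so this is Jensen's inequality. It follows by
integrating \<open>(g s - c)\<^sup>2 \<ge> 0\<close> over the cell, where \<open>c\<close> is the slope.\<close>

lemma energy_le_primitive:
  assumes "0 < T" "0 < N" and g: "set_integrable lborel {0..T} g" and g2: "set_integrable lborel {0..T} (\<lambda>s. (g s)\<^sup>2)"
    and f: "\<And>t. t \<in> {0..T} \<Longrightarrow> f t = (LBINT s:{0..t}. g s)"
  shows "energy T N f \<le> (LBINT s:{0..T}. (g s)\<^sup>2)"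
proof -
  have sub: "set_integrable lborel {a..b} g" "set_integrable lborel {a..b} (\<lambda>s. (g s)\<^sup>2)"
    if "0 \<le> a" "b \<le> T" for a b
    using that by (auto intro: set_integrable_subset[OF g] set_integrable_subset[OF g2])
  have HK: "(LBINT s:{a..b}. g s) = integral {a..b} g" "g integrable_on {a..b}"
    "(LBINT s:{a..b}. (g s)\<^sup>2) = integral {a..b} (\<lambda>s. (g s)\<^sup>2)" "(\<lambda>s. (g s)\<^sup>2) integrable_on {a..b}"
    if "0 \<le> a" "b \<le> T" for a b
    using set_borel_integral_eq_integral[OF sub(1)[OF that]] set_borel_integral_eq_integral[OF sub(2)[OF that]]
    by auto
  have "(\<Sum>i<j. (slope T N f i)\<^sup>2 * (T / N)) \<le> integral {0..grid T N j} (\<lambda>s. (g s)\<^sup>2)" if "j \<le> N" for j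
    using that
  proof (induction j)
    case (Suc j)
    define a where "a = grid T N j"
    define b where "b = grid T N (Suc j)"
    define c where "c = slope T N f j"
    have ab: "0 \<le> a" "a \<le> b" "b \<le> T" "b - a = T / N"
      using Suc.prems assms(1,2) grid_mem[of T "Suc j" N] grid_mem[of T j N]
      by (auto simp: a_def b_def grid_def divide_simps algebra_simps)
    have "integral {a..b} g = f b - f a"
      using ab f[of a] f[of b] HK(1)[of 0 a] HK(1)[of 0 b]
        Henstock_Kurzweil_Integration.integral_combine[OF ab(1,2) HK(2)[of 0 b]] by simp
    also have "\<dots> = c * (T / N)"
      using slope_mult[OF assms(1,2), of f j] by (simp add: c_def incr_def a_def b_def)
    finally have gab: "integral {a..b} g = c * (T / N)" .
    have "0 \<le> integral {a..b} (\<lambda>s. (g s - c)\<^sup>2)"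
      by (rule Henstock_Kurzweil_Integration.integral_nonneg)
        (use HK(2,4)[of a b] ab in \<open>auto simp: power2_diff intro!: integrable_add integrable_diff integrable_on_mult_right integrable_on_mult_left intro: order_trans[OF _ sum_squares_bound]\<close>)
    also have "integral {a..b} (\<lambda>s. (g s - c)\<^sup>2) =
        integral {a..b} (\<lambda>s. (g s)\<^sup>2 - 2 * c * g s + c\<^sup>2)"
      by (simp add: power2_diff algebra_simps)
    also have "\<dots> = integral {a..b} (\<lambda>s. (g s)\<^sup>2) - 2 * c * integral {a..b} g + c\<^sup>2 * (b - a)"
    proof (rule integral_unique)
      show "((\<lambda>s. (g s)\<^sup>2 - 2 * c * g s + c\<^sup>2) has_integral
          integral {a..b} (\<lambda>s. (g s)\<^sup>2) - 2 * c * integral {a..b} g + c\<^sup>2 * (b - a)) {a..b}"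
        using has_integral_const_real[of "c\<^sup>2" a b] HK(2,4)[of a b] ab
        by (intro has_integral_add has_integral_diff has_integral_mult_right integrable_integral)
          (auto simp: mult.commute)
    qed
    also have "\<dots> = integral {a..b} (\<lambda>s. (g s)\<^sup>2) - c\<^sup>2 * (T / N)"
      unfolding gab ab(4) by (simp add: power2_eq_square)
    finally have "c\<^sup>2 * (T / N) \<le> integral {a..b} (\<lambda>s. (g s)\<^sup>2)"
      by simp
    moreover have "integral {0..a} (\<lambda>s. (g s)\<^sup>2) + integral {a..b} (\<lambda>s. (g s)\<^sup>2) = integral {0..b} (\<lambda>s. (g s)\<^sup>2)"
      using ab HK(4)[of 0 b] by (intro Henstock_Kurzweil_Integration.integral_combine) auto
    moreover have "(\<Sum>i<j. (slope T N f i)\<^sup>2 * (T / N)) \<le> integral {0..a} (\<lambda>s. (g s)\<^sup>2)"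
      using Suc by (simp add: a_def)
    ultimately show ?case
      by (simp add: c_def b_def)
  qed simp
  from this[of N] HK(3)[of 0 T] show ?thesis
    using assms(2) by (simp add: energy_def grid_def)
qed

lemma lebesgue_differentiation_right:
  fixes G :: "real \<Rightarrow> real"
  assumes "\<And>a b. G integrable_on cbox a b"
  obtains N where "negligible N" "\<And>x e. x \<notin> N \<Longrightarrow> 0 < e \<Longrightarrow>
      \<exists>d>0. \<forall>h. 0 < h \<and> h < d \<longrightarrow> \<bar>integral {x..x + h} G / h - G x\<bar> < e"
proof -
  have eq: "norm (integral (cbox x (x + h *\<^sub>R One)) G /\<^sub>R h ^ DIM(real) - G x) =
      \<bar>integral {x..x + h} G / h - G x\<bar>" for x h
    by (simp add: divide_inverse mult.commute)
  obtain N where "negligible N" "\<And>x e. \<lbrakk>x \<notin> N; 0 < e\<rbrakk> \<Longrightarrow>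
      \<exists>d>0. \<forall>h. 0 < h \<and> h < d \<longrightarrow>
        norm (integral (cbox x (x + h *\<^sub>R One)) G /\<^sub>R h ^ DIM(real) - G x) < e"
    by (rule integrable_ccontinuous_explicit[OF assms]) (rule that)
  then show thesis
    unfolding eq by (rule that)
qed

text \<open>One-sided differentiation is applied to \<open>g\<close> and to its reflection at \<open>0\<close>, which yields the left
derivative. The function \<open>f\<close> is constrained on the interval only, so the endpoints are discarded
along with the two null sets.\<close>

lemma AE_has_derivative_primitive:
  assumes "0 < T" and g: "set_integrable lborel {0..T} g"
    and f: "\<And>t. t \<in> {0..T} \<Longrightarrow> f t = (LBINT s:{0..t}. g s)"
  shows "AE x in lborel. x \<in> {0..T} \<longrightarrow> (f has_real_derivative g x) (at x)"
proof -
  define G where "G s = indicator {0..T} s *\<^sub>R g s" for s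
  have G: "integrable lborel G"
    using g unfolding set_integrable_def G_def .
  have Gset: "set_integrable lborel A G" if "A \<in> sets lborel" for A
    unfolding set_integrable_def using integrable_mult_indicator[OF that G] .
  have GI: "G integrable_on cbox a b" for a b
    using Gset by (intro set_borel_integral_eq_integral(1)) auto
  have GI': "(\<lambda>s. G (- s)) integrable_on cbox a b" for a b
    using GI[of "- b" "- a"] Henstock_Kurzweil_Integration.integrable_reflect_real[where f = G and a = "- b" and b = "- a"] by simp
  obtain N1 where N1: "negligible N1" "\<And>x e. x \<notin> N1 \<Longrightarrow> 0 < e \<Longrightarrow>
      \<exists>d>0. \<forall>h. 0 < h \<and> h < d \<longrightarrow> \<bar>integral {x..x + h} G / h - G x\<bar> < e"
    by (rule lebesgue_differentiation_right[OF GI]) (rule that)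
  obtain N2 where N2: "negligible N2" "\<And>x e. x \<notin> N2 \<Longrightarrow> 0 < e \<Longrightarrow>
      \<exists>d>0. \<forall>h. 0 < h \<and> h < d \<longrightarrow> \<bar>integral {x..x + h} (\<lambda>s. G (- s)) / h - G (- x)\<bar> < e"
    by (rule lebesgue_differentiation_right[OF GI']) (rule that)
  have diff: "f b - f a = integral {a..b} G" if "0 \<le> a" "a \<le> b" "b \<le> T" for a b
  proof -
    have "f t = integral {0..t} G" if "t \<in> {0..T}" for t
    proof -
      have "f t = (LBINT s:{0..t}. G s)"
        unfolding f[OF that] set_lebesgue_integral_def G_def
        by (intro Bochner_Integration.integral_cong) (use that in \<open>auto simp: indicator_def\<close>)
      also have "\<dots> = integral {0..t} G"
        using Gset by (intro set_borel_integral_eq_integral(2)) auto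
      finally show ?thesis .
    qed
    then show ?thesis
      using that Henstock_Kurzweil_Integration.integral_combine[OF that(1,2), of G] GI[of 0 b]
      by simp
  qed
  have neg: "negligible (N1 \<union> uminus ` N2 \<union> {0, T})"
    using N1(1) N2(1)
    by (intro negligible_Un negligible_differentiable_image_negligible) (auto simp: differentiable_on_minus differentiable_on_ident)
  then have "AE x in lebesgue. x \<notin> N1 \<union> uminus ` N2 \<union> {0, T}"
    unfolding negligible_iff_null_sets by (rule AE_not_in)
  then have "AE x in lborel. x \<notin> N1 \<union> uminus ` N2 \<union> {0, T}"
    by (simp only: AE_completion_iff)
  then show ?thesis
  proof eventually_elim
    case (elim x)
    show ?case
    proof
      assume "x \<in> {0..T}"
      with elim have x: "0 < x" "x < T" and xN1: "x \<notin> N1"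
        by auto
      have xN2: "- x \<notin> N2"
      proof
        assume "- x \<in> N2"
        then have "x \<in> uminus ` N2"
          by (rule image_eqI[rotated]) simp
        with elim show False by simp
      qed
      have Gx: "G x = g x"
        using x by (simp add: G_def)
      show "(f has_real_derivative g x) (at x)"
        unfolding DERIV_def
      proof (rule LIM_I)
        fix e :: real assume "0 < e"
        obtain d1 where d1: "d1 > 0" "\<And>h. 0 < h \<Longrightarrow> h < d1 \<Longrightarrow> \<bar>integral {x..x + h} G / h - G x\<bar> < e"
          using N1(2)[OF xN1 \<open>0 < e\<close>] by metis
        obtain d2 where d2: "d2 > 0" "\<And>h. 0 < h \<Longrightarrow> h < d2 \<Longrightarrow>
            \<bar>integral {- x..- x + h} (\<lambda>s. G (- s)) / h - G x\<bar> < e"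
          using N2(2)[OF xN2 \<open>0 < e\<close>] by (metis minus_minus)
        define d where "d = min (min d1 d2) (min x (T - x))"
        have "norm ((f (x + h) - f x) / h - g x) < e" if h: "h \<noteq> 0" "\<bar>h\<bar> < d" for h
        proof (cases "h > 0")
          case True
          then have "f (x + h) - f x = integral {x..x + h} G"
            using h x by (intro diff) (auto simp: d_def)
          then show ?thesis
            using d1(2)[of h] True h by (simp add: d_def Gx)
        next
          case False
          then have "f x - f (x + h) = integral {x + h..x} G"
            using h x by (intro diff) (auto simp: d_def)
          also have "\<dots> = integral {- x..- x + (- h)} (\<lambda>s. G (- s))"
            using Henstock_Kurzweil_Integration.integral_reflect_real[of "x" "x + h" G] by (simp add: add.commute)
          finally have "(f (x + h) - f x) / h = integral {- x..- x + (- h)} (\<lambda>s. G (- s)) / (- h)"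
            using h by (simp add: field_simps)
          then show ?thesis
            using d2(2)[of "- h"] False h by (simp add: d_def Gx)
        qed
        moreover have "d > 0"
          using d1(1) d2(1) x by (simp add: d_def)
        ultimately show "\<exists>d>0. \<forall>h. h \<noteq> 0 \<and> norm (h - 0) < d \<longrightarrow> norm ((f (x + h) - f x) / h - g x) < e"
          by (intro exI[of _ d]) auto
      qed
    qed
  qed
qed

section \<open>The Cameron-Martin theorem\<close>

text \<open>Elements of the path space are \<^term>\<open>undefined\<close> outside the time interval, hence the restriction.\<close>

definition shift :: "real \<Rightarrow> (real \<Rightarrow> real) \<Rightarrow> (real \<Rightarrow> real) \<Rightarrow> (real \<Rightarrow> real)" where
  "shift T f w = (\<lambda>t\<in>{0..T}. w t + f t)"

lemma shift_apply [simp]: "t \<in> {0..T} \<Longrightarrow> shift T f w t = w t + f t"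
  by (simp add: shift_def)

lemma shift_in_C0:
  assumes "0 < T" "continuous_on {0..T} f" "f 0 = 0" "w \<in> C0 T"
  shows "shift T f w \<in> C0 T"
proof -
  have "continuous_on {0..T} (\<lambda>t. w t + f t)"
    using assms C0_continuous_on by (intro continuous_on_add) auto
  then have "continuous_on {0..T} (shift T f w)"
    by (rule continuous_on_eq) simp
  then show ?thesis
    using assms C0_at_0[OF assms(4)] by (simp add: C0_eq) (simp add: shift_def)
qed

lemma measurable_shift:
  assumes "0 < T" "continuous_on {0..T} f" "f 0 = 0" "t \<le> T"
  shows "shift T f \<in> measurable (path_filtration T t) (path_filtration T t)"
proof (rule measurable_into_path_filtration)
  fix s assume s: "s \<in> {0..t}"
  have "(\<lambda>w. w s + f s) \<in> borel_measurable (path_filtration T t)"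
    using measurable_coordinate[OF s] by (intro borel_measurable_add) auto
  then show "(\<lambda>w. shift T f w s) \<in> borel_measurable (path_filtration T t)"
    using s assms(4) by (simp add: shift_def)
qed (use shift_in_C0[OF assms(1-3)] in auto)

text \<open>The Wiener integral of the step function with the slopes of \<open>f\<close>, evaluated at the path \<open>w\<close>. On fine
grids it approximates the Wiener integral of the derivative of \<open>f\<close>, and the density below
approximates that of the law of Brownian motion shifted by \<open>f\<close>.\<close>

definition wiener_sum :: "real \<Rightarrow> nat \<Rightarrow> (real \<Rightarrow> real) \<Rightarrow> (real \<Rightarrow> real) \<Rightarrow> real" where
  "wiener_sum T N f w = (\<Sum>i<N. slope T N f i * incr T N w i)"

definition cm_density :: "real \<Rightarrow> nat \<Rightarrow> (real \<Rightarrow> real) \<Rightarrow> (real \<Rightarrow> real) \<Rightarrow> real" where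
  "cm_density T N f w = exp (wiener_sum T N f w - energy T N f / 2)"

lemma measurable_wiener_sum:
  "0 < T \<Longrightarrow> wiener_sum T N f \<in> borel_measurable (C0_borel T)"
  unfolding wiener_sum_def
  by (intro borel_measurable_sum borel_measurable_times measurable_incr) auto

lemma measurable_cm_density:
  "0 < T \<Longrightarrow> cm_density T N f \<in> borel_measurable (C0_borel T)"
  unfolding cm_density_def
  by (intro borel_measurable_exp[THEN measurable_compose[rotated]] borel_measurable_diff measurable_wiener_sum) auto

lemma wiener_sum_self:
  assumes "0 < T" "0 < N"
  shows "wiener_sum T N f f = energy T N f"
  unfolding wiener_sum_def energy_def
  by (simp only: slope_mult[OF assms, symmetric] power2_eq_square mult.assoc)

lemma cm_density_pos: "0 < cm_density T N f w"
  by (simp add: cm_density_def)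

lemma nn_integral_normal_density: "0 < \<sigma> \<Longrightarrow> (\<integral>\<^sup>+x. ennreal (normal_density m \<sigma> x) \<partial>lborel) = 1"
  by (subst nn_integral_eq_integral) auto

lemma nn_integral_exp_increments:
  assumes "0 < T" "0 < N" and M: "prob_space M" "sets M = sets (C0_borel T)"
    and bm: "brownian_motion T M (\<lambda>t w. w t - f t)"
  shows "(\<integral>\<^sup>+w. ennreal (exp ((\<Sum>i<N. c i * (incr T N w i - incr T N f i)) - (\<Sum>i<N. (c i)\<^sup>2 * (T / N)) / 2)) \<partial>M) = 1"
proof -
  define \<phi> where "\<phi> i x = ennreal (exp (c i * x - (c i)\<^sup>2 * (T / N) / 2))" for i x
  have sqrt: "0 < sqrt (T / N)" "(sqrt (T / N))\<^sup>2 = T / N"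
    using assms by auto
  have \<phi>: "\<phi> i \<in> borel_measurable borel" for i
    unfolding \<phi>_def by measurable
  have "(\<integral>\<^sup>+w. ennreal (exp ((\<Sum>i<N. c i * (incr T N w i - incr T N f i)) - (\<Sum>i<N. (c i)\<^sup>2 * (T / N)) / 2)) \<partial>M) =
    (\<integral>\<^sup>+w. (\<Prod>i<N. \<phi> i ((w (grid T N (Suc i)) - f (grid T N (Suc i))) - (w (grid T N i) - f (grid T N i)))) \<partial>M)"
  proof (intro nn_integral_cong)
    fix w
    have "exp ((\<Sum>i<N. c i * (incr T N w i - incr T N f i)) - (\<Sum>i<N. (c i)\<^sup>2 * (T / N)) / 2) =
      (\<Prod>i<N. exp (c i * (incr T N w i - incr T N f i) - (c i)\<^sup>2 * (T / N) / 2))"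
      by (simp only: exp_sum[OF finite_lessThan, symmetric] sum_subtractf sum_divide_distrib)
    moreover have "incr T N w i - incr T N f i =
      (w (grid T N (Suc i)) - f (grid T N (Suc i))) - (w (grid T N i) - f (grid T N i))" for i
      by (simp add: incr_def)
    ultimately show "ennreal (exp ((\<Sum>i<N. c i * (incr T N w i - incr T N f i)) - (\<Sum>i<N. (c i)\<^sup>2 * (T / N)) / 2)) =
      (\<Prod>i<N. \<phi> i ((w (grid T N (Suc i)) - f (grid T N (Suc i))) - (w (grid T N i) - f (grid T N i))))"
      by (simp only: \<phi>_def prod_ennreal[OF exp_ge_zero])
  qed
  also have "\<dots> = (\<Prod>i<N. \<integral>\<^sup>+x. ennreal (normal_density 0 (sqrt (T / N)) x) * \<phi> i x \<partial>lborel)"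
    by (rule nn_integral_brownian_increments[OF assms(1) M bm \<phi>]) simp
  also have "\<dots> = (\<Prod>i<N. 1)"
    using nn_integral_gaussian_tilt[OF sqrt(1), of "\<lambda>_. 1"] nn_integral_normal_density[OF sqrt(1), of 0]
    unfolding sqrt(2) \<phi>_def by (intro prod.cong) simp_all
  finally show ?thesis by (simp only: prod.neutral_const)
qed

lemma sets_increments:
  assumes "0 < T" "\<And>i. A i \<in> sets borel"
  shows "{w\<in>C0 T. \<forall>i<N. incr T N w i \<in> A i} \<in> sets (C0_borel T)"
proof -
  have "{w\<in>space (C0_borel T). \<forall>i\<in>{..<N}. incr T N w i \<in> A i} \<in> sets (C0_borel T)"
  proof (rule sets.sets_Collect_finite_All)
    fix i assume "i \<in> {..<N}"
    then have "(\<lambda>w. incr T N w i) \<in> borel_measurable (C0_borel T)"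
      using measurable_incr[OF assms(1)] by auto
    from measurable_sets[OF this assms(2)[of i]]
    show "{w\<in>space (C0_borel T). incr T N w i \<in> A i} \<in> sets (C0_borel T)"
      by (simp add: vimage_def Int_def conj_commute)
  qed auto
  then show ?thesis
    by (simp only: space_C0_borel Ball_def lessThan_iff)
qed

lemma prod_indicator_eq:
  "(\<Prod>i<N. indicator (A i) (x i) :: ennreal) = (if \<forall>i<N. x i \<in> A i then 1 else 0)" for N :: nat
proof (cases "\<forall>i<N. x i \<in> A i")
  case False
  then obtain i where "i < N" "x i \<notin> A i" by auto
  then have "(\<Prod>i<N. indicator (A i) (x i) :: ennreal) = 0"
    by (intro prod_zero) (auto intro!: bexI[of _ i])
  with False show ?thesis by simp
qed simp

text \<open>The right-hand side depends on \<open>f\<close> alone, so the drift determines the measure.\<close>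

lemma emeasure_increments_drifted:
  assumes "0 < T" and M: "prob_space M" "sets M = sets (C0_borel T)"
    and bm: "brownian_motion T M (\<lambda>t w. w t - f t)" and A: "\<And>i. A i \<in> sets borel"
  shows "emeasure M {w\<in>C0 T. \<forall>i<N. incr T N w i \<in> A i} =
    (\<Prod>i<N. \<integral>\<^sup>+x. ennreal (normal_density 0 (sqrt (T / N)) x) * indicator (A i) (x + incr T N f i) \<partial>lborel)"
proof -
  define S where "S = {w\<in>C0 T. \<forall>i<N. incr T N w i \<in> A i}"
  have sp: "space M = C0 T"
    using sets_eq_imp_space_eq[OF M(2)] by simp
  define \<phi> :: "nat \<Rightarrow> real \<Rightarrow> ennreal" where "\<phi> i x = indicator (A i) (x + incr T N f i)" for i x
  have \<phi>: "\<phi> i \<in> borel_measurable borel" for i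
    using A unfolding \<phi>_def by measurable
  have "S \<in> sets M"
    unfolding M(2) S_def by (rule sets_increments[OF assms(1) A])
  then have "emeasure M S =
    (\<integral>\<^sup>+w. indicator S w \<partial>M)"
    by (intro nn_integral_indicator[symmetric])
  also have "\<dots> = (\<integral>\<^sup>+w. (\<Prod>i<N. \<phi> i ((w (grid T N (Suc i)) - f (grid T N (Suc i))) - (w (grid T N i) - f (grid T N i)))) \<partial>M)"
  proof (intro nn_integral_cong)
    fix w assume w: "w \<in> space M"
    have "(w (grid T N (Suc i)) - f (grid T N (Suc i))) - (w (grid T N i) - f (grid T N i)) + incr T N f i = incr T N w i" for i
      by (simp add: incr_def)
    then have "(\<Prod>i<N. \<phi> i ((w (grid T N (Suc i)) - f (grid T N (Suc i))) - (w (grid T N i) - f (grid T N i)))) =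
      (\<Prod>i<N. indicator (A i) (incr T N w i))"
      by (simp add: \<phi>_def)
    also have "\<dots> = indicator S w"
      using w unfolding prod_indicator_eq S_def sp
      by (simp only: indicator_def mem_Collect_eq simp_thms of_bool_def)
    finally show "indicator S w =
      (\<Prod>i<N. \<phi> i ((w (grid T N (Suc i)) - f (grid T N (Suc i))) - (w (grid T N i) - f (grid T N i))))" ..
  qed
  also have "\<dots> = (\<Prod>i<N. \<integral>\<^sup>+x. ennreal (normal_density 0 (sqrt (T / N)) x) * \<phi> i x \<partial>lborel)"
    by (rule nn_integral_brownian_increments[OF assms(1) M bm \<phi>]) simp
  finally show ?thesis
    by (simp add: \<phi>_def S_def[symmetric])
qed

lemma brownian_motion_drift_unique:
  assumes "0 < T" and M: "prob_space M" "sets M = sets (C0_borel T)" "brownian_motion T M (\<lambda>t w. w t - f t)"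
    and M': "prob_space M'" "sets M' = sets (C0_borel T)" "brownian_motion T M' (\<lambda>t w. w t - f t)"
  shows "M = M'"
  by (rule measure_eqI_increments[OF assms(1) M(1,2) M'(1,2)])
    (simp only: emeasure_increments_drifted[OF assms(1) M] emeasure_increments_drifted[OF assms(1) M'])

locale wiener_space =
  fixes T :: real and \<mu>0 :: "(real \<Rightarrow> real) measure"
  assumes T_pos: "0 < T" and wiener: "wiener_measure T \<mu>0"
begin

lemma prob_space_wiener: "prob_space \<mu>0"
  and sets_wiener [measurable_cong]: "sets \<mu>0 = sets (C0_borel T)"
  and brownian_wiener: "brownian_motion T \<mu>0 (\<lambda>t w. w t - 0)"
  using wiener by (simp_all add: wiener_measure_def)

sublocale prob_space \<mu>0
  by (rule prob_space_wiener)

lemma space_wiener: "space \<mu>0 = C0 T"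
  using sets_eq_imp_space_eq[OF sets_wiener] by simp

lemma measurable_wiener: "f \<in> measurable (C0_borel T) N \<Longrightarrow> f \<in> measurable \<mu>0 N"
  by (simp add: measurable_cong_sets[OF sets_wiener refl])

definition shifted :: "(real \<Rightarrow> real) \<Rightarrow> (real \<Rightarrow> real) measure" where
  "shifted f = distr \<mu>0 (C0_borel T) (shift T f)"

lemma sets_shifted: "sets (shifted f) = sets (C0_borel T)"
  by (simp add: shifted_def)

context
  fixes f :: "real \<Rightarrow> real"
  assumes f: "continuous_on {0..T} f" "f 0 = 0"
begin

lemma measurable_shift_wiener: "shift T f \<in> measurable \<mu>0 (C0_borel T)"
proof -
  note sets_path_filtration_T[OF T_pos]
  from measurable_cong_sets[OF this this] measurable_shift[OF T_pos f order_refl]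
  show ?thesis
    by (intro measurable_wiener) auto
qed

lemma prob_space_shifted: "prob_space (shifted f)"
  unfolding shifted_def by (rule prob_space_distr[OF measurable_shift_wiener])

text \<open>The preimage under the shift of an event of the past is an event of the past, as \<open>f\<close> is
deterministic; so the independence of the increments carries over from Wiener measure.\<close>

lemma brownian_motion_shifted: "brownian_motion T (shifted f) (\<lambda>t w. w t - f t)"
  unfolding brownian_motion_def
proof (intro conjI ballI allI impI)
  interpret S: prob_space "shifted f" by (rule prob_space_shifted)
  have sp: "space (shifted f) = C0 T"
    using sets_eq_imp_space_eq[OF sets_shifted] by simp
  show "(\<lambda>w. w t - f t) \<in> borel_measurable (path_filtration T t)" if "t \<in> {0..T}" for t
    using that by (intro borel_measurable_diff measurable_coordinate) auto
  show "AE w in shifted f. w 0 - f 0 = 0"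
    by (rule AE_I2) (simp add: sp C0_at_0 f)
  show "AE w in shifted f. continuous_on {0..T} (\<lambda>t. w t - f t)"
    by (rule AE_I2) (simp add: sp continuous_on_diff[OF C0_continuous_on f(1)])
  fix s t assume st: "0 \<le> s \<and> s < t \<and> t \<le> T"
  define X where "X = (\<lambda>w :: real \<Rightarrow> real. w t - f t - (w s - f s))"
  have bm: "distributed \<mu>0 lborel (\<lambda>w. w t - w s) (normal_density 0 (sqrt (t - s)))"
    "indep_set (sets (path_filtration T s)) (sets (vimage_algebra (space \<mu>0) (\<lambda>w. w t - w s) borel))"
    using wiener st by (auto simp: wiener_measure_def brownian_motion_def)
  have Xm: "X \<in> borel_measurable (C0_borel T)"
    unfolding X_def using st by (intro borel_measurable_diff measurable_coordinate_C0_borel) auto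
  have comp: "X (shift T f w) = w t - w s" for w
    using st by (simp add: X_def)
  have "distr (shifted f) lborel X = distr \<mu>0 lborel (\<lambda>w. w t - w s)"
    unfolding shifted_def
    by (subst distr_distr[OF _ measurable_shift_wiener])
      (use Xm in \<open>simp_all add: comp_def comp\<close>)
  with bm(1) Xm show "distributed (shifted f) lborel (\<lambda>w. w t - f t - (w s - f s)) (normal_density 0 (sqrt (t - s)))"
    by (simp add: distributed_def X_def[symmetric] measurable_cong_sets[OF sets_shifted refl])
  have "S.indep_set (sets (path_filtration T s)) (sets (vimage_algebra (space (shifted f)) X borel))"
    unfolding S.indep_sets2_eq
  proof (intro conjI ballI)
    show sub: "sets (path_filtration T s) \<subseteq> sets (shifted f)"
      using st T_pos unfolding sets_shifted by (intro sets_path_filtration_subset) auto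
    have "X \<in> borel_measurable (shifted f)"
      using Xm by (simp add: measurable_cong_sets[OF sets_shifted refl])
    from measurable_sets[OF this]
    show sub2: "sets (vimage_algebra (space (shifted f)) X borel) \<subseteq> sets (shifted f)"
      unfolding sets_vimage_algebra by (intro sets.sigma_sets_subset) auto
    fix A B assume A: "A \<in> sets (path_filtration T s)" and B: "B \<in> sets (vimage_algebra (space (shifted f)) X borel)"
    have "B \<in> {X -` E \<inter> space (shifted f) |E. E \<in> sets borel}"
      using B sets_vimage_algebra2[of X "space (shifted f)" borel] by auto
    then obtain E where E: "E \<in> sets borel" "B = X -` E \<inter> C0 T"
      by (auto simp: sp)
    define A' where "A' = shift T f -` A \<inter> C0 T"
    define B' where "B' = (\<lambda>w. w t - w s) -` E \<inter> C0 T"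
    have A': "A' \<in> sets (path_filtration T s)"
      unfolding A'_def using measurable_sets[OF measurable_shift[OF T_pos f, of s] A] st by simp
    have B': "B' \<in> sets (vimage_algebra (space \<mu>0) (\<lambda>w. w t - w s) borel)"
      unfolding B'_def space_wiener[symmetric] by (rule in_vimage_algebra[OF E(1)])
    have BB: "shift T f -` B \<inter> C0 T = B'"
      using shift_in_C0[OF T_pos f] by (auto simp: B'_def E(2) comp)
    have AB: "A \<in> sets (C0_borel T)" "B \<in> sets (C0_borel T)"
      using A B sub sub2 unfolding sets_shifted by auto
    have m: "S.prob D = prob (shift T f -` D \<inter> C0 T)" if "D \<in> sets (C0_borel T)" for D
      unfolding shifted_def using measure_distr[OF measurable_shift_wiener that] by (simp add: space_wiener)
    have "S.prob (A \<inter> B) = prob (A' \<inter> B')"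
    proof -
      have "shift T f -` (A \<inter> B) \<inter> C0 T = A' \<inter> B'"
        unfolding BB[symmetric] A'_def by auto
      then show ?thesis using m[OF sets.Int[OF AB]] by simp
    qed
    also have "\<dots> = prob A' * prob B'"
      using bm(2) A' B' unfolding indep_sets2_eq by blast
    also have "\<dots> = S.prob A * S.prob B"
      using m[OF AB(1)] m[OF AB(2)] by (simp add: BB A'_def)
    finally show "S.prob (A \<inter> B) = S.prob A * S.prob B" .
  qed
  then show "S.indep_set (sets (path_filtration T s))
      (sets (vimage_algebra (space (shifted f)) (\<lambda>w. w t - f t - (w s - f s)) borel))"
    by (simp add: X_def)
qed

end

lemma has_bochner_integral_exp_increments:
  assumes "0 < N"
  shows "has_bochner_integral \<mu>0 (\<lambda>w. exp (\<Sum>i<N. c i * incr T N w i)) (exp ((\<Sum>i<N. (c i)\<^sup>2 * (T / N)) / 2))"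
proof (rule has_bochner_integral_nn_integral)
  define v where "v = (\<Sum>i<N. (c i)\<^sup>2 * (T / N)) / 2"
  have "(\<lambda>w. \<Sum>i<N. c i * incr T N w i) \<in> borel_measurable \<mu>0"
    by (intro borel_measurable_sum borel_measurable_times measurable_wiener[OF measurable_incr[OF T_pos]]) auto
  then show m: "(\<lambda>w. exp (\<Sum>i<N. c i * incr T N w i)) \<in> borel_measurable \<mu>0"
    by (rule measurable_compose[OF _ borel_measurable_exp])
  have "(\<integral>\<^sup>+w. ennreal (exp (\<Sum>i<N. c i * incr T N w i)) \<partial>\<mu>0) =
    (\<integral>\<^sup>+w. ennreal (exp v) * ennreal (exp ((\<Sum>i<N. c i * (incr T N w i - incr T N (\<lambda>_. 0) i)) - v)) \<partial>\<mu>0)"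
    by (intro nn_integral_cong) (simp add: incr_def ennreal_mult[symmetric] exp_add[symmetric])
  also have "\<dots> = ennreal (exp v) * (\<integral>\<^sup>+w. ennreal (exp ((\<Sum>i<N. c i * (incr T N w i - incr T N (\<lambda>_. 0) i)) - v)) \<partial>\<mu>0)"
    using m by (intro nn_integral_cmult) (simp add: incr_def exp_diff)
  also have "\<dots> = ennreal (exp v)"
    using nn_integral_exp_increments[OF T_pos assms prob_space_wiener sets_wiener, of "\<lambda>_. 0" c] brownian_wiener
    unfolding v_def by simp
  finally show "(\<integral>\<^sup>+w. ennreal (exp (\<Sum>i<N. c i * incr T N w i)) \<partial>\<mu>0) = ennreal (exp ((\<Sum>i<N. (c i)\<^sup>2 * (T / N)) / 2))"
    by (simp add: v_def)
qed auto

lemma has_bochner_integral_cm_density: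
  assumes "0 < N"
  shows "has_bochner_integral \<mu>0 (cm_density T N f) 1"
proof -
  have "has_bochner_integral \<mu>0 (\<lambda>w. exp (- energy T N f / 2) * exp (\<Sum>i<N. slope T N f i * incr T N w i))
    (exp (- energy T N f / 2) * exp ((\<Sum>i<N. (slope T N f i)\<^sup>2 * (T / N)) / 2))"
    by (intro has_bochner_integral_mult_right has_bochner_integral_exp_increments[OF assms])
  then show ?thesis
    unfolding energy_def[symmetric] wiener_sum_def[symmetric] exp_add[symmetric]
    by (simp add: cm_density_def[abs_def])
qed

text \<open>On the finer of the two grids both Wiener sums are linear in the increments. If \<open>E\<close> and \<open>F\<close> are the
energies of the coarse and the fine level, the squared norm of the sum of the coefficients is
\<open>E + 2 * E + F\<close> by orthogonality, and the normalisations take away \<open>E + F\<close>. Hence the densities are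
a martingale bounded in \<open>L\<^sup>2\<close> as soon as the energies are bounded.\<close>

lemma has_bochner_integral_cm_density_mult:
  assumes "n \<le> m"
  shows "has_bochner_integral \<mu>0 (\<lambda>w. cm_density T (2 ^ n) f w * cm_density T (2 ^ m) f w) (exp (energy T (2 ^ n) f))"
proof -
  define K :: nat where "K = 2 ^ (m - n)"
  define N :: nat where "N = 2 ^ n"
  have K: "0 < K" "0 < N" "(2::nat) ^ m = N * K"
    using assms by (auto simp: K_def N_def power_add[symmetric])
  define b where "b i = slope T N f (i div K) + slope T (N * K) f i" for i
  define E where "E = energy T N f"
  define F where "F = energy T (N * K) f"
  have sq: "(\<Sum>i<N * K. (b i)\<^sup>2 * (T / real (N * K))) = 3 * E + F"
  proof -
    have "(\<Sum>i<N * K. (b i)\<^sup>2 * (T / real (N * K))) =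
      (\<Sum>i<N * K. (slope T N f (i div K))\<^sup>2 * (T / real (N * K))) + (\<Sum>i<N * K. (slope T (N * K) f i)\<^sup>2 * (T / real (N * K))) +
      2 * (\<Sum>i<N * K. slope T N f (i div K) * slope T (N * K) f i * (T / real (N * K)))"
      unfolding sum_distrib_left sum.distrib[symmetric]
      by (rule sum.cong) (simp_all only: b_def power2_sum distrib_right mult.assoc)
    also have "\<dots> = E + F + 2 * E"
      unfolding slope_inner[OF T_pos K(2,1)] by (simp add: E_def F_def energy_def)
    finally show ?thesis by simp
  qed
  have eq: "cm_density T N f w * cm_density T (N * K) f w =
      exp (- (E + F) / 2) * exp (\<Sum>i<N * K. b i * incr T (N * K) w i)" for w
  proof -
    have "(\<Sum>i<N * K. b i * incr T (N * K) w i) = wiener_sum T N f w + wiener_sum T (N * K) f w"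
      unfolding wiener_sum_def sum_blocks[OF K(1), of "slope T N f" T N w, symmetric]
      by (simp only: b_def distrib_right sum.distrib)
    then show ?thesis
      unfolding cm_density_def E_def[symmetric] F_def[symmetric] exp_add[symmetric]
      by (intro arg_cong[where f = exp]) argo
  qed
  have "has_bochner_integral \<mu>0 (\<lambda>w. exp (- (E + F) / 2) * exp (\<Sum>i<N * K. b i * incr T (N * K) w i))
      (exp (- (E + F) / 2) * exp ((\<Sum>i<N * K. (b i)\<^sup>2 * (T / real (N * K))) / 2))"
    using K by (intro has_bochner_integral_mult_right has_bochner_integral_exp_increments) auto
  also have "exp (- (E + F) / 2) * exp ((\<Sum>i<N * K. (b i)\<^sup>2 * (T / real (N * K))) / 2) = exp E"
    unfolding sq exp_add[symmetric] by (intro arg_cong[where f = exp]) argo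
  finally show ?thesis
    unfolding eq[symmetric] K(3) N_def[symmetric] by (simp only: E_def)
qed

text \<open>The density is a product over the cells, and each factor moves the mean of one increment from \<open>0\<close> to
the increment of \<open>f\<close>. So at the level of the grid the density already produces the law of the shifted
path.\<close>

lemma emeasure_increments_cm_density:
  assumes "0 < N" and A: "\<And>i. A i \<in> sets borel"
  shows "emeasure (density \<mu>0 (\<lambda>w. ennreal (cm_density T N f w))) {w\<in>C0 T. \<forall>i<N. incr T N w i \<in> A i} =
    (\<Prod>i<N. \<integral>\<^sup>+x. ennreal (normal_density 0 (sqrt (T / N)) x) * indicator (A i) (x + incr T N f i) \<partial>lborel)"
proof -
  define c where "c = slope T N f"
  define \<phi> :: "nat \<Rightarrow> real \<Rightarrow> ennreal" where
    "\<phi> i x = ennreal (exp (c i * x - (c i)\<^sup>2 * (T / N) / 2)) * indicator (A i) x" for i x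
  have sqrt: "0 < sqrt (T / N)" "(sqrt (T / N))\<^sup>2 = T / N"
    using assms T_pos by auto
  have \<phi>: "\<phi> i \<in> borel_measurable borel" for i
    using A unfolding \<phi>_def by measurable
  define S where "S = {w\<in>C0 T. \<forall>i<N. incr T N w i \<in> A i}"
  have S: "S \<in> sets \<mu>0"
    unfolding sets_wiener S_def by (rule sets_increments[OF T_pos A])
  have "emeasure (density \<mu>0 (\<lambda>w. ennreal (cm_density T N f w))) S =
    (\<integral>\<^sup>+w. ennreal (cm_density T N f w) * indicator S w \<partial>\<mu>0)"
    using S measurable_wiener[OF measurable_cm_density[OF T_pos]] by (intro emeasure_density) auto
  also have "\<dots> = (\<integral>\<^sup>+w. (\<Prod>i<N. \<phi> i (w (grid T N (Suc i)) - 0 - (w (grid T N i) - 0))) \<partial>\<mu>0)"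
  proof (intro nn_integral_cong)
    fix w assume w: "w \<in> space \<mu>0"
    have "cm_density T N f w = (\<Prod>i<N. exp (c i * incr T N w i - (c i)\<^sup>2 * (T / N) / 2))"
      unfolding cm_density_def wiener_sum_def energy_def c_def
      by (simp only: exp_sum[OF finite_lessThan, symmetric] sum_subtractf sum_divide_distrib)
    moreover have "(\<Prod>i<N. indicator (A i) (incr T N w i) :: ennreal) = indicator S w"
      using w unfolding prod_indicator_eq S_def space_wiener
      by (simp only: indicator_def mem_Collect_eq simp_thms of_bool_def)
    moreover have "w (grid T N (Suc i)) - 0 - (w (grid T N i) - 0) = incr T N w i" for i
      by (simp add: incr_def)
    ultimately show "ennreal (cm_density T N f w) * indicator S w =
        (\<Prod>i<N. \<phi> i (w (grid T N (Suc i)) - 0 - (w (grid T N i) - 0)))"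
      by (simp only: \<phi>_def prod_ennreal[OF exp_ge_zero] prod.distrib)
  qed
  also have "\<dots> = (\<Prod>i<N. \<integral>\<^sup>+x. ennreal (normal_density 0 (sqrt (T / N)) x) * \<phi> i x \<partial>lborel)"
    by (rule nn_integral_brownian_increments[OF T_pos prob_space_wiener sets_wiener brownian_wiener \<phi>]) simp
  also have "\<dots> = (\<Prod>i<N. \<integral>\<^sup>+x. ennreal (normal_density 0 (sqrt (T / N)) x) * indicator (A i) (x + incr T N f i) \<partial>lborel)"
  proof (rule prod.cong)
    fix i
    have "indicator (A i) \<in> (borel_measurable borel :: (real \<Rightarrow> ennreal) set)"
      using A by simp
    from nn_integral_gaussian_tilt[OF sqrt(1) this, of "c i"]
    show "(\<integral>\<^sup>+x. ennreal (normal_density 0 (sqrt (T / N)) x) * \<phi> i x \<partial>lborel) =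
      (\<integral>\<^sup>+x. ennreal (normal_density 0 (sqrt (T / N)) x) * indicator (A i) (x + incr T N f i) \<partial>lborel)"
      unfolding sqrt(2) \<phi>_def c_def slope_mult[OF T_pos assms(1)] .
  qed simp
  finally show ?thesis
    by (simp only: S_def)
qed

text \<open>The densities converge in \<open>L\<^sup>1\<close>, and almost surely along a subsequence. On a cylinder of a given level
the approximate measures agree with the law of the shifted path from that level on, so the limit
density is that of the law of the shifted path. The almost sure convergence is recorded because both
the characterisation of equality and the bound on the entropy pass to the limit by it.\<close>

theorem cameron_martin:
  assumes f: "continuous_on {0..T} f" "f 0 = 0" and bound: "\<And>n. energy T (2 ^ n) f \<le> C"
  obtains Z r where "Z \<in> borel_measurable \<mu>0" "\<And>w. 0 \<le> Z w" "strict_mono r"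
    "AE w in \<mu>0. (\<lambda>k. cm_density T (2 ^ r k) f w) \<longlonglongrightarrow> Z w"
    "density \<mu>0 (\<lambda>w. ennreal (Z w)) = shifted f"
proof -
  define X where "X n = cm_density T (2 ^ n) f" for n
  have Xm: "X n \<in> borel_measurable \<mu>0" for n
    unfolding X_def by (rule measurable_wiener[OF measurable_cm_density[OF T_pos]])
  have inner: "(\<integral>w. X n w * X m w \<partial>\<mu>0) = exp (energy T (2 ^ n) f)" if "n \<le> m" for n m
    unfolding X_def by (rule has_bochner_integral_integral_eq[OF has_bochner_integral_cm_density_mult[OF that]])
  have sq: "integrable \<mu>0 (\<lambda>w. (X n w)\<^sup>2)" for n
    using has_bochner_integral_cm_density_mult[OF order_refl, of n f]
    by (auto simp: X_def power2_eq_square has_bochner_integral_iff)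
  have X1: "has_bochner_integral \<mu>0 (X n) 1" for n
    unfolding X_def by (rule has_bochner_integral_cm_density) simp
  have bound': "exp (energy T (2 ^ n) f) \<le> exp C" for n
    using bound by simp
  obtain Y r where Y: "Y \<in> borel_measurable \<mu>0" "strict_mono r"
    "AE w in \<mu>0. (\<lambda>k. X (r k) w) \<longlonglongrightarrow> Y w"
    "integrable \<mu>0 (\<lambda>w. (Y w)\<^sup>2)" "(\<integral>w. (Y w)\<^sup>2 \<partial>\<mu>0) \<le> exp C"
    "(\<lambda>k. \<integral>w. \<bar>X (r k) w - Y w\<bar> \<partial>\<mu>0) \<longlonglongrightarrow> 0"
    by (rule L2_bounded_martingale_converges[OF finite_measure_axioms Xm sq inner bound']) (assumption | rule that)+
  have Y1: "integrable \<mu>0 Y"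
    by (rule square_integrable_imp_integrable[OF Y(1,4)])
  \<comment> \<open>The limit is nonnegative almost surely; the absolute value makes it so everywhere.\<close>
  define Z where "Z w = \<bar>Y w\<bar>" for w
  have Zm: "Z \<in> borel_measurable \<mu>0"
    unfolding Z_def using Y(1) by measurable
  have lim: "AE w in \<mu>0. (\<lambda>k. X (r k) w) \<longlonglongrightarrow> Z w"
    using Y(3)
  proof eventually_elim
    case (elim w)
    from tendsto_rabs[OF this] show ?case
      by (simp add: Z_def X_def cm_density_def)
  qed
  have ZY: "AE w in \<mu>0. Z w = Y w"
    using lim Y(3) by eventually_elim (rule LIMSEQ_unique)
  have setlim: "(\<lambda>k. emeasure (density \<mu>0 (\<lambda>w. ennreal (X (r k) w))) S) \<longlonglongrightarrow> emeasure (density \<mu>0 (\<lambda>w. ennreal (Z w))) S"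
    if S: "S \<in> sets \<mu>0" for S
  proof -
    have ind: "integrable \<mu>0 (\<lambda>w. indicator S w * u w)" if "integrable \<mu>0 u" for u :: "_ \<Rightarrow> real"
      using integrable_real_mult_indicator[OF S that] by (simp add: mult.commute)
    have em: "emeasure (density \<mu>0 (\<lambda>w. ennreal (u w))) S = ennreal (\<integral>w. indicator S w * u w \<partial>\<mu>0)"
      if u: "integrable \<mu>0 u" "\<And>w. 0 \<le> u w" for u
    proof -
      have "emeasure (density \<mu>0 (\<lambda>w. ennreal (u w))) S = (\<integral>\<^sup>+w. ennreal (u w) * indicator S w \<partial>\<mu>0)"
        using u S by (intro emeasure_density) auto
      also have "\<dots> = (\<integral>\<^sup>+w. ennreal (indicator S w * u w) \<partial>\<mu>0)"
        by (intro nn_integral_cong) (auto simp: indicator_def)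
      also have "\<dots> = ennreal (\<integral>w. indicator S w * u w \<partial>\<mu>0)"
        using u by (intro nn_integral_eq_integral ind) auto
      finally show ?thesis .
    qed
    have Xi: "integrable \<mu>0 (X n)" for n
      using X1 by (auto simp: has_bochner_integral_iff)
    have "(\<lambda>k. (\<integral>w. indicator S w * X (r k) w \<partial>\<mu>0) - (\<integral>w. indicator S w * Y w \<partial>\<mu>0)) \<longlonglongrightarrow> 0"
    proof (rule Lim_null_comparison[OF always_eventually[OF allI] Y(6)])
      fix k
      have "(\<integral>w. indicator S w * X (r k) w \<partial>\<mu>0) - (\<integral>w. indicator S w * Y w \<partial>\<mu>0) =
        (\<integral>w. indicator S w * X (r k) w - indicator S w * Y w \<partial>\<mu>0)"
        by (rule Bochner_Integration.integral_diff[symmetric]) (intro ind Xi Y1)+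
      also have "\<bar>\<dots>\<bar> \<le> (\<integral>w. \<bar>indicator S w * X (r k) w - indicator S w * Y w\<bar> \<partial>\<mu>0)"
        by (rule integral_abs_bound)
      also have "\<dots> \<le> (\<integral>w. \<bar>X (r k) w - Y w\<bar> \<partial>\<mu>0)"
        by (intro integral_mono Bochner_Integration.integrable_abs Bochner_Integration.integrable_diff ind Xi Y1)
          (auto simp: indicator_def)
      finally show "norm ((\<integral>w. indicator S w * X (r k) w \<partial>\<mu>0) - (\<integral>w. indicator S w * Y w \<partial>\<mu>0)) \<le> (\<integral>w. \<bar>X (r k) w - Y w\<bar> \<partial>\<mu>0)"
        by simp
    qed
    then have "(\<lambda>k. \<integral>w. indicator S w * X (r k) w \<partial>\<mu>0) \<longlonglongrightarrow> (\<integral>w. indicator S w * Y w \<partial>\<mu>0)"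
      by (rule LIM_zero_cancel)
    also have "(\<integral>w. indicator S w * Y w \<partial>\<mu>0) = (\<integral>w. indicator S w * Z w \<partial>\<mu>0)"
      using ZY Zm Y(1) S by (intro integral_cong_AE) auto
    finally have "(\<lambda>k. ennreal (\<integral>w. indicator S w * X (r k) w \<partial>\<mu>0)) \<longlonglongrightarrow> ennreal (\<integral>w. indicator S w * Z w \<partial>\<mu>0)"
      by (rule tendsto_ennrealI)
    moreover have "integrable \<mu>0 Z" "\<And>w. 0 \<le> Z w"
      using Y1 unfolding Z_def by simp_all
    moreover have "0 \<le> X n w" for n w
      by (simp add: X_def cm_density_def)
    ultimately show ?thesis
      by (simp only: em Xi)
  qed
  have "density \<mu>0 (\<lambda>w. ennreal (Z w)) = shifted f"
  proof (rule measure_eqI_cylinders[OF T_pos, symmetric])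
    interpret S: prob_space "shifted f" by (rule prob_space_shifted[OF f])
    show "finite_measure (shifted f)"
      by (rule S.finite_measure_axioms)
    show "sets (shifted f) = sets (C0_borel T)" "sets (density \<mu>0 (\<lambda>w. ennreal (Z w))) = sets (C0_borel T)"
      by (simp_all add: sets_shifted sets_wiener)
    fix n and A :: "nat \<Rightarrow> real set" assume A: "\<And>i. A i \<in> sets borel"
    have cyl: "cylinder T n A \<in> sets \<mu>0"
      unfolding sets_wiener using T_pos A
      by (intro sets_cylinder measurable_coordinate_C0_borel) auto
    have "emeasure (density \<mu>0 (\<lambda>w. ennreal (X (r k) w))) (cylinder T n A) = emeasure (shifted f) (cylinder T n A)"
      if "n \<le> k" for k
    proof -
      have "n \<le> r k"
        using that seq_suble[OF Y(2), of k] by simp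
      define B where "B i = (if 2 ^ (r k - n) dvd i then A (i div 2 ^ (r k - n)) else UNIV)" for i
      have B: "B i \<in> sets borel" for i
        using A by (simp add: B_def)
      have "emeasure (density \<mu>0 (\<lambda>w. ennreal (X (r k) w))) (cylinder T (r k) B) = emeasure (shifted f) (cylinder T (r k) B)"
      proof (rule emeasure_cylinder_eqI[OF T_pos _ _ prob_space_shifted[OF f] sets_shifted _ B])
        show "prob_space (density \<mu>0 (\<lambda>w. ennreal (X (r k) w)))"
        proof
          have "(\<integral>\<^sup>+w. ennreal (X (r k) w) \<partial>\<mu>0) = 1"
            using X1[of "r k"] cm_density_pos[THEN less_imp_le, of T "2 ^ r k" f]
            by (subst nn_integral_eq_integral) (auto simp: has_bochner_integral_iff X_def)
          then show "emeasure (density \<mu>0 (\<lambda>w. ennreal (X (r k) w))) (space (density \<mu>0 (\<lambda>w. ennreal (X (r k) w)))) = 1"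
            using Xm by (simp add: emeasure_density)
        qed
        show "sets (density \<mu>0 (\<lambda>w. ennreal (X (r k) w))) = sets (C0_borel T)"
          by (simp add: sets_wiener)
        fix A' :: "nat \<Rightarrow> real set" assume A': "\<And>i. A' i \<in> sets borel"
        show "emeasure (density \<mu>0 (\<lambda>w. ennreal (X (r k) w))) {w\<in>C0 T. \<forall>i<2 ^ r k. incr T (2 ^ r k) w i \<in> A' i} =
          emeasure (shifted f) {w\<in>C0 T. \<forall>i<2 ^ r k. incr T (2 ^ r k) w i \<in> A' i}"
          unfolding X_def
          using emeasure_increments_cm_density[of "2 ^ r k" A' f] A'
            emeasure_increments_drifted[OF T_pos prob_space_shifted[OF f] sets_shifted brownian_motion_shifted[OF f] A', of "2 ^ r k"]
          by simp
      qed
      then show ?thesis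
        unfolding cylinder_refine[OF \<open>n \<le> r k\<close>, of T A] B_def .
    qed
    then have "(\<lambda>k. emeasure (density \<mu>0 (\<lambda>w. ennreal (X (r k) w))) (cylinder T n A)) \<longlonglongrightarrow> emeasure (shifted f) (cylinder T n A)"
      by (intro tendsto_eventually) (auto simp: eventually_sequentially)
    with setlim[OF cyl] show "emeasure (shifted f) (cylinder T n A) = emeasure (density \<mu>0 (\<lambda>w. ennreal (Z w))) (cylinder T n A)"
      by (rule LIMSEQ_unique[rotated])
  qed
  with Zm Y(2) lim show thesis
    by (intro that[of Z r]) (auto simp: X_def Z_def)
qed

end

section \<open>Relative entropy and the mean path\<close>

text \<open>The expression is the gap in the Fenchel-Young inequality for \<open>exp\<close> and its convex conjugate
\<open>d * ln d - d\<close>. If \<open>d\<close> and \<open>exp x\<close> are the values of two probability densities, its mean is the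
relative entropy of the first with respect to the second.\<close>

lemma gibbs_gap_nonneg:
  fixes d x :: real
  assumes "0 \<le> d"
  shows "0 \<le> d * ln d - d - d * x + exp x"
proof (cases "d = 0")
  case False
  with assms have d: "0 < d" by simp
  have "d * (1 + (x - ln d)) \<le> d * exp (x - ln d)"
    using d by (intro mult_left_mono exp_ge_add_one_self) auto
  also have "\<dots> = exp x"
    using d by (simp add: exp_diff)
  finally show ?thesis
    by (simp add: algebra_simps)
qed simp

text \<open>By strict convexity the gap vanishes only at \<open>z = d\<close>. The limit \<open>z = 0\<close>, where the logarithm is
not continuous, has to be ruled out first: there \<open>- d * ln (zk k)\<close> would make the gap diverge.\<close>

lemma gibbs_gap_tendsto_0:
  fixes d z :: real
  assumes d: "0 < d" and zk: "\<And>k. 0 < zk k" "zk \<longlonglongrightarrow> z"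
    and gap: "(\<lambda>k. d * ln d - d - d * ln (zk k) + zk k) \<longlonglongrightarrow> 0"
  shows "z = d"
proof -
  define L where "L = (d * ln d - d - 1) / d"
  have "\<forall>\<^sub>F k in sequentially. d * ln d - d - d * ln (zk k) + zk k < 1"
    using gap by (rule order_tendstoD) simp
  then have "\<forall>\<^sub>F k in sequentially. exp L \<le> zk k"
  proof eventually_elim
    case (elim k)
    then have "L * d < ln (zk k) * d"
    proof -
      have "L * d = d * ln d - d - 1"
        using d by (simp add: L_def)
      then show ?thesis
        using elim zk(1)[of k] by (simp add: mult.commute)
    qed
    then have "L < ln (zk k)"
      using d by simp
    then have "exp L < exp (ln (zk k))"
      by simp
    then show ?case
      using zk(1)[of k] by simp
  qed
  then have "exp L \<le> z"
    by (rule tendsto_lowerbound[OF zk(2)]) simp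
  then have z: "0 < z"
    using exp_gt_zero[of L] by linarith
  have "(\<lambda>k. d * ln d - d - d * ln (zk k) + zk k) \<longlonglongrightarrow> d * ln d - d - d * ln z + z"
    using z by (intro tendsto_intros zk(2)) auto
  then have "d * ln d - d - d * ln z + z = 0"
    using gap by (rule LIMSEQ_unique)
  then have "d * ln (z / d) = d * (z / d - 1)"
    using d z by (simp add: ln_div algebra_simps)
  then have "ln (z / d) = z / d - 1"
    using d by simp
  then have "z / d = 1"
    using d z by (intro ln_eq_minus_one) auto
  then show ?thesis
    using d by simp
qed

lemma energy_refine_le:
  assumes "0 < T" "0 < N" "0 < K"
  shows "energy T N f \<le> energy T (N * K) f"
proof -
  have "0 \<le> (\<Sum>i<N * K. (slope T (N * K) f i - slope T N f (i div K))\<^sup>2 * (T / real (N * K)))"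
    using assms by (intro sum_nonneg mult_nonneg_nonneg) auto
  also have "\<dots> = (\<Sum>i<N * K. (slope T (N * K) f i)\<^sup>2 * (T / real (N * K))) +
      (\<Sum>i<N * K. (slope T N f (i div K))\<^sup>2 * (T / real (N * K))) -
      2 * (\<Sum>i<N * K. slope T N f (i div K) * slope T (N * K) f i * (T / real (N * K)))"
    unfolding sum_distrib_left sum.distrib[symmetric] sum_subtractf[symmetric]
    by (rule sum.cong) (simp_all add: power2_diff algebra_simps diff_divide_distrib add_divide_distrib)
  also have "\<dots> = energy T (N * K) f - energy T N f"
    unfolding slope_inner[OF assms] by (simp add: energy_def)
  finally show ?thesis by simp
qed

lemma incseq_energy: "0 < T \<Longrightarrow> incseq (\<lambda>n. energy T (2 ^ n) f)"
  unfolding incseq_Suc_iff using energy_refine_le[of T "2 ^ n" 2 f for n] by (simp add: mult.commute)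

lemma (in wiener_space) measurable_coordinate_wiener: "t \<in> {0..T} \<Longrightarrow> (\<lambda>w. w t) \<in> borel_measurable \<mu>0"
  using T_pos by (intro measurable_wiener measurable_coordinate_C0_borel) auto

lemma (in wiener_space) has_bochner_integral_exp_increment:
  assumes "0 \<le> s" "s < t" "t \<le> T"
  shows "has_bochner_integral \<mu>0 (\<lambda>w. exp (c * (w t - w s))) (exp (c\<^sup>2 * (t - s) / 2))"
proof (rule has_bochner_integral_nn_integral)
  have d: "distributed \<mu>0 lborel (\<lambda>w. w t - w s) (normal_density 0 (sqrt (t - s)))"
    using wiener assms by (auto simp: wiener_measure_def brownian_motion_def)
  have sqrt: "0 < sqrt (t - s)" "(sqrt (t - s))\<^sup>2 = t - s"
    using assms by auto
  define v where "v = c\<^sup>2 * (t - s) / 2"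
  show "(\<lambda>w. exp (c * (w t - w s))) \<in> borel_measurable \<mu>0"
    using assms by (intro measurable_compose[OF _ borel_measurable_exp] borel_measurable_times
        borel_measurable_diff measurable_coordinate_wiener) auto
  have "(\<integral>\<^sup>+w. ennreal (exp (c * (w t - w s))) \<partial>\<mu>0) =
      (\<integral>\<^sup>+x. ennreal (normal_density 0 (sqrt (t - s)) x) * ennreal (exp (c * x)) \<partial>lborel)"
    by (rule distributed_nn_integral[OF d, symmetric]) simp
  also have "\<dots> = (\<integral>\<^sup>+x. ennreal (exp v) * (ennreal (normal_density 0 (sqrt (t - s)) x) * (ennreal (exp (c * x - v)) * 1)) \<partial>lborel)"
    by (intro nn_integral_cong) (simp add: ennreal_mult[symmetric] exp_diff)
  also have "\<dots> = ennreal (exp v) * (\<integral>\<^sup>+x. ennreal (normal_density 0 (sqrt (t - s)) x) * (ennreal (exp (c * x - v)) * 1) \<partial>lborel)"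
    by (rule nn_integral_cmult) simp
  also have "\<dots> = ennreal (exp v)"
    using nn_integral_gaussian_tilt[OF sqrt(1), of "\<lambda>_. 1" c] nn_integral_normal_density[OF sqrt(1), of 0]
    unfolding sqrt(2) v_def by simp
  finally show "(\<integral>\<^sup>+w. ennreal (exp (c * (w t - w s))) \<partial>\<mu>0) = ennreal (exp (c\<^sup>2 * (t - s) / 2))"
    by (simp add: v_def)
qed auto

text \<open>The function \<open>D\<close> is a finite version of the density of \<open>\<mu>\<close> with respect to Wiener measure.\<close>

locale wiener_density = wiener_space +
  fixes \<mu> :: "(real \<Rightarrow> real) measure" and D :: "(real \<Rightarrow> real) \<Rightarrow> real"
  assumes prob_tilted: "prob_space \<mu>"
    and D_meas [measurable]: "D \<in> borel_measurable \<mu>0" and D_nonneg: "\<And>w. 0 \<le> D w"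
    and density_D: "density \<mu>0 (\<lambda>w. ennreal (D w)) = \<mu>"
begin

sublocale tilted: prob_space \<mu>
  by (rule prob_tilted)

lemma sets_tilted: "sets \<mu> = sets (C0_borel T)"
  unfolding density_D[symmetric] by (simp add: sets_wiener)

lemma space_tilted: "space \<mu> = C0 T"
  using sets_eq_imp_space_eq[OF sets_tilted] by simp

lemma has_bochner_integral_D: "has_bochner_integral \<mu>0 D 1"
proof (rule has_bochner_integral_nn_integral)
  have "(\<integral>\<^sup>+w. ennreal (D w) \<partial>\<mu>0) = (\<integral>\<^sup>+w. ennreal (D w) * indicator (space \<mu>0) w \<partial>\<mu>0)"
    by (intro nn_integral_cong) simp
  also have "\<dots> = emeasure (density \<mu>0 (\<lambda>w. ennreal (D w))) (space \<mu>0)"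
    by (intro emeasure_density[symmetric]) auto
  also have "\<dots> = 1"
    unfolding density_D space_wiener space_tilted[symmetric] by (rule tilted.emeasure_space_1)
  finally show "(\<integral>\<^sup>+w. ennreal (D w) \<partial>\<mu>0) = ennreal 1"
    by simp
qed (auto simp: D_nonneg)

lemma integrable_tilted: "f \<in> borel_measurable \<mu>0 \<Longrightarrow> integrable \<mu> f \<longleftrightarrow> integrable \<mu>0 (\<lambda>w. D w * f w)"
  for f :: "_ \<Rightarrow> real"
  unfolding density_D[symmetric] by (subst integrable_density) (auto simp: D_nonneg)

lemma integral_tilted: "f \<in> borel_measurable \<mu>0 \<Longrightarrow> (\<integral>w. f w \<partial>\<mu>) = (\<integral>w. D w * f w \<partial>\<mu>0)"
  for f :: "_ \<Rightarrow> real"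
  unfolding density_D[symmetric] by (subst integral_density) (auto simp: D_nonneg)

text \<open>This is the relative entropy of \<open>\<mu>\<close> only if the integrand is integrable; otherwise the Bochner
integral is \<open>0\<close>, whereas the relative entropy is infinite.\<close>

definition rel_entropy :: real where
  "rel_entropy = (\<integral>w. D w * ln (D w) \<partial>\<mu>0)"

lemma D_KL_eq:
  "D_KL \<mu> \<mu>0 = (if integrable \<mu>0 (\<lambda>w. D w * ln (D w)) then ereal rel_entropy else \<infinity>)"
proof -
  have ac: "AE w in \<mu>0. RN_deriv \<mu>0 \<mu> w = ennreal (D w)"
    using RN_deriv_unique[OF _ density_D] by (auto elim: eventually_mono)
  have ed: "entropy_density (exp 1) \<mu>0 \<mu> \<in> borel_measurable \<mu>0"
    by simp
  have ae: "AE w in \<mu>0. D w * entropy_density (exp 1) \<mu>0 \<mu> w = D w * ln (D w)"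
    using ac by eventually_elim (simp add: entropy_density_def log_def D_nonneg)
  have "integrable \<mu> (entropy_density (exp 1) \<mu>0 \<mu>) \<longleftrightarrow> integrable \<mu>0 (\<lambda>w. D w * ln (D w))"
    unfolding integrable_tilted[OF ed] by (rule integrable_cong_AE[OF _ _ ae]) auto
  moreover have "KL_divergence (exp 1) \<mu>0 \<mu> = (\<integral>w. D w * ln (D w) \<partial>\<mu>0)"
    unfolding KL_divergence_def integral_tilted[OF ed] by (rule integral_cong_AE[OF _ _ ae]) auto
  ultimately show ?thesis
    by (simp add: D_KL_def rel_entropy_def)
qed

context
  assumes finite_entropy: "integrable \<mu>0 (\<lambda>w. D w * ln (D w))"
begin

text \<open>The Fenchel-Young inequality for \<open>D w\<close> and \<open>\<bar>X w\<bar>\<close> bounds their product by an integrable function.\<close>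

lemma integrable_exponential_moment:
  fixes X :: "(real \<Rightarrow> real) \<Rightarrow> real"
  assumes [measurable]: "X \<in> borel_measurable \<mu>0"
    and "integrable \<mu>0 (\<lambda>w. exp (X w))" "integrable \<mu>0 (\<lambda>w. exp (- X w))"
  shows "integrable \<mu> X"
proof -
  have "integrable \<mu>0 (\<lambda>w. D w * ln (D w) - D w + (exp (X w) + exp (- X w)))"
    using assms finite_entropy has_bochner_integral_D by (auto simp: has_bochner_integral_iff)
  then have "integrable \<mu>0 (\<lambda>w. D w * X w)"
  proof (rule Bochner_Integration.integrable_bound)
    show "AE w in \<mu>0. norm (D w * X w) \<le> norm (D w * ln (D w) - D w + (exp (X w) + exp (- X w)))"
    proof (rule AE_I2)
      fix w
      have "exp \<bar>X w\<bar> \<le> exp (X w) + exp (- X w)"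
        by (simp add: abs_if add_increasing add_increasing2)
      then have "D w * \<bar>X w\<bar> \<le> D w * ln (D w) - D w + (exp (X w) + exp (- X w))"
        using gibbs_gap_nonneg[OF D_nonneg, of w "\<bar>X w\<bar>"] by linarith
      then show "norm (D w * X w) \<le> norm (D w * ln (D w) - D w + (exp (X w) + exp (- X w)))"
        by (simp add: abs_mult D_nonneg)
    qed
  qed measurable
  then show ?thesis
    by (simp add: integrable_tilted)
qed

lemma has_bochner_integral_gibbs_gap:
  fixes X :: "(real \<Rightarrow> real) \<Rightarrow> real"
  assumes X: "integrable \<mu> X" "X \<in> borel_measurable \<mu>0"
    and e: "has_bochner_integral \<mu>0 (\<lambda>w. exp (X w)) 1"
  shows "has_bochner_integral \<mu>0 (\<lambda>w. D w * ln (D w) - D w - D w * X w + exp (X w)) (rel_entropy - (\<integral>w. X w \<partial>\<mu>))"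
proof -
  have "has_bochner_integral \<mu>0 (\<lambda>w. D w * ln (D w) - D w - D w * X w + exp (X w))
      (rel_entropy - 1 - (\<integral>w. X w \<partial>\<mu>) + 1)"
    using X(1) finite_entropy
    by (intro has_bochner_integral_add has_bochner_integral_diff e has_bochner_integral_D)
      (auto simp: rel_entropy_def integrable_tilted[OF X(2)] integral_tilted[OF X(2)] has_bochner_integral_iff)
  then show ?thesis by simp
qed

text \<open>The variational inequality of Donsker and Varadhan, for functions normalised by \<open>\<integral> exp X d\<mu>0 = 1\<close>.\<close>

lemma expectation_le_entropy:
  fixes X :: "(real \<Rightarrow> real) \<Rightarrow> real"
  assumes "integrable \<mu> X" "X \<in> borel_measurable \<mu>0" "has_bochner_integral \<mu>0 (\<lambda>w. exp (X w)) 1"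
  shows "(\<integral>w. X w \<partial>\<mu>) \<le> rel_entropy"
proof -
  have "0 \<le> (\<integral>w. D w * ln (D w) - D w - D w * X w + exp (X w) \<partial>\<mu>0)"
    by (intro Bochner_Integration.integral_nonneg gibbs_gap_nonneg D_nonneg)
  then show ?thesis
    using has_bochner_integral_integral_eq[OF has_bochner_integral_gibbs_gap[OF assms]] by simp
qed

lemma integrable_increment:
  assumes "0 \<le> s" "s < t" "t \<le> T"
  shows "integrable \<mu> (\<lambda>w. w t - w s)"
proof (rule integrable_exponential_moment)
  show "(\<lambda>w. w t - w s) \<in> borel_measurable \<mu>0"
    using assms by (intro borel_measurable_diff measurable_coordinate_wiener) auto
  show "integrable \<mu>0 (\<lambda>w. exp (w t - w s))"
    using has_bochner_integral_exp_increment[OF assms, of 1] by (auto simp: has_bochner_integral_iff)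
  show "integrable \<mu>0 (\<lambda>w. exp (- (w t - w s)))"
    using has_bochner_integral_exp_increment[OF assms, of "- 1"] by (auto simp: has_bochner_integral_iff)
qed

lemma integrable_coordinate:
  assumes "t \<in> {0..T}"
  shows "integrable \<mu> (\<lambda>w. w t)"
proof (cases "t = 0")
  case True
  have "integrable \<mu> (\<lambda>w. w t) \<longleftrightarrow> integrable \<mu> (\<lambda>_. 0 :: real)"
    by (intro Bochner_Integration.integrable_cong refl) (use C0_at_0 True in \<open>simp add: space_tilted\<close>)
  then show ?thesis by simp
next
  case False
  then have "integrable \<mu> (\<lambda>w. w t - w 0)"
    using assms by (intro integrable_increment) auto
  moreover have "integrable \<mu> (\<lambda>w. w t - w 0) \<longleftrightarrow> integrable \<mu> (\<lambda>w. w t)"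
    by (intro Bochner_Integration.integrable_cong refl) (use C0_at_0 in \<open>simp add: space_tilted\<close>)
  ultimately show ?thesis by simp
qed

lemma mean_path_0: "mean_path \<mu> 0 = 0"
proof -
  have "mean_path \<mu> 0 = (\<integral>w. 0 \<partial>\<mu>)"
    unfolding mean_path_def by (intro Bochner_Integration.integral_cong refl) (use C0_at_0 in \<open>simp add: space_tilted\<close>)
  then show ?thesis by simp
qed

lemma mean_path_diff:
  assumes "s \<in> {0..T}" "t \<in> {0..T}"
  shows "(\<integral>w. w t - w s \<partial>\<mu>) = mean_path \<mu> t - mean_path \<mu> s"
  unfolding mean_path_def using assms by (intro Bochner_Integration.integral_diff integrable_coordinate)

lemma mean_path_modulus:
  assumes "0 \<le> s" "s < t" "t \<le> T"
  shows "(mean_path \<mu> t - mean_path \<mu> s)\<^sup>2 \<le> 2 * rel_entropy * (t - s)"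
proof -
  define \<Delta> where "\<Delta> = mean_path \<mu> t - mean_path \<mu> s"
  \<comment> \<open>This \<open>c\<close> maximises \<open>c * \<Delta> - c\<^sup>2 * (t - s) / 2\<close>, which is the mean of the normalised exponent
    \<open>c * (w t - w s) - v\<close>.\<close>
  define c where "c = \<Delta> / (t - s)"
  define v where "v = c\<^sup>2 * (t - s) / 2"
  have I: "integrable \<mu> (\<lambda>w. c * (w t - w s) - v)"
    using integrable_increment[OF assms] by simp
  have "has_bochner_integral \<mu>0 (\<lambda>w. exp (c * (w t - w s)) * exp (- v)) (exp v * exp (- v))"
    unfolding v_def by (intro has_bochner_integral_mult_left has_bochner_integral_exp_increment assms)
  then have "has_bochner_integral \<mu>0 (\<lambda>w. exp (c * (w t - w s) - v)) 1"
    by (simp add: exp_add[symmetric])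
  moreover have "(\<lambda>w. c * (w t - w s) - v) \<in> borel_measurable \<mu>0"
    using assms by (intro borel_measurable_diff borel_measurable_times measurable_coordinate_wiener) auto
  ultimately have "(\<integral>w. c * (w t - w s) - v \<partial>\<mu>) \<le> rel_entropy"
    by (intro expectation_le_entropy I)
  also have "(\<integral>w. c * (w t - w s) - v \<partial>\<mu>) = c * \<Delta> - v"
    using integrable_increment[OF assms] mean_path_diff[of s t] assms
    by (simp add: \<Delta>_def tilted.prob_space)
  finally have "c * \<Delta> - v \<le> rel_entropy" .
  have c: "c * (t - s) = \<Delta>"
    using assms by (simp add: c_def)
  then have "v = c * \<Delta> / 2"
    unfolding v_def power2_eq_square mult.assoc by simp
  with \<open>c * \<Delta> - v \<le> rel_entropy\<close> have "c * \<Delta> / 2 \<le> rel_entropy"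
    by linarith
  then have "c * \<Delta> / 2 * (t - s) \<le> rel_entropy * (t - s)"
    using assms by (intro mult_right_mono) auto
  also have "c * \<Delta> / 2 * (t - s) = c * (t - s) * \<Delta> / 2"
    by simp
  finally have "\<Delta>\<^sup>2 \<le> 2 * rel_entropy * (t - s)"
    unfolding c by (simp add: power2_eq_square)
  then show ?thesis
    by (simp add: \<Delta>_def)
qed

lemma rel_entropy_nonneg: "0 \<le> rel_entropy"
  using expectation_le_entropy[of "\<lambda>_. 0"] by (simp add: has_bochner_integral_iff prob_space)

lemma continuous_on_mean_path: "continuous_on {0..T} (mean_path \<mu>)"
  unfolding continuous_on_iff
proof (intro ballI allI impI)
  fix s e :: real assume s: "s \<in> {0..T}" and e: "0 < e"
  define d where "d = e\<^sup>2 / (2 * rel_entropy + 1)"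
  have d: "0 < d" "2 * rel_entropy * d < e\<^sup>2"
    using e rel_entropy_nonneg by (auto simp: d_def divide_simps)
  have "dist (mean_path \<mu> t) (mean_path \<mu> s) < e" if t: "t \<in> {0..T}" "dist t s < d" for t
  proof (cases "s = t")
    case False
    have "(mean_path \<mu> t - mean_path \<mu> s)\<^sup>2 \<le> 2 * rel_entropy * \<bar>t - s\<bar>"
      using mean_path_modulus[of s t] mean_path_modulus[of t s] s t(1) False
      by (cases "s < t") (auto simp: power2_commute)
    also have "\<dots> \<le> 2 * rel_entropy * d"
      using t(2) rel_entropy_nonneg by (intro mult_left_mono) (auto simp: dist_real_def)
    also have "\<dots> < e\<^sup>2"
      by (rule d(2))
    finally have "\<bar>mean_path \<mu> t - mean_path \<mu> s\<bar>\<^sup>2 < e\<^sup>2"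
      by simp
    then have "\<bar>mean_path \<mu> t - mean_path \<mu> s\<bar> < e"
      by (rule power2_less_imp_less) (use e in simp)
    then show ?thesis by (simp add: dist_real_def)
  qed (use e in simp)
  with d(1) show "\<exists>d>0. \<forall>x'\<in>{0..T}. dist x' s < d \<longrightarrow> dist (mean_path \<mu> x') (mean_path \<mu> s) < e"
    by blast
qed

text \<open>The integral is the relative entropy of \<open>\<mu>\<close> with respect to the approximate Cameron-Martin measure of
its own mean path. The mean of a Wiener sum under \<open>\<mu>\<close> is the Wiener sum of the mean path, and the
coefficients are chosen such that this is the energy; subtracting the normalisation leaves one half
of it.\<close>

lemma entropy_gap_cm_density:
  assumes "0 < N"
  shows "has_bochner_integral \<mu>0
    (\<lambda>w. D w * ln (D w) - D w - D w * ln (cm_density T N (mean_path \<mu>) w) + cm_density T N (mean_path \<mu>) w)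
    (rel_entropy - energy T N (mean_path \<mu>) / 2)"
proof -
  define m where "m = mean_path \<mu>"
  define X where "X w = wiener_sum T N m w - energy T N m / 2" for w
  have gr: "grid T N i \<in> {0..T}" if "i \<le> N" for i
    using T_pos that by (intro grid_mem) auto
  have inc: "integrable \<mu> (\<lambda>w. incr T N w i)" "(\<integral>w. incr T N w i \<partial>\<mu>) = incr T N m i" if "i < N" for i
  proof -
    show "integrable \<mu> (\<lambda>w. incr T N w i)"
      unfolding incr_def using that by (intro Bochner_Integration.integrable_diff integrable_coordinate gr) auto
    show "(\<integral>w. incr T N w i \<partial>\<mu>) = incr T N m i"
      unfolding incr_def m_def using that by (intro mean_path_diff gr) auto
  qed
  have I: "integrable \<mu> (wiener_sum T N m)"
    unfolding wiener_sum_def by (intro Bochner_Integration.integrable_sum integrable_mult_right inc) auto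
  have "(\<integral>w. wiener_sum T N m w \<partial>\<mu>) = (\<Sum>i<N. \<integral>w. slope T N m i * incr T N w i \<partial>\<mu>)"
    unfolding wiener_sum_def by (intro Bochner_Integration.integral_sum integrable_mult_right inc) auto
  also have "\<dots> = wiener_sum T N m m"
    unfolding wiener_sum_def by (intro sum.cong) (auto simp: inc)
  also have "\<dots> = energy T N m"
    by (rule wiener_sum_self[OF T_pos assms])
  finally have EX: "(\<integral>w. X w \<partial>\<mu>) = energy T N m / 2"
    unfolding X_def using I by (simp add: tilted.prob_space)
  have IX: "integrable \<mu> X"
    unfolding X_def using I by simp
  have mX: "X \<in> borel_measurable \<mu>0"
    unfolding X_def by (intro borel_measurable_diff measurable_wiener[OF measurable_wiener_sum[OF T_pos]]) auto
  have eX: "exp (X w) = cm_density T N m w" "X w = ln (cm_density T N m w)" for w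
    by (simp_all add: X_def cm_density_def)
  have "has_bochner_integral \<mu>0 (\<lambda>w. exp (X w)) 1"
    unfolding eX(1) by (rule has_bochner_integral_cm_density[OF assms])
  from has_bochner_integral_gibbs_gap[OF IX mX this] show ?thesis
    unfolding EX eX(1) unfolding eX(2) unfolding m_def .
qed

lemma energy_mean_path_le: "0 < N \<Longrightarrow> energy T N (mean_path \<mu>) \<le> 2 * rel_entropy"
proof -
  assume "0 < N"
  note gap = entropy_gap_cm_density[OF this]
  have "0 \<le> (\<integral>w. D w * ln (D w) - D w - D w * ln (cm_density T N (mean_path \<mu>) w) + cm_density T N (mean_path \<mu>) w \<partial>\<mu>0)"
    using gibbs_gap_nonneg[OF D_nonneg, of _ "ln (cm_density T N (mean_path \<mu>) _)"] cm_density_pos[of T N "mean_path \<mu>"]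
    by (intro Bochner_Integration.integral_nonneg) simp
  then show ?thesis
    using has_bochner_integral_integral_eq[OF gap] by simp
qed

text \<open>The hypothesis on the energies says that the gap between \<open>D\<close> and the approximate densities tends to
\<open>0\<close> in mean. Along a subsequence it does so almost surely, and then the approximate densities tend to
\<open>D\<close>. But they also tend to the density of the shifted measure.\<close>

lemma tilted_eq_shifted:
  assumes pos: "AE w in \<mu>0. 0 < D w"
    and lim: "(\<lambda>n. energy T (2 ^ n) (mean_path \<mu>)) \<longlonglongrightarrow> 2 * rel_entropy"
  shows "\<mu> = shifted (mean_path \<mu>)"
proof -
  define m where "m = mean_path \<mu>"
  have m: "continuous_on {0..T} m" "m 0 = 0"
    using continuous_on_mean_path mean_path_0 by (simp_all add: m_def)
  have bound: "energy T (2 ^ n) m \<le> 2 * rel_entropy" for n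
    unfolding m_def by (rule energy_mean_path_le) simp
  obtain Z r where Z: "Z \<in> borel_measurable \<mu>0" "\<And>w. 0 \<le> Z w" "strict_mono r"
    "AE w in \<mu>0. (\<lambda>k. cm_density T (2 ^ r k) m w) \<longlonglongrightarrow> Z w"
    "density \<mu>0 (\<lambda>w. ennreal (Z w)) = shifted m"
    by (rule cameron_martin[OF m bound]) (assumption | rule that)+
  define gap where "gap k w = D w * ln (D w) - D w - D w * ln (cm_density T (2 ^ r k) m w) + cm_density T (2 ^ r k) m w" for k w
  have gap: "has_bochner_integral \<mu>0 (gap k) (rel_entropy - energy T (2 ^ r k) m / 2)" for k
    unfolding gap_def m_def by (rule entropy_gap_cm_density) simp
  have gap0: "0 \<le> gap k w" for k w
    using gibbs_gap_nonneg[OF D_nonneg, of w "ln (cm_density T (2 ^ r k) m w)"] cm_density_pos[of T "2 ^ r k" m w]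
    by (simp add: gap_def)
  have "(\<lambda>k. energy T (2 ^ r k) m) \<longlonglongrightarrow> 2 * rel_entropy"
    using LIMSEQ_subseq_LIMSEQ[OF lim Z(3)] by (simp add: comp_def m_def)
  then have "(\<lambda>k. rel_entropy - energy T (2 ^ r k) m / 2) \<longlonglongrightarrow> rel_entropy - 2 * rel_entropy / 2"
    by (intro tendsto_intros) auto
  then have "(\<lambda>k. \<integral>w. norm (gap k w) \<partial>\<mu>0) \<longlonglongrightarrow> 0"
    using has_bochner_integral_integral_eq[OF gap] gap0 by simp
  moreover have "integrable \<mu>0 (gap k)" for k
    using gap by (auto simp: has_bochner_integral_iff)
  ultimately obtain q where q: "strict_mono q" "AE w in \<mu>0. (\<lambda>k. gap (q k) w) \<longlonglongrightarrow> 0"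
    using tendsto_L1_AE_subseq[of \<mu>0 gap] by blast
  have "AE w in \<mu>0. ennreal (Z w) = ennreal (D w)"
    using Z(4) q(2) pos
  proof eventually_elim
    case (elim w)
    have "(\<lambda>k. cm_density T (2 ^ r (q k)) m w) \<longlonglongrightarrow> Z w"
      using LIMSEQ_subseq_LIMSEQ[OF elim(1) q(1)] by (simp add: comp_def)
    then have "Z w = D w"
      using elim(2,3) unfolding gap_def by (intro gibbs_gap_tendsto_0[of "D w" "\<lambda>k. cm_density T (2 ^ r (q k)) m w"] cm_density_pos)
    then show ?case by simp
  qed
  then have "density \<mu>0 (\<lambda>w. ennreal (Z w)) = density \<mu>0 (\<lambda>w. ennreal (D w))"
    using Z(1) by (intro density_cong) auto
  then show ?thesis
    using Z(5) density_D by (simp add: m_def)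
qed

end

end

section \<open>State independent drifts\<close>

lemma brownian_motion_cong:
  assumes bm: "brownian_motion T M X" and M: "sets M = sets (C0_borel T)" "0 < T"
    and eq: "\<And>t w. t \<in> {0..T} \<Longrightarrow> w \<in> C0 T \<Longrightarrow> X t w = Y t w"
  shows "brownian_motion T M Y"
  unfolding brownian_motion_def
proof (intro conjI ballI allI impI)
  have sp: "space M = C0 T"
    using sets_eq_imp_space_eq[OF M(1)] by simp
  show "Y t \<in> borel_measurable (path_filtration T t)" if t: "t \<in> {0..T}" for t
  proof -
    have "X t \<in> borel_measurable (path_filtration T t)"
      using bm t by (simp add: brownian_motion_def)
    moreover have "X t \<in> borel_measurable (path_filtration T t) \<longleftrightarrow> Y t \<in> borel_measurable (path_filtration T t)"
      by (rule measurable_cong) (use eq[OF t] in simp)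
    ultimately show ?thesis by simp
  qed
  have ae: "AE w in M. \<forall>t\<in>{0..T}. X t w = Y t w"
    by (rule AE_I2) (use eq sp in simp)
  have "AE w in M. X 0 w = 0"
    using bm by (simp add: brownian_motion_def)
  with ae show "AE w in M. Y 0 w = 0"
    by eventually_elim (use M(2) in auto)
  have "AE w in M. continuous_on {0..T} (\<lambda>t. X t w)"
    using bm by (simp add: brownian_motion_def)
  with ae show "AE w in M. continuous_on {0..T} (\<lambda>t. Y t w)"
  proof eventually_elim
    case (elim w)
    show ?case
      by (rule continuous_on_eq[OF elim(2)]) (use elim(1) in auto)
  qed
  fix s t assume st: "0 \<le> s \<and> s < t \<and> t \<le> T"
  have d: "X t w - X s w = Y t w - Y s w" if "w \<in> space M" for w
    using that st eq[of t w] eq[of s w] by (simp add: sp)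
  have "distributed M lborel (\<lambda>w. X t w - X s w) (normal_density 0 (sqrt (t - s)))"
    "prob_space.indep_set M (sets (path_filtration T s)) (sets (vimage_algebra (space M) (\<lambda>w. X t w - X s w) borel))"
    using bm st by (auto simp: brownian_motion_def)
  moreover have "distr M lborel (\<lambda>w. X t w - X s w) = distr M lborel (\<lambda>w. Y t w - Y s w)"
    by (rule distr_cong) (use d in auto)
  moreover have "(\<lambda>w. X t w - X s w) \<in> measurable M lborel \<longleftrightarrow> (\<lambda>w. Y t w - Y s w) \<in> measurable M lborel"
    by (rule measurable_cong) (rule d)
  moreover have "vimage_algebra (space M) (\<lambda>w. X t w - X s w) borel = vimage_algebra (space M) (\<lambda>w. Y t w - Y s w) borel"
    by (rule vimage_algebra_cong) (use d in auto)
  ultimately show "distributed M lborel (\<lambda>w. Y t w - Y s w) (normal_density 0 (sqrt (t - s)))"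
    "prob_space.indep_set M (sets (path_filtration T s)) (sets (vimage_algebra (space M) (\<lambda>w. Y t w - Y s w) borel))"
    by (simp_all add: distributed_def)
qed

lemma set_integrable_of_square:
  fixes g :: "real \<Rightarrow> real"
  assumes "set_borel_measurable lborel {0..T} g" "set_integrable lborel {0..T} (\<lambda>s. (g s)\<^sup>2)"
  shows "set_integrable lborel {0..T} g"
  unfolding set_integrable_def
proof (rule Bochner_Integration.integrable_bound)
  have "integrable lborel (indicator {0..T} :: real \<Rightarrow> real)"
    by (simp add: emeasure_lborel_Icc_eq)
  then show "integrable lborel (\<lambda>s. indicator {0..T} s + indicator {0..T} s *\<^sub>R (g s)\<^sup>2)"
    using assms(2) by (simp add: set_integrable_def)
  show "(\<lambda>s. indicator {0..T} s *\<^sub>R g s) \<in> borel_measurable lborel"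
    using assms(1) by (simp add: set_borel_measurable_def)
  have "\<bar>x\<bar> \<le> 1 + x\<^sup>2" for x :: real
    using abs_le_power_mean[of 1 x] by (simp add: field_simps) 
  then show "AE s in lborel. norm (indicator {0..T} s *\<^sub>R g s) \<le>
      norm (indicator {0..T} s + indicator {0..T} s *\<^sub>R (g s)\<^sup>2)"
    by (intro AE_I2) (simp add: indicator_def)
qed

lemma nn_integral_deriv_primitive:
  fixes f g :: "real \<Rightarrow> real"
  assumes "0 < T" and g: "set_integrable lborel {0..T} g" and g2: "set_integrable lborel {0..T} (\<lambda>s. (g s)\<^sup>2)"
    and f: "\<And>t. t \<in> {0..T} \<Longrightarrow> f t = (LBINT s:{0..t}. g s)"
  shows "(\<integral>\<^sup>+s\<in>{0..T}. ennreal ((deriv f s)\<^sup>2) \<partial>lborel) = ennreal (LBINT s:{0..T}. (g s)\<^sup>2)"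
proof -
  have "(\<integral>\<^sup>+s\<in>{0..T}. ennreal ((deriv f s)\<^sup>2) \<partial>lborel) = (\<integral>\<^sup>+s. ennreal (indicator {0..T} s *\<^sub>R (g s)\<^sup>2) \<partial>lborel)"
  proof (rule nn_integral_cong_AE)
    show "AE s in lborel. ennreal ((deriv f s)\<^sup>2) * indicator {0..T} s = ennreal (indicator {0..T} s *\<^sub>R (g s)\<^sup>2)"
    proof -
      have "AE s in lborel. s \<in> {0..T} \<longrightarrow> (f has_real_derivative g s) (at s)"
        by (rule AE_has_derivative_primitive[OF assms(1) g f])
      then show ?thesis
        by eventually_elim (auto simp: indicator_def dest: DERIV_imp_deriv)
    qed
  qed
  also have "\<dots> = ennreal (LBINT s:{0..T}. (g s)\<^sup>2)"
    unfolding set_lebesgue_integral_def using g2 unfolding set_integrable_def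
    by (intro nn_integral_eq_integral) auto
  finally show ?thesis .
qed

context wiener_density
begin

lemma D_functional_primitive:
  assumes "integrable \<mu>0 (\<lambda>w. D w * ln (D w))"
    and g: "set_integrable lborel {0..T} g" "set_integrable lborel {0..T} (\<lambda>s. (g s)\<^sup>2)"
    and m: "\<And>t. t \<in> {0..T} \<Longrightarrow> mean_path \<mu> t = (LBINT s:{0..t}. g s)"
  shows "D_functional T \<mu>0 \<mu> = ereal (rel_entropy - (LBINT s:{0..T}. (g s)\<^sup>2) / 2)"
proof -
  have "0 \<le> (LBINT s:{0..T}. (g s)\<^sup>2)"
    unfolding set_lebesgue_integral_def by (intro Bochner_Integration.integral_nonneg) simp
  moreover have "(\<integral>\<^sup>+s\<in>{0..T}. ennreal ((deriv (mean_path \<mu>) s)\<^sup>2) \<partial>lborel) = ennreal (LBINT s:{0..T}. (g s)\<^sup>2)"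
    by (rule nn_integral_deriv_primitive[OF T_pos g m])
  ultimately show ?thesis
    unfolding D_functional_def D_KL_eq using assms(1) by (simp add: enn2ereal_ennreal)
qed

lemma D_functional_infinite:
  assumes "\<not> integrable \<mu>0 (\<lambda>w. D w * ln (D w))"
  shows "D_functional T \<mu>0 \<mu> = \<infinity>"
  using assms by (simp add: D_functional_def D_KL_eq)

text \<open>The number \<open>Q\<close> is the squared norm of the derivative of the mean path. It is at most the limit \<open>S\<close> of
the energies (in fact equal to it), and these are at most twice the entropy; so if \<open>Q\<close> equals twice
the entropy, then so does \<open>S\<close>.\<close>

lemma D_functional_finite:
  assumes fin: "integrable \<mu>0 (\<lambda>w. D w * ln (D w))"
  obtains Q S where "D_functional T \<mu>0 \<mu> = ereal (rel_entropy - Q / 2)" "Q \<le> S" "S \<le> 2 * rel_entropy"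
    "(\<lambda>n. energy T (2 ^ n) (mean_path \<mu>)) \<longlonglongrightarrow> S" "mean_path \<mu> \<in> W012 T"
proof -
  have le: "energy T (2 ^ n) (mean_path \<mu>) \<le> 2 * rel_entropy" for n
    by (rule energy_mean_path_le[OF fin]) simp
  define S where "S = (SUP n. energy T (2 ^ n) (mean_path \<mu>))"
  have bdd: "bdd_above (range (\<lambda>n. energy T (2 ^ n) (mean_path \<mu>)))"
    using le by (auto simp: bdd_above_def)
  have lim: "(\<lambda>n. energy T (2 ^ n) (mean_path \<mu>)) \<longlonglongrightarrow> S"
    unfolding S_def by (rule LIMSEQ_incseq_SUP[OF bdd incseq_energy[OF T_pos]])
  have S: "energy T (2 ^ n) (mean_path \<mu>) \<le> S" for n
    unfolding S_def by (rule cSUP_upper[OF UNIV_I bdd])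
  have S2: "S \<le> 2 * rel_entropy"
    unfolding S_def by (rule cSUP_least) (use le in auto)
  obtain g where g: "g \<in> borel_measurable lborel" "integrable lborel g"
    "integrable lborel (\<lambda>s. (g s)\<^sup>2)" "(\<integral>s. (g s)\<^sup>2 \<partial>lborel) \<le> S"
    "\<And>t. t \<in> {0..T} \<Longrightarrow> mean_path \<mu> t = (LBINT s:{0..t}. g s)" "\<And>s. s \<notin> {0..T} \<Longrightarrow> g s = 0"
    by (rule finite_energy_imp_primitive[OF T_pos continuous_on_mean_path[OF fin] mean_path_0[OF fin] S])
      (assumption | rule that)+
  have gs: "set_integrable lborel {0..T} g" "set_integrable lborel {0..T} (\<lambda>s. (g s)\<^sup>2)"
    unfolding set_integrable_def by (intro integrable_mult_indicator g; simp)+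
  define Q where "Q = (LBINT s:{0..T}. (g s)\<^sup>2)"
  have "D_functional T \<mu>0 \<mu> = ereal (rel_entropy - Q / 2)"
    unfolding Q_def by (rule D_functional_primitive[OF fin gs g(5)])
  moreover have "Q \<le> S"
  proof -
    have "Q = (\<integral>s. (g s)\<^sup>2 \<partial>lborel)"
      unfolding Q_def set_lebesgue_integral_def
      by (intro Bochner_Integration.integral_cong) (use g(6) in \<open>auto simp: indicator_def\<close>)
    with g(4) show ?thesis by simp
  qed
  moreover have "mean_path \<mu> \<in> W012 T"
    unfolding W012_def
    using gs g(1,5) by (intro CollectI exI[of _ g]) (auto simp: set_borel_measurable_def)
  ultimately show thesis
    using S2 lim by (intro that)
qed

text \<open>This direction of the entropy bound is lower semicontinuity. Let \<open>z\<close> be an approximate density. Under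
\<open>\<mu>\<close> the mean of \<open>ln z\<close> is one half of the energy and the mean of \<open>1 / z\<close> is \<open>1\<close>, by the law of the
increments. So Fatou's lemma can be applied to the nonnegative function \<open>ln z + 1 / z - 1\<close>. In the
limit the added terms still cancel, since \<open>1 / D\<close> has mean \<open>1\<close> under \<open>\<mu>\<close> when \<open>D\<close> is almost surely
positive.\<close>

lemma entropy_drifted_le:
  assumes f: "continuous_on {0..T} f" "f 0 = 0" and bound: "\<And>n. energy T (2 ^ n) f \<le> C"
    and bm: "brownian_motion T \<mu> (\<lambda>t w. w t - f t)" and pos: "AE w in \<mu>0. 0 < D w"
  shows "integrable \<mu>0 (\<lambda>w. D w * ln (D w))" "rel_entropy \<le> C / 2"
proof -
  have \<mu>: "\<mu> = shifted f"
    by (rule brownian_motion_drift_unique[OF T_pos prob_tilted sets_tilted bm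
        prob_space_shifted[OF f] sets_shifted brownian_motion_shifted[OF f]])
  obtain Z r where Z: "Z \<in> borel_measurable \<mu>0" "\<And>w. 0 \<le> Z w" "strict_mono r"
    "AE w in \<mu>0. (\<lambda>k. cm_density T (2 ^ r k) f w) \<longlonglongrightarrow> Z w"
    "density \<mu>0 (\<lambda>w. ennreal (Z w)) = shifted f"
    by (rule cameron_martin[OF f bound]) (assumption | rule that)+
  have "AE w in \<mu>0. ennreal (Z w) = ennreal (D w)"
    using Z(1,5) density_D \<mu> by (intro density_unique) auto
  then have ZD: "AE w in \<mu>0. Z w = D w"
    by eventually_elim (use Z(2) D_nonneg in simp)
  have AE_\<mu>: "AE w in \<mu>. P w" if "AE w in \<mu>0. P w" for P
    unfolding density_D[symmetric] using that by (subst AE_density) auto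
  define u where "u k w = ln (cm_density T (2 ^ r k) f w) + 1 / cm_density T (2 ^ r k) f w - 1" for k w
  have u: "has_bochner_integral \<mu> (u k) (energy T (2 ^ r k) f / 2)" for k
  proof -
    define N :: nat where "N = 2 ^ r k"
    have N: "0 < N" by (simp add: N_def)
    define E where "E = energy T N f"
    have inc: "has_bochner_integral \<mu> (\<lambda>w. incr T N w i) (incr T N f i)" if i: "i < N" for i
    proof -
      have st: "0 \<le> grid T N i" "grid T N i < grid T N (Suc i)" "grid T N (Suc i) \<le> T"
        using T_pos N i grid_mem[of T "Suc i" N] grid_mem[of T i N]
        by (auto simp: grid_def divide_strict_right_mono)
      define Y where "Y w = w (grid T N (Suc i)) - f (grid T N (Suc i)) - (w (grid T N i) - f (grid T N i))" for w
      have d: "distributed \<mu> lborel Y (normal_density 0 (sqrt (grid T N (Suc i) - grid T N i)))"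
        using bm st unfolding brownian_motion_def Y_def by blast
      have sq: "0 < sqrt (grid T N (Suc i) - grid T N i)"
        using st by simp
      have "integrable \<mu> Y"
        using distributed_integrable[OF d, of "\<lambda>x. x"] integrable_normal_moment_nz_1[OF sq] by simp
      then have "has_bochner_integral \<mu> Y 0"
        using tilted.normal_distributed_expectation[OF sq d] by (simp add: has_bochner_integral_iff)
      then have "has_bochner_integral \<mu> (\<lambda>w. Y w + incr T N f i) (0 + incr T N f i)"
        by (intro has_bochner_integral_add) (simp_all add: has_bochner_integral_iff tilted.prob_space)
      then show ?thesis
        by (simp add: Y_def incr_def)
    qed
    have "has_bochner_integral \<mu> (\<lambda>w. wiener_sum T N f w - E / 2) (wiener_sum T N f f - E / 2)"
      unfolding wiener_sum_def
      by (intro has_bochner_integral_diff has_bochner_integral_sum has_bochner_integral_mult_right inc)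
        (simp_all add: has_bochner_integral_iff tilted.prob_space)
    then have X: "has_bochner_integral \<mu> (\<lambda>w. ln (cm_density T N f w)) (E / 2)"
      unfolding wiener_sum_self[OF T_pos N] by (simp add: cm_density_def E_def)
    have cm: "cm_density T N f \<in> borel_measurable \<mu>"
      using measurable_cm_density[OF T_pos] measurable_cong_sets[OF sets_tilted refl] by blast
    have "has_bochner_integral \<mu> (\<lambda>w. 1 / cm_density T N f w) 1"
    proof (rule has_bochner_integral_nn_integral)
      have eq: "1 / cm_density T N f w =
          exp ((\<Sum>i<N. - slope T N f i * (incr T N w i - incr T N f i)) - (\<Sum>i<N. (- slope T N f i)\<^sup>2 * (T / N)) / 2)" for w
      proof -
        have "(\<Sum>i<N. - slope T N f i * (incr T N w i - incr T N f i)) = wiener_sum T N f f - wiener_sum T N f w"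
          unfolding wiener_sum_def sum_subtractf[symmetric] by (rule sum.cong) (simp_all add: algebra_simps)
        then have s1: "(\<Sum>i<N. - slope T N f i * (incr T N w i - incr T N f i)) = E - wiener_sum T N f w"
          unfolding wiener_sum_self[OF T_pos N] E_def .
        have s2: "(\<Sum>i<N. (- slope T N f i)\<^sup>2 * (T / N)) = E"
          by (simp add: E_def energy_def)
        have "E - wiener_sum T N f w - E / 2 = - (wiener_sum T N f w - E / 2)"
          by linarith
        then show ?thesis
          unfolding s1 s2 cm_density_def E_def[symmetric] by (simp only: exp_minus inverse_eq_divide)
      qed
      show "(\<integral>\<^sup>+w. ennreal (1 / cm_density T N f w) \<partial>\<mu>) = ennreal 1"
        unfolding eq using nn_integral_exp_increments[OF T_pos N prob_tilted sets_tilted bm, of "\<lambda>i. - slope T N f i"]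
        by simp
    qed (use cm cm_density_pos[THEN less_imp_le, of T N f] in auto)
    then have "has_bochner_integral \<mu> (\<lambda>w. ln (cm_density T N f w) + 1 / cm_density T N f w - 1) (E / 2 + 1 - 1)"
      by (intro has_bochner_integral_diff has_bochner_integral_add X)
        (simp_all add: has_bochner_integral_iff tilted.prob_space)
    then show ?thesis
      by (simp add: u_def[abs_def] N_def E_def)
  qed
  have nonneg: "0 \<le> ln x + 1 / x - 1" if "0 < x" for x :: real
    using ln_le_minus_one[of "1 / x"] that by (simp add: ln_div)
  have u0: "0 \<le> u k w" for k w
    unfolding u_def by (rule nonneg[OF cm_density_pos])
  have Dm: "D \<in> borel_measurable \<mu>"
    using D_meas by (simp add: measurable_cong_sets[OF sets_tilted refl] measurable_cong_sets[OF sets_wiener refl])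
  have pos\<mu>: "AE w in \<mu>. 0 < D w"
    by (rule AE_\<mu>[OF pos])
  define v where "v w = ln (D w) + 1 / D w - 1" for w
  have vm: "v \<in> borel_measurable \<mu>"
    unfolding v_def using Dm by measurable
  have v0: "AE w in \<mu>. 0 \<le> v w"
    using pos\<mu> unfolding v_def by eventually_elim (rule nonneg)
  have vle: "(\<integral>\<^sup>+w. ennreal (v w) \<partial>\<mu>) \<le> ennreal (C / 2)"
  proof (rule nn_integral_AE_limit_le)
    show "u k \<in> borel_measurable \<mu>" for k
      using u by (auto simp: has_bochner_integral_iff)
    show "AE w in \<mu>. (\<lambda>k. u k w) \<longlonglongrightarrow> v w"
      using AE_\<mu>[OF Z(4)] AE_\<mu>[OF ZD] pos\<mu>
      by eventually_elim (auto simp: u_def v_def intro!: tendsto_intros)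
    show "\<forall>\<^sub>F k in sequentially. (\<integral>\<^sup>+w. ennreal (u k w) \<partial>\<mu>) \<le> ennreal (C / 2)"
    proof (intro always_eventually allI)
      fix k
      have "(\<integral>\<^sup>+w. ennreal (u k w) \<partial>\<mu>) = ennreal (\<integral>w. u k w \<partial>\<mu>)"
        using u[of k] u0 by (intro nn_integral_eq_integral) (auto simp: has_bochner_integral_iff)
      also have "\<dots> \<le> ennreal (C / 2)"
        using has_bochner_integral_integral_eq[OF u[of k]] bound[of "r k"] by (intro ennreal_leI) simp
      finally show "(\<integral>\<^sup>+w. ennreal (u k w) \<partial>\<mu>) \<le> ennreal (C / 2)" .
    qed
  qed
  have vi: "integrable \<mu> v"
    by (rule integrableI_nonneg[OF vm v0]) (use vle in \<open>auto intro: le_less_trans[OF _ ennreal_less_top]\<close>)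
  have C: "0 \<le> C"
    using bound[of 0] energy_nonneg[OF T_pos, of "2 ^ 0" f] by linarith
  have vC: "(\<integral>w. v w \<partial>\<mu>) \<le> C / 2"
    using vle C unfolding nn_integral_eq_integral[OF vi v0] by simp
  have inv: "has_bochner_integral \<mu> (\<lambda>w. 1 / D w) 1"
  proof -
    have m: "(\<lambda>w. 1 / D w) \<in> borel_measurable \<mu>0"
      by measurable
    have ae: "AE w in \<mu>0. D w * (1 / D w) = 1"
      using pos by eventually_elim simp
    have "integrable \<mu>0 (\<lambda>w. D w * (1 / D w)) \<longleftrightarrow> integrable \<mu>0 (\<lambda>w. 1 :: real)"
      by (rule integrable_cong_AE[OF _ _ ae]) auto
    moreover have "(\<integral>w. D w * (1 / D w) \<partial>\<mu>0) = (\<integral>w. 1 \<partial>\<mu>0)"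
      by (rule integral_cong_AE[OF _ _ ae]) auto
    ultimately show ?thesis
      unfolding has_bochner_integral_iff integrable_tilted[OF m] integral_tilted[OF m] by (simp add: prob_space)
  qed
  have "has_bochner_integral \<mu> (\<lambda>w. v w - 1 / D w + 1) ((\<integral>w. v w \<partial>\<mu>) - 1 + 1)"
    using vi inv by (intro has_bochner_integral_add has_bochner_integral_diff)
      (simp_all add: has_bochner_integral_iff tilted.prob_space)
  then have "has_bochner_integral \<mu> (\<lambda>w. ln (D w)) (\<integral>w. v w \<partial>\<mu>)"
    by (simp add: v_def)
  moreover have lm: "(\<lambda>w. ln (D w)) \<in> borel_measurable \<mu>0"
    by measurable
  ultimately show "integrable \<mu>0 (\<lambda>w. D w * ln (D w))" "rel_entropy \<le> C / 2"
    using vC unfolding rel_entropy_def has_bochner_integral_iff integrable_tilted[OF lm] integral_tilted[OF lm] by simp_all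
qed

lemma mean_path_drifted:
  assumes bm: "brownian_motion T \<mu> (\<lambda>t w. w t - f t)" and f: "f 0 = 0" and t: "t \<in> {0..T}"
  shows "mean_path \<mu> t = f t"
proof (cases "t = 0")
  case True
  have "mean_path \<mu> t = (\<integral>w. 0 \<partial>\<mu>)"
    unfolding mean_path_def by (intro Bochner_Integration.integral_cong refl) (use C0_at_0 True in \<open>simp add: space_tilted\<close>)
  then show ?thesis using True f by simp
next
  case False
  define Y where "Y w = w t - f t - (w 0 - f 0)" for w
  have st: "0 \<le> (0::real)" "0 < t" "t \<le> T"
    using t False by auto
  have d: "distributed \<mu> lborel Y (normal_density 0 (sqrt (t - 0)))"
    using bm st unfolding brownian_motion_def Y_def by blast
  have sq: "0 < sqrt (t - 0)"
    using st by simp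
  have "integrable \<mu> Y"
    using distributed_integrable[OF d, of "\<lambda>x. x"] integrable_normal_moment_nz_1[OF sq] by simp
  moreover have "mean_path \<mu> t = (\<integral>w. Y w + f t \<partial>\<mu>)"
    unfolding mean_path_def
    by (intro Bochner_Integration.integral_cong refl) (use C0_at_0 f in \<open>simp add: space_tilted Y_def\<close>)
  ultimately show ?thesis
    using tilted.normal_distributed_expectation[OF sq d] by (simp add: tilted.prob_space)
qed

lemma D_functional_drift_le:
  assumes F: "drift_of T \<mu> F" "state_independent T F" and pos: "AE w in \<mu>0. 0 < D w"
  shows "D_functional T \<mu>0 \<mu> \<le> 0"
proof -
  obtain f0 where f0: "\<And>w t. w \<in> C0 T \<Longrightarrow> t \<in> {0..T} \<Longrightarrow> F t w = f0 t"
    using F(2) unfolding state_independent_def by blast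
  have "AE w in \<mu>. (\<lambda>t. F t w) \<in> W012 T"
    using F(1) by (simp add: drift_of_def)
  have "\<exists>w\<in>space \<mu>. (\<lambda>t. F t w) \<in> W012 T"
  proof (rule ccontr)
    assume none: "\<not> (\<exists>w\<in>space \<mu>. (\<lambda>t. F t w) \<in> W012 T)"
    have "AE w in \<mu>. False"
      using \<open>AE w in \<mu>. (\<lambda>t. F t w) \<in> W012 T\<close> AE_space[of \<mu>]
    proof eventually_elim
      case (elim w)
      with none show ?case by blast
    qed
    then show False
      by (simp add: tilted.AE_False)
  qed
  then obtain w where w: "w \<in> C0 T" "(\<lambda>t. F t w) \<in> W012 T"
    by (auto simp: space_tilted)
  then obtain g where g: "set_borel_measurable lborel {0..T} g" "set_integrable lborel {0..T} (\<lambda>s. (g s)\<^sup>2)"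
    "\<And>t. t \<in> {0..T} \<Longrightarrow> F t w = (LBINT s:{0..t}. g s)"
    unfolding W012_def by blast
  have g1: "set_integrable lborel {0..T} g"
    by (rule set_integrable_of_square[OF g(1,2)])
  define f where "f t = (LBINT s:{0..t}. g s)" for t
  have Ff: "F t v = f t" if "v \<in> C0 T" "t \<in> {0..T}" for v t
    using f0[OF that] f0[OF w(1) that(2)] g(3)[OF that(2)] by (simp add: f_def)
  have f_eq: "f t = integral {0..t} g" if "t \<in> {0..T}" for t
    unfolding f_def using that by (intro set_borel_integral_eq_integral(2) set_integrable_subset[OF g1]) auto
  have f_0: "f 0 = 0"
    using f_eq[of 0] T_pos by simp
  have f_cont: "continuous_on {0..T} f"
  proof (rule continuous_on_eq)
    show "continuous_on {0..T} (\<lambda>t. integral {0..t} g)"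
      by (intro indefinite_integral_continuous_1 set_borel_integral_eq_integral(1) g1)
  qed (simp add: f_eq)
  have "brownian_motion T \<mu> (\<lambda>t w. w t - F t w)"
    using F(1) by (simp add: drift_of_def)
  then have bm: "brownian_motion T \<mu> (\<lambda>t w. w t - f t)"
    by (rule brownian_motion_cong[OF _ sets_tilted T_pos]) (simp add: Ff)
  have bound: "energy T (2 ^ n) f \<le> (LBINT s:{0..T}. (g s)\<^sup>2)" for n
    by (rule energy_le_primitive[OF T_pos _ g1 g(2)]) (simp_all add: f_def)
  note H = entropy_drifted_le[OF f_cont f_0 bound bm pos]
  have "mean_path \<mu> t = (LBINT s:{0..t}. g s)" if "t \<in> {0..T}" for t
    using mean_path_drifted[OF bm f_0 that] by (simp add: f_def)
  from D_functional_primitive[OF H(1) g1 g(2) this] H(2)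
  show "D_functional T \<mu>0 \<mu> \<le> 0"
    by simp
qed

lemma drift_of_shifted:
  assumes f: "continuous_on {0..T} f" "f 0 = 0" "f \<in> W012 T" and \<mu>: "\<mu> = shifted f"
  shows "drift_of T \<mu> (\<lambda>t w. f t)"
  unfolding drift_of_def progressively_measurable_def
proof (intro conjI ballI)
  fix t assume t: "t \<in> {0..T}"
  have "continuous_on {0..t} f"
    using f(1) by (rule continuous_on_subset) (use t in auto)
  then have "f \<in> borel_measurable (restrict_space borel {0..t})"
    by (rule borel_measurable_continuous_on_restrict)
  then have "(\<lambda>x. f (fst x)) \<in> borel_measurable (restrict_space borel {0..t} \<Otimes>\<^sub>M path_filtration T t)"
    by (rule measurable_compose[OF measurable_fst])
  then show "(\<lambda>(s, w). f s) \<in> borel_measurable (restrict_space borel {0..t} \<Otimes>\<^sub>M path_filtration T t)"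
    by (simp add: case_prod_unfold)
next
  show "AE w in \<mu>. f \<in> W012 T"
    using f(3) by simp
  show "brownian_motion T \<mu> (\<lambda>t w. w t - f t)"
    unfolding \<mu> by (rule brownian_motion_shifted[OF f(1,2)])
qed

lemma D_functional_properties:
  assumes pos: "AE w in \<mu>0. 0 < D w"
  shows "0 \<le> D_functional T \<mu>0 \<mu>"
    and "D_functional T \<mu>0 \<mu> = 0 \<longleftrightarrow> (\<exists>F. drift_of T \<mu> F \<and> state_independent T F)"
proof -
  have "0 \<le> D_functional T \<mu>0 \<mu> \<and>
    (D_functional T \<mu>0 \<mu> = 0 \<longrightarrow> (\<exists>F. drift_of T \<mu> F \<and> state_independent T F))"
  proof (cases "integrable \<mu>0 (\<lambda>w. D w * ln (D w))")
    case False
    then show ?thesis by (simp add: D_functional_infinite)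
  next
    case True
    obtain Q S where QS: "D_functional T \<mu>0 \<mu> = ereal (rel_entropy - Q / 2)" "Q \<le> S" "S \<le> 2 * rel_entropy"
      "(\<lambda>n. energy T (2 ^ n) (mean_path \<mu>)) \<longlonglongrightarrow> S" "mean_path \<mu> \<in> W012 T"
      by (rule D_functional_finite[OF True]) (assumption | rule that)+
    have "\<exists>F. drift_of T \<mu> F \<and> state_independent T F" if "D_functional T \<mu>0 \<mu> = 0"
    proof -
      have "S = 2 * rel_entropy"
        using that QS(1-3) by simp
      then have "\<mu> = shifted (mean_path \<mu>)"
        using tilted_eq_shifted[OF True pos] QS(4) by simp
      then have "drift_of T \<mu> (\<lambda>t w. mean_path \<mu> t)"
        by (intro drift_of_shifted continuous_on_mean_path[OF True] mean_path_0[OF True] QS(5))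
      moreover have "state_independent T (\<lambda>t w. mean_path \<mu> t)"
        by (auto simp: state_independent_def)
      ultimately show ?thesis by blast
    qed
    moreover have "0 \<le> D_functional T \<mu>0 \<mu>"
      using QS(1-3) by simp
    ultimately show ?thesis by blast
  qed
  moreover have "D_functional T \<mu>0 \<mu> \<le> 0" if "drift_of T \<mu> F" "state_independent T F" for F
    by (rule D_functional_drift_le[OF that pos])
  ultimately show "0 \<le> D_functional T \<mu>0 \<mu>"
    "D_functional T \<mu>0 \<mu> = 0 \<longleftrightarrow> (\<exists>F. drift_of T \<mu> F \<and> state_independent T F)"
    by (blast, blast intro: antisym)
qed

end

lemma (in wiener_space) equivalent_density:
  assumes "\<mu> \<in> equivalent_measures T \<mu>0"
  obtains D where "wiener_density T \<mu>0 \<mu> D" "AE w in \<mu>0. 0 < D w"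
proof -
  have \<mu>: "prob_space \<mu>" "sets \<mu> = sets \<mu>0" "absolutely_continuous \<mu>0 \<mu>" "absolutely_continuous \<mu> \<mu>0"
    using assms sets_wiener by (auto simp: equivalent_measures_def)
  interpret M: prob_space \<mu> by fact
  obtain D where D: "D \<in> borel_measurable \<mu>0" "AE w in \<mu>0. RN_deriv \<mu>0 \<mu> w = ennreal (D w)"
    "AE w in \<mu>. 0 < D w" "\<And>w. 0 \<le> D w"
    by (rule real_RN_deriv[OF M.finite_measure_axioms \<mu>(3,2)]) (assumption | rule that)+
  have "density \<mu>0 (\<lambda>w. ennreal (D w)) = density \<mu>0 (RN_deriv \<mu>0 \<mu>)"
    using D(1,2) by (intro density_cong) (auto elim: eventually_mono)
  also have "\<dots> = \<mu>"
    by (rule density_RN_deriv[OF \<mu>(3,2)])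
  finally have dens: "density \<mu>0 (\<lambda>w. ennreal (D w)) = \<mu>" .
  have "wiener_density T \<mu>0 \<mu> D"
    by unfold_locales (use D dens \<mu> in auto)
  moreover have "AE w in \<mu>0. 0 < D w"
    using absolutely_continuous_AE[OF \<mu>(2)[symmetric] \<mu>(4) D(3)] .
  ultimately show thesis
    by (rule that)
qed

theorem proposition4p1:
  fixes T :: real and \<mu>0 :: "(real \<Rightarrow> real) measure"
  assumes "0 < T"
    and "wiener_measure T \<mu>0"
  shows "\<forall>\<mu>\<in>equivalent_measures T \<mu>0.
           0 \<le> D_functional T \<mu>0 \<mu> \<and>
           (D_functional T \<mu>0 \<mu> = 0 \<longleftrightarrow> (\<exists>F. drift_of T \<mu> F \<and> state_independent T F))"
proof
  interpret wiener_space T \<mu>0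
    by (rule wiener_space.intro[OF assms])
  fix \<mu> assume "\<mu> \<in> equivalent_measures T \<mu>0"
  then obtain D where D: "wiener_density T \<mu>0 \<mu> D" "AE w in \<mu>0. 0 < D w"
    by (rule equivalent_density)
  from wiener_density.D_functional_properties[OF D]
  show "0 \<le> D_functional T \<mu>0 \<mu> \<and>
      (D_functional T \<mu>0 \<mu> = 0 \<longleftrightarrow> (\<exists>F. drift_of T \<mu> F \<and> state_independent T F))"
    by blast
qed

end
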